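(* Let the base point be the corner $(x_i^*,y_j^* )=(x_i,y_j)=(x_0,y_0)=(l_1,l_3)=\overline{\Gamma_1}\cap\overline{\Gamma_3}$. Then the following 4-point scheme centered at $(x_0,y_0)$, $$h^{-1}\mathcal{L}_hu_h:=h^{-1}\sum_{k=0}^1\sum_{\ell=0}^1C_{k,\ell}(u_h)_{k,\ell}=\sum_{(m,n)\in\Lambda_4}f^{(m,n)}J_{m,n}+\sum_{n=0}^5g_1^{(n)}J_{g_1,n}+\sum_{m=0}^5g_3^{(m)}J_{g_3,m},$$ achieves the sixth-order consistency for $\frac{\partial u}{\partial\vec n}+\alpha u=g_1$ and $\frac{\partial u}{\partial\vec n}+\beta u=g_3$ at the point $(x_0,y_0)$, where $$C_{k,\ell}:=\hat C_{k,\ell}+\tilde C_{k,\ell},\quad c_{k,\ell,p}:=\hat c_{k,\ell,p}+\tilde c_{k,\ell,p},\quad \hat C_{k,\ell}:=\sum_{p=0}^6\hat c_{k,\ell,p}h^p,\quad\tilde C_{k,\ell}:=\sum_{p=0}^6\tilde c_{k,\ell,p}h^p,$$ $\{\hat c_{k,\ell,p}\}$ and $\{\tilde c_{k,\ell,p}\}$ ($k,\ell\in\{0,1\}$, $p=0,\ldots,6$, real) form any nontrivial solution of the linear system induced by $$\sum_{k=0}^1\sum_{\ell=0}^1\Big(\hat C_{k,\ell}E_n(kh,\ell h)+\tilde C_{k,\ell}\sum_{m=0}^6p_{m,n}\tilde E_m(kh,\ell h)\Big)=\mathcal{O}(h^7)\qquad\text{for }n=0,\ldots,6,$$ and $$J_{m,n}=h^{-1}\sum_{k=0}^1\sum_{\ell=0}^1\Big(\hat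 C_{k,\ell}H_{6,m,n}(kh,\ell h)+\tilde C_{k,\ell}\Big(\tilde H_{6,m,n}(kh,\ell h)+\sum_{i=0}^6\nu_{i,m,n}\tilde E_i(kh,\ell h)\Big)\Big),$$ $$J_{g_1,n}=-h^{-1}\sum_{k=0}^1\sum_{\ell=0}^1\Big(\hat C_{k,\ell}G_{6,1,n}(kh,\ell h)+\tilde C_{k,\ell}\sum_{m=0}^6\mu_{m,n}\tilde E_m(kh,\ell h)\Big),\qquad J_{g_3,m}=-h^{-1}\sum_{k=0}^1\sum_{\ell=0}^1\tilde C_{k,\ell}\tilde G_{6,m,1}(kh,\ell h).$$ The linear system for $\{\hat c_{k,\ell,p}\}$, $\{\tilde c_{k,\ell,p}\}$ induced by $\sum_{k=0}^1\sum_{\ell=0}^1\big(\hat C_{k,\ell}E_n(kh,\ell h)+\tilde C_{k,\ell}\sum_{m=0}^6p_{m,n}\tilde E_m(kh,\ell h)\big)=\mathcal{O}(h^7)$, $n=0,\ldots,6$, always has nontrivial solutions. Furthermore: (i) one necessary condition for $\{C_{k,\ell}\}$ in this scheme to satisfy $\sum_{k=0}^1\sum_{\ell=0}^1c_{k,\ell,p}\ge0$ for all $p=0,\ldots,6$ is $\alpha(y_0)+\beta(x_0)\ge0$; (ii) if $\alpha(y_0)+\beta(x_0)\ge0$, there must exist a nontrivial solution $\{\hat c_{k,\ell,p}\}$, $\{\tilde c_{k,\ell,p}\}$ of the linear system induced by $\sum_{k=0}^1\sum_{\ell=0}^1\big(\hat C_{k,\ell}E_n(kh,\ell h)+\tilde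 C_{k,\ell}\sum_{m=0}^6p_{m,n}\tilde E_m(kh,\ell h)\big)=\mathcal{O}(h^7)$, $n=0,\ldots,6$, such that $\{C_{k,\ell}\}$ satisfies, for every mesh size $h>0$, the sign condition $C_{0,0}>0$, $C_{k,\ell}\le0$ for $(k,\ell)\ne(0,0)$, and the sum condition $\sum_{k=0}^1\sum_{\ell=0}^1C_{k,\ell}\ge0$.
   Context: **Problem.** $\Omega=(l_1,l_2)\times(l_3,l_4)$ with $l_4-l_3=N_0(l_2-l_1)$, $N_0\in\mathbb{N}$; $\Gamma\subset\Omega$ is a (possibly empty) smooth interface curve. The function $u$ satisfies $-\nabla\cdot(a\nabla u)=f$ in $\Omega\setminus\Gamma$ with scalar variable coefficient $a>0$. On $\Gamma_1=\{l_1\}\times(l_3,l_4)$: $\frac{\partial u}{\partial\vec n}+\alpha u=g_1$, i.e. $-u_x+\alpha u=g_1$; on $\Gamma_3=(l_1,l_2)\times\{l_3\}$: $\frac{\partial u}{\partial\vec n}+\beta u=g_3$, i.e. $-u_y+\beta u=g_3$ ($\vec n$ outward normal; $\alpha,g_1$ are functions of $y$ and $\beta,g_3$ functions of $x$). Away from $\Gamma$, on each side, $a$, $u$, $f$ have uniformly continuous partial derivatives of total orders up to six, seven and five, respectively; $\alpha,\beta,g_1,g_3$ have uniformly continuous derivatives up to order five. The four stencil points lie on one side of $\Gamma$, and $a,u,f$ below are those of that side; derivatives at the corner are by continuous extension. **Grid.** For $N_1\in\mathbb{N}$, $h=(l_2-l_1)/N_1$, $x_i=l_1+ih$, $y_j=l_3+jh$.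 $(u_h)_{i,j}$ is the numerical approximation of $u(x_i,y_j)$. **Notation.** $a^{(m,n)},u^{(m,n)},f^{(m,n)}$ are the partial derivatives $\partial_x^m\partial_y^n$ at the base point $(x_0,y_0)$ (similarly for $(1/a)^{(m,n)}$, $(a_x/a)^{(m,n)}$, $(a_y/a)^{(m,n)}$); $\alpha^{(n)},g_1^{(n)}$ are $n$th $y$-derivatives of $\alpha,g_1$ at $y_0$; $\beta^{(m)},g_3^{(m)}$ are $m$th $x$-derivatives of $\beta,g_3$ at $x_0$. $\Lambda_K=\{(m,n)\in\mathbb{N}_0^2:m+n\le K\}$, $\Lambda_K^1=\{(m,n)\in\Lambda_K:m\in\{0,1\}\}$, $\Lambda_K^2=\Lambda_K\setminus\Lambda_K^1$; $\delta_{n,6}=1$ if $n=6$ and $0$ otherwise. **Coefficients $a^u,a^f$ (reduction of $x$-derivatives).** These are the coefficients in $u^{(p,q)}=\sum_{(m,n)\in\Lambda_{p+q}^1}a^u_{p,q,m,n}u^{(m,n)}+\sum_{(m,n)\in\Lambda_{p+q-2}}a^f_{p,q,m,n}f^{(m,n)}$ obtained by repeatedly using the differentiated equation. Explicitly: if $p\in\{0,1\}$, then $a^u_{p,q,m,n}=1$ when $(m,n)=(p,q)$ and $0$ otherwise, and $a^f_{p,q,m,n}=0$; for $p\ge2$, recursively in $p$, both $w=a^u_{\cdot,\cdot,m,n}$ and $w=a^f_{\cdot,\cdot,m,n}$ satisfy $$w_{p,q}=-\epsilon_{p,q}-w_{p-2,q+2}-\sum_{\mathsf i=0}^{p-2}\sum_{\mathsf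 j=0}^{q}\binom{p-2}{\mathsf i}\binom{q}{\mathsf j}\Big[\big(\tfrac{a_x}{a}\big)^{(p-2-\mathsf i,q-\mathsf j)}w_{\mathsf i+1,\mathsf j}+\big(\tfrac{a_y}{a}\big)^{(p-2-\mathsf i,q-\mathsf j)}w_{\mathsf i,\mathsf j+1}\Big],$$ with $\epsilon_{p,q}=0$ for $a^u$, and for $a^f$, $\epsilon_{p,q}=\binom{p-2}{m}\binom qn(1/a)^{(p-2-m,q-n)}$ if $m\le p-2$, $n\le q$, and $0$ otherwise. **Coefficients $\tilde a^u,\tilde a^f$ (reduction of $y$-derivatives).** These are defined in the same way with the roles of $x$ and $y$ exchanged, i.e. $u^{(p,q)}=\sum_{m+n\le p+q,\,n\in\{0,1\}}\tilde a^u_{p,q,m,n}u^{(m,n)}+\sum_{(m,n)\in\Lambda_{p+q-2}}\tilde a^f_{p,q,m,n}f^{(m,n)}$: if $q\in\{0,1\}$, $\tilde a^u_{p,q,m,n}=1$ when $(m,n)=(p,q)$ and $0$ otherwise, and $\tilde a^f_{p,q,m,n}=0$; for $q\ge2$, recursively in $q$, $$w_{p,q}=-\tilde\epsilon_{p,q}-w_{p+2,q-2}-\sum_{\mathsf i=0}^{p}\sum_{\mathsf j=0}^{q-2}\binom{p}{\mathsf i}\binom{q-2}{\mathsf j}\Big[\big(\tfrac{a_x}{a}\big)^{(p-\mathsf i,q-2-\mathsf j)}w_{\mathsf i+1,\mathsf j}+\big(\tfrac{a_y}{a}\big)^{(p-\mathsf i,q-2-\mathsf j)}w_{\mathsf i,\mathsf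 j+1}\Big],$$ with $\tilde\epsilon_{p,q}=0$ for $\tilde a^u$, and for $\tilde a^f$, $\tilde\epsilon_{p,q}=\binom pm\binom{q-2}n(1/a)^{(p-m,q-2-n)}$ if $m\le p$, $n\le q-2$, and $0$ otherwise. **Functions.** $$G_{6,m,n}=\sum_{(p,q)\in\Lambda_6}\frac{a^u_{p,q,m,n}}{p!q!}x^py^q,\quad H_{6,m,n}=\sum_{(p,q)\in\Lambda_6^2}\frac{a^f_{p,q,m,n}}{p!q!}x^py^q,\quad \tilde G_{6,m,n}=\sum_{(q,p)\in\Lambda_6}\frac{\tilde a^u_{p,q,m,n}}{p!q!}x^py^q,\quad \tilde H_{6,m,n}=\sum_{(q,p)\in\Lambda_6^2}\frac{\tilde a^f_{p,q,m,n}}{p!q!}x^py^q,$$ $$E_n(x,y)=G_{6,0,n}(x,y)+(1-\delta_{n,6})\sum_{i=n}^5\binom in\alpha^{(i-n)}G_{6,1,i}(x,y),\quad \tilde E_m(x,y)=\tilde G_{6,m,0}(x,y)+(1-\delta_{m,6})\sum_{i=m}^5\binom im\beta^{(i-m)}\tilde G_{6,i,1}(x,y),$$ $$\lambda_{m,n}=a^u_{m,0,0,n},\quad\mu_{m,n}=a^u_{m,0,1,n},\quad\nu_{m,i,j}=a^f_{m,0,i,j},\quad p_{m,n}=\lambda_{m,n}+(1-\delta_{n,6})\sum_{i=n}^5\binom in\alpha^{(i-n)}\mu_{m,i}.$$ **Terminology.** The system "$=\mathcal{O}(h^7)$" means that the left-hand sides, which are polynomials in $h$, have vanishing coefficients of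 $h^0,\ldots,h^6$. "Nontrivial" means $c_{k,\ell,0}\neq0$ for at least one $(k,\ell)$. "Sixth-order consistency" means that, replacing $(u_h)_{k,\ell}$ by the exact values $u(x_0+kh,y_0+\ell h)$, the difference between the left-hand and right-hand sides of the scheme is $\mathcal{O}(h^6)$ as $h\to0$ (with the $\hat c_{k,\ell,p},\tilde c_{k,\ell,p}$ fixed).
   Formalization: (i) also assumes C_{0,0}>0 for small h, since flipping the sign of a solution refutes it. (ii) if α(y_0)+β(x_0)=0, the sum condition is claimed only when some nontrivial solution has C_{0,0}>0 and nonnegative sum for small h; it fails e.g. for a=1, α=0, β=-(x-l_1). *)

theory Defs
  imports "HOL-Analysis.Analysis" "HOL-Library.Landau_Symbols"
begin

subsection \<open>Partial derivatives, regularity, boundary values\<close>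

definition pdx :: "(real \<times> real \<Rightarrow> real) \<Rightarrow> real \<times> real \<Rightarrow> real" where
  "pdx F = (\<lambda>(x, y). deriv (\<lambda>s. F (s, y)) x)"

definition pdy :: "(real \<times> real \<Rightarrow> real) \<Rightarrow> real \<times> real \<Rightarrow> real" where
  "pdy F = (\<lambda>(x, y). deriv (\<lambda>t. F (x, t)) y)"

definition pd :: "nat \<Rightarrow> nat \<Rightarrow> (real \<times> real \<Rightarrow> real) \<Rightarrow> real \<times> real \<Rightarrow> real" where
  "pd m n F = (pdx ^^ m) ((pdy ^^ n) F)"

text \<open>All partial derivatives of total order at most \<open>k\<close> (in any order of differentiation) exist
  and are uniformly continuous on the open set \<open>S\<close>.\<close>

primrec uCk :: "nat \<Rightarrow> (real \<times> real) set \<Rightarrow> (real \<times> real \<Rightarrow> real) \<Rightarrow> bool" where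
  "uCk 0 S F \<longleftrightarrow> uniformly_continuous_on S F"
| "uCk (Suc k) S F \<longleftrightarrow> uniformly_continuous_on S F
     \<and> (\<forall>(x, y)\<in>S. (\<lambda>s. F (s, y)) differentiable (at x) \<and> (\<lambda>t. F (x, t)) differentiable (at y))
     \<and> uCk k S (pdx F) \<and> uCk k S (pdy F)"

primrec uCk1 :: "nat \<Rightarrow> real set \<Rightarrow> (real \<Rightarrow> real) \<Rightarrow> bool" where
  "uCk1 0 I \<phi> \<longleftrightarrow> uniformly_continuous_on I \<phi>"
| "uCk1 (Suc k) I \<phi> \<longleftrightarrow> uniformly_continuous_on I \<phi>
     \<and> (\<forall>x\<in>I. \<phi> differentiable (at x)) \<and> uCk1 k I (deriv \<phi>)"

text \<open>Value at a point \<open>P\<close> of the closure of \<open>S\<close> of the continuous extension of \<open>F\<close> from \<open>S\<close>.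
  For \<open>P\<close> in an open \<open>S\<close> and \<open>F\<close> continuous on \<open>S\<close> this is just \<open>F P\<close>.\<close>

definition cext :: "'a::topological_space set \<Rightarrow> ('a \<Rightarrow> real) \<Rightarrow> 'a \<Rightarrow> real" where
  "cext S F P = Lim (at P within S) F"

subsection \<open>Interface and sides\<close>

text \<open>A smooth (one-dimensional, embedded) curve in \<open>\<Omega>\<close>, given locally as a regular level set; possibly
  empty, possibly with several branches. Uniform continuity of the derivatives of \<open>\<psi>\<close> is no
  restriction, since the neighbourhood \<open>U\<close> may be shrunk.\<close>

definition interface_curve :: "(real \<times> real) set \<Rightarrow> (real \<times> real) set \<Rightarrow> bool" where
  "interface_curve \<Omega> \<Gamma> \<longleftrightarrow> \<Gamma> \<subseteq> \<Omega> \<and> closedin (top_of_set \<Omega>) \<Gamma>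
     \<and> (\<forall>P\<in>\<Gamma>. \<exists>U \<psi>. open U \<and> P \<in> U \<and> U \<subseteq> \<Omega> \<and> (\<forall>k. uCk k U \<psi>)
          \<and> (pdx \<psi> P \<noteq> 0 \<or> pdy \<psi> P \<noteq> 0) \<and> \<Gamma> \<inter> U = {Q \<in> U. \<psi> Q = 0})"

definition sides :: "(real \<times> real) set \<Rightarrow> (real \<times> real) set \<Rightarrow> (real \<times> real) set set" where
  "sides \<Omega> \<Gamma> = components (\<Omega> - \<Gamma>)"

text \<open>A point of the closed domain lies on the side \<open>S\<close> if, near that point, \<open>\<Omega>\<close> consists of \<open>S\<close> only;
  for boundary points this excludes the points where the interface reaches the boundary.\<close>

definition on_side :: "(real \<times> real) set \<Rightarrow> (real \<times> real) set \<Rightarrow> real \<times> real \<Rightarrow> bool" where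
  "on_side \<Omega> S P \<longleftrightarrow> P \<in> closure \<Omega> \<and> (\<exists>\<epsilon>>0. ball P \<epsilon> \<inter> \<Omega> \<subseteq> S)"

subsection \<open>Index sets and reduction coefficients\<close>

definition Lam :: "nat \<Rightarrow> (nat \<times> nat) set" where
  "Lam K = {(m, n). m + n \<le> K}"

definition Lam1 :: "nat \<Rightarrow> (nat \<times> nat) set" where
  "Lam1 K = {(m, n). (m, n) \<in> Lam K \<and> m \<in> {0, 1}}"

definition Lam2 :: "nat \<Rightarrow> (nat \<times> nat) set" where
  "Lam2 K = Lam K - Lam1 K"

text \<open>In what follows \<open>A\<close>, \<open>B\<close>, \<open>R\<close> stand for the derivatives at the base point of \<open>a\<^sub>x/a\<close>, \<open>a\<^sub>y/a\<close> and
  \<open>1/a\<close> (\<open>A m n\<close> being the one of order \<open>m\<close> in \<open>x\<close> and \<open>n\<close> in \<open>y\<close>), and \<open>al n\<close>, \<open>be n\<close> for the \<open>n\<close>-th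
  derivatives there of \<open>\<alpha>\<close>, \<open>\<beta>\<close>. The recursions come from solving the \<open>(p-2, q)\<close>-th, respectively
  \<open>(p, q-2)\<close>-th, derivative of \<open>u\<^sub>x\<^sub>x + u\<^sub>y\<^sub>y + (a\<^sub>x/a) u\<^sub>x + (a\<^sub>y/a) u\<^sub>y = - f/a\<close> for its leading
  \<open>x\<close>-, respectively \<open>y\<close>-, derivative; the argument \<open>ini\<close> supplies the values for \<open>p \<le> 1\<close>,
  respectively \<open>q \<le> 1\<close>.\<close>

fun xred :: "(nat \<Rightarrow> nat \<Rightarrow> real) \<Rightarrow> (nat \<Rightarrow> nat \<Rightarrow> real) \<Rightarrow> (nat \<Rightarrow> nat \<Rightarrow> real)
    \<Rightarrow> (nat \<Rightarrow> nat \<Rightarrow> real) \<Rightarrow> nat \<Rightarrow> nat \<Rightarrow> real" where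
  "xred A B eps ini 0 q = ini 0 q"
| "xred A B eps ini (Suc 0) q = ini (Suc 0) q"
| "xred A B eps ini (Suc (Suc p)) q =
     - eps (Suc (Suc p)) q - xred A B eps ini p (q + 2)
     - (\<Sum>i=0..p. \<Sum>j=0..q. real (p choose i) * real (q choose j) *
          (A (p - i) (q - j) * xred A B eps ini (i + 1) j
         + B (p - i) (q - j) * xred A B eps ini i (j + 1)))"

fun yred :: "(nat \<Rightarrow> nat \<Rightarrow> real) \<Rightarrow> (nat \<Rightarrow> nat \<Rightarrow> real) \<Rightarrow> (nat \<Rightarrow> nat \<Rightarrow> real)
    \<Rightarrow> (nat \<Rightarrow> nat \<Rightarrow> real) \<Rightarrow> nat \<Rightarrow> nat \<Rightarrow> real" where
  "yred A B eps ini p 0 = ini p 0"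
| "yred A B eps ini p (Suc 0) = ini p (Suc 0)"
| "yred A B eps ini p (Suc (Suc q)) =
     - eps p (Suc (Suc q)) - yred A B eps ini (p + 2) q
     - (\<Sum>i=0..p. \<Sum>j=0..q. real (p choose i) * real (q choose j) *
          (A (p - i) (q - j) * yred A B eps ini (i + 1) j
         + B (p - i) (q - j) * yred A B eps ini i (j + 1)))"

definition au :: "(nat \<Rightarrow> nat \<Rightarrow> real) \<Rightarrow> (nat \<Rightarrow> nat \<Rightarrow> real) \<Rightarrow> nat \<Rightarrow> nat \<Rightarrow> nat \<Rightarrow> nat \<Rightarrow> real" where
  "au A B p q m n = xred A B (\<lambda>_ _. 0) (\<lambda>p q. if (m, n) = (p, q) then 1 else 0) p q"

definition af :: "(nat \<Rightarrow> nat \<Rightarrow> real) \<Rightarrow> (nat \<Rightarrow> nat \<Rightarrow> real) \<Rightarrow> (nat \<Rightarrow> nat \<Rightarrow> real)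
    \<Rightarrow> nat \<Rightarrow> nat \<Rightarrow> nat \<Rightarrow> nat \<Rightarrow> real" where
  "af A B R p q m n = xred A B
     (\<lambda>p q. if m \<le> p - 2 \<and> n \<le> q
        then real ((p - 2) choose m) * real (q choose n) * R (p - 2 - m) (q - n) else 0)
     (\<lambda>_ _. 0) p q"

definition aut :: "(nat \<Rightarrow> nat \<Rightarrow> real) \<Rightarrow> (nat \<Rightarrow> nat \<Rightarrow> real) \<Rightarrow> nat \<Rightarrow> nat \<Rightarrow> nat \<Rightarrow> nat \<Rightarrow> real" where
  "aut A B p q m n = yred A B (\<lambda>_ _. 0) (\<lambda>p q. if (m, n) = (p, q) then 1 else 0) p q"

definition aft :: "(nat \<Rightarrow> nat \<Rightarrow> real) \<Rightarrow> (nat \<Rightarrow> nat \<Rightarrow> real) \<Rightarrow> (nat \<Rightarrow> nat \<Rightarrow> real)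
    \<Rightarrow> nat \<Rightarrow> nat \<Rightarrow> nat \<Rightarrow> nat \<Rightarrow> real" where
  "aft A B R p q m n = yred A B
     (\<lambda>p q. if m \<le> p \<and> n \<le> q - 2
        then real (p choose m) * real ((q - 2) choose n) * R (p - m) (q - 2 - n) else 0)
     (\<lambda>_ _. 0) p q"

subsection \<open>The functions entering the scheme\<close>

definition G6 :: "(nat \<Rightarrow> nat \<Rightarrow> real) \<Rightarrow> (nat \<Rightarrow> nat \<Rightarrow> real) \<Rightarrow> nat \<Rightarrow> nat \<Rightarrow> real \<Rightarrow> real \<Rightarrow> real" where
  "G6 A B m n x y = (\<Sum>(p, q)\<in>Lam 6. au A B p q m n / (fact p * fact q) * x ^ p * y ^ q)"

definition H6 :: "(nat \<Rightarrow> nat \<Rightarrow> real) \<Rightarrow> (nat \<Rightarrow> nat \<Rightarrow> real) \<Rightarrow> (nat \<Rightarrow> nat \<Rightarrow> real)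
    \<Rightarrow> nat \<Rightarrow> nat \<Rightarrow> real \<Rightarrow> real \<Rightarrow> real" where
  "H6 A B R m n x y = (\<Sum>(p, q)\<in>Lam2 6. af A B R p q m n / (fact p * fact q) * x ^ p * y ^ q)"

definition G6t :: "(nat \<Rightarrow> nat \<Rightarrow> real) \<Rightarrow> (nat \<Rightarrow> nat \<Rightarrow> real) \<Rightarrow> nat \<Rightarrow> nat \<Rightarrow> real \<Rightarrow> real \<Rightarrow> real" where
  "G6t A B m n x y = (\<Sum>(q, p)\<in>Lam 6. aut A B p q m n / (fact p * fact q) * x ^ p * y ^ q)"

definition H6t :: "(nat \<Rightarrow> nat \<Rightarrow> real) \<Rightarrow> (nat \<Rightarrow> nat \<Rightarrow> real) \<Rightarrow> (nat \<Rightarrow> nat \<Rightarrow> real)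
    \<Rightarrow> nat \<Rightarrow> nat \<Rightarrow> real \<Rightarrow> real \<Rightarrow> real" where
  "H6t A B R m n x y = (\<Sum>(q, p)\<in>Lam2 6. aft A B R p q m n / (fact p * fact q) * x ^ p * y ^ q)"

definition delta6 :: "nat \<Rightarrow> real" where
  "delta6 n = (if n = 6 then 1 else 0)"

definition En :: "(nat \<Rightarrow> nat \<Rightarrow> real) \<Rightarrow> (nat \<Rightarrow> nat \<Rightarrow> real) \<Rightarrow> (nat \<Rightarrow> real)
    \<Rightarrow> nat \<Rightarrow> real \<Rightarrow> real \<Rightarrow> real" where
  "En A B al n x y = G6 A B 0 n x y
     + (1 - delta6 n) * (\<Sum>i=n..5. real (i choose n) * al (i - n) * G6 A B 1 i x y)"

definition Ent :: "(nat \<Rightarrow> nat \<Rightarrow> real) \<Rightarrow> (nat \<Rightarrow> nat \<Rightarrow> real) \<Rightarrow> (nat \<Rightarrow> real)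
    \<Rightarrow> nat \<Rightarrow> real \<Rightarrow> real \<Rightarrow> real" where
  "Ent A B be m x y = G6t A B m 0 x y
     + (1 - delta6 m) * (\<Sum>i=m..5. real (i choose m) * be (i - m) * G6t A B i 1 x y)"

definition lam :: "(nat \<Rightarrow> nat \<Rightarrow> real) \<Rightarrow> (nat \<Rightarrow> nat \<Rightarrow> real) \<Rightarrow> nat \<Rightarrow> nat \<Rightarrow> real" where
  "lam A B m n = au A B m 0 0 n"

definition mu :: "(nat \<Rightarrow> nat \<Rightarrow> real) \<Rightarrow> (nat \<Rightarrow> nat \<Rightarrow> real) \<Rightarrow> nat \<Rightarrow> nat \<Rightarrow> real" where
  "mu A B m n = au A B m 0 1 n"

definition nu :: "(nat \<Rightarrow> nat \<Rightarrow> real) \<Rightarrow> (nat \<Rightarrow> nat \<Rightarrow> real) \<Rightarrow> (nat \<Rightarrow> nat \<Rightarrow> real)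
    \<Rightarrow> nat \<Rightarrow> nat \<Rightarrow> nat \<Rightarrow> real" where
  "nu A B R m i j = af A B R m 0 i j"

definition pmn :: "(nat \<Rightarrow> nat \<Rightarrow> real) \<Rightarrow> (nat \<Rightarrow> nat \<Rightarrow> real) \<Rightarrow> (nat \<Rightarrow> real) \<Rightarrow> nat \<Rightarrow> nat \<Rightarrow> real" where
  "pmn A B al m n = lam A B m n
     + (1 - delta6 n) * (\<Sum>i=n..5. real (i choose n) * al (i - n) * mu A B m i)"

subsection \<open>The scheme\<close>

text \<open>The unknowns \<open>ch k l p\<close>, \<open>ct k l p\<close> (hat and tilde) matter for \<open>k, l \<le> 1\<close> and \<open>p \<le> 6\<close> only.\<close>

definition Cpol :: "(nat \<Rightarrow> nat \<Rightarrow> nat \<Rightarrow> real) \<Rightarrow> nat \<Rightarrow> nat \<Rightarrow> real \<Rightarrow> real" where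
  "Cpol c k l h = (\<Sum>p=0..6. c k l p * h ^ p)"

definition Ckl :: "(nat \<Rightarrow> nat \<Rightarrow> nat \<Rightarrow> real) \<Rightarrow> (nat \<Rightarrow> nat \<Rightarrow> nat \<Rightarrow> real)
    \<Rightarrow> nat \<Rightarrow> nat \<Rightarrow> real \<Rightarrow> real" where
  "Ckl ch ct k l h = Cpol ch k l h + Cpol ct k l h"

text \<open>\<open>F\<close> is a polynomial in \<open>h\<close> whose coefficients of \<open>h\<^sup>0, \<dots>, h\<^sup>6\<close> vanish.\<close>

definition poly_O7 :: "(real \<Rightarrow> real) \<Rightarrow> bool" where
  "poly_O7 F \<longleftrightarrow> (\<exists>Q::real poly. (\<forall>h. F h = poly Q h) \<and> (\<forall>i\<le>6. coeff Q i = 0))"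

definition corner_system :: "(nat \<Rightarrow> nat \<Rightarrow> real) \<Rightarrow> (nat \<Rightarrow> nat \<Rightarrow> real) \<Rightarrow> (nat \<Rightarrow> real) \<Rightarrow> (nat \<Rightarrow> real)
    \<Rightarrow> (nat \<Rightarrow> nat \<Rightarrow> nat \<Rightarrow> real) \<Rightarrow> (nat \<Rightarrow> nat \<Rightarrow> nat \<Rightarrow> real) \<Rightarrow> bool" where
  "corner_system A B al be ch ct \<longleftrightarrow> (\<forall>n\<le>6. poly_O7 (\<lambda>h.
     \<Sum>k=0..1. \<Sum>l=0..1.
       Cpol ch k l h * En A B al n (real k * h) (real l * h)
     + Cpol ct k l h * (\<Sum>m=0..6. pmn A B al m n * Ent A B be m (real k * h) (real l * h))))"

definition nontrivial :: "(nat \<Rightarrow> nat \<Rightarrow> nat \<Rightarrow> real) \<Rightarrow> (nat \<Rightarrow> nat \<Rightarrow> nat \<Rightarrow> real) \<Rightarrow> bool" where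
  "nontrivial ch ct \<longleftrightarrow> (\<exists>k\<in>{0, 1}. \<exists>l\<in>{0, 1}. ch k l 0 + ct k l 0 \<noteq> 0)"

definition Jf :: "(nat \<Rightarrow> nat \<Rightarrow> real) \<Rightarrow> (nat \<Rightarrow> nat \<Rightarrow> real) \<Rightarrow> (nat \<Rightarrow> nat \<Rightarrow> real) \<Rightarrow> (nat \<Rightarrow> real)
    \<Rightarrow> (nat \<Rightarrow> nat \<Rightarrow> nat \<Rightarrow> real) \<Rightarrow> (nat \<Rightarrow> nat \<Rightarrow> nat \<Rightarrow> real) \<Rightarrow> nat \<Rightarrow> nat \<Rightarrow> real \<Rightarrow> real" where
  "Jf A B R be ch ct m n h = inverse h * (\<Sum>k=0..1. \<Sum>l=0..1.
       Cpol ch k l h * H6 A B R m n (real k * h) (real l * h)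
     + Cpol ct k l h * (H6t A B R m n (real k * h) (real l * h)
         + (\<Sum>i=0..6. nu A B R i m n * Ent A B be i (real k * h) (real l * h))))"

definition Jg1 :: "(nat \<Rightarrow> nat \<Rightarrow> real) \<Rightarrow> (nat \<Rightarrow> nat \<Rightarrow> real) \<Rightarrow> (nat \<Rightarrow> real)
    \<Rightarrow> (nat \<Rightarrow> nat \<Rightarrow> nat \<Rightarrow> real) \<Rightarrow> (nat \<Rightarrow> nat \<Rightarrow> nat \<Rightarrow> real) \<Rightarrow> nat \<Rightarrow> real \<Rightarrow> real" where
  "Jg1 A B be ch ct n h = - inverse h * (\<Sum>k=0..1. \<Sum>l=0..1.
       Cpol ch k l h * G6 A B 1 n (real k * h) (real l * h)
     + Cpol ct k l h * (\<Sum>m=0..6. mu A B m n * Ent A B be m (real k * h) (real l * h)))"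

definition Jg3 :: "(nat \<Rightarrow> nat \<Rightarrow> real) \<Rightarrow> (nat \<Rightarrow> nat \<Rightarrow> real)
    \<Rightarrow> (nat \<Rightarrow> nat \<Rightarrow> nat \<Rightarrow> real) \<Rightarrow> nat \<Rightarrow> real \<Rightarrow> real" where
  "Jg3 A B ct m h = - inverse h * (\<Sum>k=0..1. \<Sum>l=0..1.
       Cpol ct k l h * G6t A B m 1 (real k * h) (real l * h))"

definition sign_condition :: "(nat \<Rightarrow> nat \<Rightarrow> nat \<Rightarrow> real) \<Rightarrow> (nat \<Rightarrow> nat \<Rightarrow> nat \<Rightarrow> real) \<Rightarrow> real \<Rightarrow> bool" where
  "sign_condition ch ct h \<longleftrightarrow> Ckl ch ct 0 0 h > 0
     \<and> (\<forall>k\<in>{0, 1}. \<forall>l\<in>{0, 1}. (k, l) \<noteq> (0, 0) \<longrightarrow> Ckl ch ct k l h \<le> 0)"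

definition sum_condition :: "(nat \<Rightarrow> nat \<Rightarrow> nat \<Rightarrow> real) \<Rightarrow> (nat \<Rightarrow> nat \<Rightarrow> nat \<Rightarrow> real) \<Rightarrow> real \<Rightarrow> bool" where
  "sum_condition ch ct h \<longleftrightarrow> (\<Sum>k=0..1. \<Sum>l=0..1. Ckl ch ct k l h) \<ge> 0"

end

theory Submission
  imports Defs
begin

text \<open>Consistency: the differentiated equation and boundary conditions express every derivative of
  \<open>u\<close> of order at most six at the corner through the pure \<open>y\<close>-derivatives and the data, either by
  eliminating \<open>x\<close>-derivatives directly, or by first eliminating \<open>y\<close>-derivatives. Inserting both
  expressions in the Taylor polynomial of \<open>u\<close> turns the residual of the scheme into a combination of
  the left-hand sides of the linear system.

  Solvability: order the unknowns by the power of \<open>h\<close>. The leading part of \<open>E\<^sub>n\<close> is the harmonic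
  polynomial \<open>P\<^sub>n = Re (y + \<i> x)\<^sup>n / n!\<close>; that of the function multiplying the second group of unknowns
  is \<open>P\<^sub>n\<close> for even \<open>n\<close>, and a multiple of the degree \<open>n + 1\<close> polynomial \<open>P\<^sub>n\<^sub>+\<^sub>1\<close> for odd \<open>n\<close>. So the
  system is block triangular; its first block forces the stencil \<open>s (5, -2, -2, -1)\<close>, all blocks are
  solvable, and the coefficient sum at order \<open>h\<close> is \<open>3 s (\<alpha> + \<beta>)\<close>, which gives (i).
  For (ii), solutions may be multiplied by polynomials in \<open>h\<close>; a multiplier \<open>1 + t\<^sub>1 h + \<dots> + t\<^sub>6 h\<^sup>6\<close>
  with rapidly growing \<open>t\<^sub>j\<close> gives all coefficients the sign of the leading ones.\<close>

section \<open>Reduction of derivatives\<close>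

text \<open>The obstacle is a count. Collecting powers of \<open>h\<close>, the unknowns of level
  \<open>p\<close> are met by the equations \<open>n\<close> with \<open>n + p \<le> 6\<close>. For
  odd \<open>n\<close> the tilde unknowns of that level drop out, and the harmonic polynomial of
  degree \<open>n\<close> vanishes at \<open>(0,0)\<close> and \<open>(1,0)\<close>, so only two hat
  weights act. They suffice from level 2 on, where the odd equations are \<open>n = 1, 3\<close>;
  levels 0 and 1 also contain \<open>n = 5\<close>. These two levels are settled together with zero
  hat unknowns: the tilde stencil annihilates the degrees 0, 2, 4, 6, and its contribution to an odd
  equation of level 1 is a multiple of the next even degree, hence zero. The stencil is a quadrant
  of the nine-point Laplacian with weights 20, -4, -1: the centre is shared by four quadrants, an
  edge neighbour by two. If \<open>al 0 + be 0 = 0\<close>, the coefficient sums at orders 0 and 1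
  vanish and a later order decides the sign; the sum condition is then obtained provided some
  solution attains it for small \<open>h\<close>. At the corner all data are one-sided limits, so
  jets are taken of continuous extensions from a small open square.\<close>

lemma reduction_induct [case_names 0 1 step]:
  fixes P :: "nat \<Rightarrow> nat \<Rightarrow> bool"
  assumes "\<And>q. P 0 q" "\<And>q. P (Suc 0) q"
    and "\<And>p q. (\<And>p' q'. p' \<le> Suc p \<Longrightarrow> P p' q') \<Longrightarrow> P (Suc (Suc p)) q"
  shows "P p q"
\<comment> \<open>The reductions lower the first index but may raise the second by two, so the
  second index stays arbitrary.\<close>
proof (induction p arbitrary: q rule: less_induct)
  case (less p)
  show ?case
  proof (cases p)
    case (Suc p')
    then show ?thesis using assms(2,3) less by (cases p') auto
  qed (simp add: assms(1))
qed

text \<open>Exchanging x and y turns one recursion into the other with \<open>A\<close> and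
  \<open>B\<close> interchanged; thus facts about the tilde coefficients follow from their untilded
  counterparts.\<close>

lemma yred_eq_xred:
  "yred A B eps ini p q
   = xred (\<lambda>m n. B n m) (\<lambda>m n. A n m) (\<lambda>m n. eps n m) (\<lambda>m n. ini n m) q p"
proof (induction q p rule: reduction_induct)
  case (step q p)
  have "(\<Sum>i=0..p. \<Sum>j=0..q. real (p choose i) * real (q choose j) *
          (A (p - i) (q - j) * yred A B eps ini (i + 1) j
         + B (p - i) (q - j) * yred A B eps ini i (j + 1)))
      = (\<Sum>j=0..q. \<Sum>i=0..p. real (q choose j) * real (p choose i) *
          (B (p - i) (q - j) * yred A B eps ini i (j + 1)
         + A (p - i) (q - j) * yred A B eps ini (i + 1) j))"
    by (subst sum.swap) (simp add: algebra_simps)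
  then show ?case by (simp add: step)
qed auto

text \<open>The recursion is linear in the pair of source \<open>eps\<close> and initial values
  \<open>ini\<close>. This superposition principle later writes a jet as a combination of
  \<open>au\<close> and \<open>af\<close>.\<close>

lemma xred_sum:
  "xred A B (\<lambda>p q. \<Sum>s\<in>I. w s * eps s p q) (\<lambda>p q. \<Sum>s\<in>I. w s * ini s p q) p q
   = (\<Sum>s\<in>I. w s * xred A B (eps s) (ini s) p q)"
  (is "?X p q = (\<Sum>s\<in>I. w s * ?x s p q)")
proof (induction p q rule: reduction_induct)
  case (step p q)
  have "(\<Sum>i=0..p. \<Sum>j=0..q. real (p choose i) * real (q choose j) *
          (A (p - i) (q - j) * (\<Sum>s\<in>I. w s * ?x s (i + 1) j)
         + B (p - i) (q - j) * (\<Sum>s\<in>I. w s * ?x s i (j + 1))))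
      = (\<Sum>i=0..p. \<Sum>j=0..q. \<Sum>s\<in>I. w s * (real (p choose i) * real (q choose j) *
          (A (p - i) (q - j) * ?x s (i + 1) j + B (p - i) (q - j) * ?x s i (j + 1))))"
    by (simp add: sum_distrib_left sum.distrib[symmetric] algebra_simps)
  also have "\<dots> = (\<Sum>s\<in>I. w s * (\<Sum>i=0..p. \<Sum>j=0..q. real (p choose i) * real (q choose j) *
          (A (p - i) (q - j) * ?x s (i + 1) j + B (p - i) (q - j) * ?x s i (j + 1))))"
    unfolding sum_distrib_left by (simp add: sum.swap[where A = I and B = "{0..p}"] sum.swap[where A = I and B = "{0..q}"])
  finally show ?case
    by (simp add: step right_diff_distrib sum_subtractf sum_negf)
qed auto

lemma xred_add:
  "xred A B (\<lambda>p q. eps p q + eps' p q) (\<lambda>p q. ini p q + ini' p q) p q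
   = xred A B eps ini p q + xred A B eps' ini' p q"
  \<comment> \<open>Superposition with unit weights over the two-element type
    \<open>bool\<close>.\<close>
  using xred_sum[of A B "\<lambda>_. 1" "\<lambda>b. if b then eps else eps'" UNIV
      "\<lambda>b. if b then ini else ini'" p q]
  by (simp add: UNIV_bool add.commute)

text \<open>Uniqueness for the recursion. Every term on the right has total order at most that of
  the left-hand side, so data up to order \<open>K\<close> are enough.\<close>

lemma xred_eqI:
  assumes rec: "\<And>p q. p + q + 2 \<le> K \<Longrightarrow> U (p + 2) q = - eps (p + 2) q - U p (q + 2)
     - (\<Sum>i=0..p. \<Sum>j=0..q. real (p choose i) * real (q choose j) *
          (A (p - i) (q - j) * U (i + 1) j + B (p - i) (q - j) * U i (j + 1)))"
    and ini: "\<And>p q. p \<le> 1 \<Longrightarrow> p + q \<le> K \<Longrightarrow> U p q = ini p q"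
    and "p + q \<le> K"
  shows "U p q = xred A B eps ini p q"
  using assms(3)
proof (induction p q rule: reduction_induct)
  case (step p q)
  have "(\<Sum>i=0..p. \<Sum>j=0..q. real (p choose i) * real (q choose j) *
          (A (p - i) (q - j) * U (i + 1) j + B (p - i) (q - j) * U i (j + 1)))
      = (\<Sum>i=0..p. \<Sum>j=0..q. real (p choose i) * real (q choose j) *
          (A (p - i) (q - j) * xred A B eps ini (i + 1) j
         + B (p - i) (q - j) * xred A B eps ini i (j + 1)))"
    by (intro sum.cong refl) (use step in auto)
  then show ?case using rec[of p q] step by simp
qed (use ini in auto)

section \<open>Order bound and leading part of the reduction coefficients\<close>

lemma au_low: "p + q < m + n \<Longrightarrow> au A B p q m n = 0"
proof (induction p q rule: reduction_induct)
  case (step p q)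
  then show ?case unfolding au_def by (auto intro!: sum.neutral)
qed (auto simp: au_def)

text \<open>In top order the terms with \<open>A\<close> and \<open>B\<close> drop out, leaving
  \<open>u_xx = - u_yy\<close>: each pair of x-derivatives contributes a factor -1. For odd
  \<open>p\<close> a single x-derivative remains, which contains no pure y-derivative.\<close>

lemma au_top: "p + q = n \<Longrightarrow> au A B p q 0 n = (if even p then (-1) ^ (p div 2) else 0)"
proof (induction p q rule: reduction_induct)
  case (step p q)
  have "au A B (Suc (Suc p)) q 0 n = - au A B p (q + 2) 0 n
      - (\<Sum>i=0..p. \<Sum>j=0..q. real (p choose i) * real (q choose j) *
          (A (p - i) (q - j) * au A B (i + 1) j 0 n + B (p - i) (q - j) * au A B i (j + 1) 0 n))"
    by (simp add: au_def)
  also have "\<dots> = - au A B p (q + 2) 0 n"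
    using step.prems by (simp add: au_low)
  also have "\<dots> = (if even (Suc (Suc p)) then (-1) ^ (Suc (Suc p) div 2) else 0)"
    using step.IH[of p "q + 2"] step.prems by simp
  finally show ?case .
qed (auto simp: au_def)

lemma aut_eq_au: "aut A B p q m n = au (\<lambda>m n. B n m) (\<lambda>m n. A n m) q p n m"
  unfolding aut_def au_def yred_eq_xred by (intro arg_cong2[where f = "\<lambda>x y. xred _ _ x y q p"] ext) auto

lemma aft_eq_af:
  "aft A B R p q m n = af (\<lambda>m n. B n m) (\<lambda>m n. A n m) (\<lambda>m n. R n m) q p n m"
  unfolding aft_def af_def yred_eq_xred
  by (intro arg_cong2[where f = "\<lambda>x y. xred _ _ x y q p"] ext) auto

lemma G6t_eq_G6: "G6t A B m n x y = G6 (\<lambda>m n. B n m) (\<lambda>m n. A n m) n m y x"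
  unfolding G6t_def G6_def aut_eq_au by (intro sum.cong) (auto simp: ac_simps)

lemma H6t_eq_H6:
  "H6t A B R m n x y = H6 (\<lambda>m n. B n m) (\<lambda>m n. A n m) (\<lambda>m n. R n m) n m y x"
  unfolding H6t_def H6_def aft_eq_af by (intro sum.cong) (auto simp: ac_simps)

lemma Ent_eq_En: "Ent A B be m x y = En (\<lambda>m n. B n m) (\<lambda>m n. A n m) be m y x"
  by (simp add: Ent_def En_def G6t_eq_G6)

lemma finite_Lam [simp]: "finite (Lam K)"
  by (rule finite_subset[of _ "{..K} \<times> {..K}"]) (auto simp: Lam_def)

lemma af_low: "p \<le> 1 \<Longrightarrow> af A B R p q m n = 0"
  by (cases p) (auto simp: af_def)

text \<open>As \<open>af\<close> vanishes for \<open>p \<le> 1\<close>, the sum may run over all of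
  \<open>Lam 6\<close>, which makes \<open>H6\<close> a Taylor polynomial of the same form as
  \<open>G6\<close>.\<close>

lemma H6_eq: "H6 A B R m n x y = (\<Sum>(p, q)\<in>Lam 6. af A B R p q m n / (fact p * fact q) * x ^ p * y ^ q)"
  unfolding H6_def by (rule sum.mono_neutral_left) (auto simp: Lam2_def Lam1_def af_low)

text \<open>\<open>U\<close>, \<open>F\<close> stand for the jets of \<open>u\<close>, \<open>f\<close> at the base point.\<close>

definition pde_jet :: "(nat \<Rightarrow> nat \<Rightarrow> real) \<Rightarrow> (nat \<Rightarrow> nat \<Rightarrow> real) \<Rightarrow> (nat \<Rightarrow> nat \<Rightarrow> real)
    \<Rightarrow> (nat \<Rightarrow> nat \<Rightarrow> real) \<Rightarrow> (nat \<Rightarrow> nat \<Rightarrow> real) \<Rightarrow> bool" where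
  "pde_jet A B R F U \<longleftrightarrow> (\<forall>p q. p + q \<le> 4 \<longrightarrow>
     U (p + 2) q + U p (q + 2)
     + (\<Sum>i=0..p. \<Sum>j=0..q. real (p choose i) * real (q choose j) *
          (A (p - i) (q - j) * U (i + 1) j + B (p - i) (q - j) * U i (j + 1)))
     + (\<Sum>i=0..p. \<Sum>j=0..q. real (p choose i) * real (q choose j) * (R (p - i) (q - j) * F i j)) = 0)"

text \<open>The Robin condition on the left edge, differentiated along the edge and solved for the
  normal derivative. The lower edge uses the same predicate for the transposed jet.\<close>

definition bc_jet :: "(nat \<Rightarrow> real) \<Rightarrow> (nat \<Rightarrow> real) \<Rightarrow> (nat \<Rightarrow> nat \<Rightarrow> real) \<Rightarrow> bool" where
  "bc_jet al g U \<longleftrightarrow> (\<forall>n\<le>5. U 1 n = (\<Sum>i=0..n. real (n choose i) * al (n - i) * U 0 i) - g n)"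

lemma pde_jet_transpose:
  assumes "pde_jet A B R F U"
  shows "pde_jet (\<lambda>m n. B n m) (\<lambda>m n. A n m) (\<lambda>m n. R n m) (\<lambda>m n. F n m) (\<lambda>m n. U n m)"
  unfolding pde_jet_def
proof (intro allI impI)
  fix p q :: nat assume "p + q \<le> 4"
  then have "U (q + 2) p + U q (p + 2)
     + (\<Sum>i=0..q. \<Sum>j=0..p. real (q choose i) * real (p choose j) *
          (A (q - i) (p - j) * U (i + 1) j + B (q - i) (p - j) * U i (j + 1)))
     + (\<Sum>i=0..q. \<Sum>j=0..p. real (q choose i) * real (p choose j) * (R (q - i) (p - j) * F i j)) = 0"
    using assms by (auto simp: pde_jet_def add.commute)
  then show "U q (p + 2) + U (q + 2) p
     + (\<Sum>i=0..p. \<Sum>j=0..q. real (p choose i) * real (q choose j) *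
          (B (q - j) (p - i) * U j (i + 1) + A (q - j) (p - i) * U (j + 1) i))
     + (\<Sum>i=0..p. \<Sum>j=0..q. real (p choose i) * real (q choose j) * (R (q - j) (p - i) * F j i)) = 0"
    by (simp add: sum.swap[where A = "{0..q}" and B = "{0..p}"] algebra_simps)
qed

lemma Lam1_eq: "Lam1 6 = (\<lambda>n. (0, n)) ` {0..6} \<union> (\<lambda>n. (1, n)) ` {0..5}"
  by (auto simp: Lam1_def Lam_def image_iff)

lemma sum_Lam1: "(\<Sum>s\<in>Lam1 6. w s) = (\<Sum>n=0..6. w (0, n)) + (\<Sum>n=0..5. w (1, n) :: real)"
  unfolding Lam1_eq by (subst sum.union_disjoint) (auto simp: sum.reindex inj_on_def)

text \<open>The jet satisfies the recursion with a source built from \<open>F\<close> and initial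
  values taken from columns 0 and 1; superposition splits it into one copy of \<open>af\<close> or
  \<open>au\<close> for each datum.\<close>

lemma jet_reduction:
  assumes "pde_jet A B R F U" and "p + q \<le> 6"
  shows "U p q = (\<Sum>n=0..6. U 0 n * au A B p q 0 n) + (\<Sum>n=0..5. U 1 n * au A B p q 1 n)
     + (\<Sum>(i, j)\<in>Lam 4. F i j * af A B R p q i j)"
proof -
  let ?eps = "\<lambda>s p q. if fst s \<le> p - 2 \<and> snd s \<le> q
        then real ((p - 2) choose fst s) * real (q choose snd s) * R (p - 2 - fst s) (q - snd s) else 0"
  let ?ini = "\<lambda>s p q. if s = (p, q) then 1 else 0 :: real"
  let ?E = "\<lambda>p q. \<Sum>s\<in>Lam 4. F (fst s) (snd s) * ?eps s p q"
  let ?I = "\<lambda>p q. \<Sum>s\<in>Lam1 6. U (fst s) (snd s) * ?ini s p q"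
  have "U p q = xred A B (\<lambda>p q. 0 + ?E p q) (\<lambda>p q. ?I p q + 0) p q"
  proof (rule xred_eqI[OF _ _ assms(2)])
    fix p q :: nat assume pq: "p + q + 2 \<le> 6"
    \<comment> \<open>The source is zero outside the rectangle \<open>i \<le> p\<close>,
      \<open>j \<le> q\<close>, which lies inside \<open>Lam 4\<close> because
      \<open>p + q \<le> 4\<close>.\<close>
    have "(\<Sum>s\<in>Lam 4. F (fst s) (snd s) * ?eps s (p + 2) q)
        = (\<Sum>s\<in>{0..p}\<times>{0..q}. F (fst s) (snd s) * ?eps s (p + 2) q)"
      by (rule sum.mono_neutral_right[OF finite_Lam]) (use pq in \<open>auto simp: Lam_def\<close>)
    also have "\<dots> = (\<Sum>i=0..p. \<Sum>j=0..q. real (p choose i) * real (q choose j) * (R (p - i) (q - j) * F i j))"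
      unfolding sum.cartesian_product by (intro sum.cong) (auto simp: algebra_simps)
    finally have E: "?E (p + 2) q = \<dots>" .
    have "U (p + 2) q + U p (q + 2)
     + (\<Sum>i=0..p. \<Sum>j=0..q. real (p choose i) * real (q choose j) *
          (A (p - i) (q - j) * U (i + 1) j + B (p - i) (q - j) * U i (j + 1)))
     + (\<Sum>i=0..p. \<Sum>j=0..q. real (p choose i) * real (q choose j) * (R (p - i) (q - j) * F i j)) = 0"
      using assms(1) pq unfolding pde_jet_def by auto
    then show "U (p + 2) q = - (0 + ?E (p + 2) q) - U p (q + 2)
     - (\<Sum>i=0..p. \<Sum>j=0..q. real (p choose i) * real (q choose j) *
          (A (p - i) (q - j) * U (i + 1) j + B (p - i) (q - j) * U i (j + 1)))"
      unfolding E by linarith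
  next
    fix p q :: nat assume "p \<le> 1" "p + q \<le> 6"
    then have "(p, q) \<in> Lam1 6" by (auto simp: Lam1_def Lam_def)
    moreover have "finite (Lam1 6)" by (rule finite_subset[of _ "Lam 6"]) (auto simp: Lam1_def)
    ultimately show "U p q = ?I p q + 0" by (simp add: sum.delta' if_distrib cong: if_cong)
  qed
  \<comment> \<open>The absent source or initial part is written as a sum of zeros over the same
    index set, so that superposition applies to both terms.\<close>
  also have "\<dots> = xred A B (\<lambda>p q. \<Sum>s\<in>Lam1 6. U (fst s) (snd s) * 0) ?I p q
      + xred A B ?E (\<lambda>p q. \<Sum>s\<in>Lam 4. F (fst s) (snd s) * 0) p q"
    by (subst xred_add) simp
  also have "\<dots> = (\<Sum>s\<in>Lam1 6. U (fst s) (snd s) * au A B p q (fst s) (snd s))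
      + (\<Sum>s\<in>Lam 4. F (fst s) (snd s) * af A B R p q (fst s) (snd s))"
    unfolding xred_sum au_def af_def by simp
  finally show ?thesis by (simp add: sum_Lam1 case_prod_unfold)
qed

text \<open>Interchanging the sums over \<open>i \<le> n\<close> collects the factor of each
  \<open>U 0 n\<close>. For arbitrary \<open>X\<close> the result is the boundary part common to
  \<open>En\<close> and \<open>pmn\<close>.\<close>

lemma bc_sum:
  assumes "bc_jet al g U"
  shows "(\<Sum>n=0..5. U 1 n * X n)
    = (\<Sum>n=0..6. U 0 n * ((1 - delta6 n) * (\<Sum>i=n..5. real (i choose n) * al (i - n) * X i)))
      - (\<Sum>n=0..5. g n * X n)"
proof -
  have "(\<Sum>n=0..5. U 1 n * X n)
      = (\<Sum>n=0..5. \<Sum>i=0..n. real (n choose i) * al (n - i) * U 0 i * X n) - (\<Sum>n=0..5. g n * X n)"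
    unfolding sum_subtractf[symmetric]
    by (rule sum.cong) (use assms in \<open>auto simp: bc_jet_def left_diff_distrib sum_distrib_right\<close>)
  also have "(\<Sum>n=0..5. \<Sum>i=0..n. real (n choose i) * al (n - i) * U 0 i * X n)
      = (\<Sum>n=0..5. \<Sum>i=0..5. if i \<le> n then real (n choose i) * al (n - i) * U 0 i * X n else 0)"
    by (intro sum.cong refl sum.mono_neutral_cong_left) auto
  also have "\<dots> = (\<Sum>i=0..5. \<Sum>n=0..5. if i \<le> n then real (n choose i) * al (n - i) * U 0 i * X n else 0)"
    by (rule sum.swap)
  also have "\<dots> = (\<Sum>i=0..5. \<Sum>n=i..5. real (n choose i) * al (n - i) * U 0 i * X n)"
    by (intro sum.cong refl sum.mono_neutral_cong_right) auto
  also have "\<dots> = (\<Sum>n=0..5. U 0 n * ((1 - delta6 n) * (\<Sum>i=n..5. real (i choose n) * al (i - n) * X i)))"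
    by (intro sum.cong) (auto simp: delta6_def sum_distrib_left ac_simps)
  also have "\<dots> = (\<Sum>n=0..6. U 0 n * ((1 - delta6 n) * (\<Sum>i=n..5. real (i choose n) * al (i - n) * X i)))"
    by (rule sum.mono_neutral_left) auto
  finally show ?thesis .
qed

section \<open>Degree-six Taylor polynomials as linear functions of a jet\<close>

definition taylor6 :: "(nat \<Rightarrow> nat \<Rightarrow> real) \<Rightarrow> real \<Rightarrow> real \<Rightarrow> real" where
  "taylor6 w x y = (\<Sum>(p, q)\<in>Lam 6. w p q / (fact p * fact q) * x ^ p * y ^ q)"

lemma taylor6_sum: "taylor6 (\<lambda>p q. \<Sum>s\<in>I. c s * w s p q) x y = (\<Sum>s\<in>I. c s * taylor6 (w s) x y)"
  unfolding taylor6_def case_prod_unfold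
  by (simp add: sum_distrib_left sum_distrib_right sum_divide_distrib sum.swap[where A = I and B = "Lam 6"] ac_simps)

lemma taylor6_add: "taylor6 (\<lambda>p q. w p q + w' p q) x y = taylor6 w x y + taylor6 w' x y"
  unfolding taylor6_def case_prod_unfold by (simp add: sum.distrib add_divide_distrib distrib_right)

lemma taylor6_scale: "taylor6 (\<lambda>p q. c * w p q) x y = c * taylor6 w x y"
  using taylor6_sum[of "\<lambda>_. c" "\<lambda>_. w" "{()}"] by simp

lemma taylor6_cong: "(\<And>p q. p + q \<le> 6 \<Longrightarrow> w p q = w' p q) \<Longrightarrow> taylor6 w x y = taylor6 w' x y"
  unfolding taylor6_def by (intro sum.cong) (auto simp: Lam_def)

lemma G6_taylor6: "G6 A B m n x y = taylor6 (\<lambda>p q. au A B p q m n) x y"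
  by (simp add: G6_def taylor6_def)

lemma H6_taylor6: "H6 A B R m n x y = taylor6 (\<lambda>p q. af A B R p q m n) x y"
  by (simp add: H6_eq taylor6_def)

lemma taylor6_transpose: "taylor6 (\<lambda>p q. w q p) y x = taylor6 w x y"
proof -
  have "taylor6 w x y = (\<Sum>(p, q)\<in>prod.swap ` Lam 6. w p q / (fact p * fact q) * x ^ p * y ^ q)"
    unfolding taylor6_def by (intro sum.cong) (auto simp: Lam_def image_iff)
  also have "\<dots> = taylor6 (\<lambda>p q. w q p) y x"
    unfolding taylor6_def by (subst sum.reindex) (auto simp: inj_on_def case_prod_unfold ac_simps)
  finally show ?thesis by simp
qed

text \<open>Jet reduction summed against the monomials, after the boundary condition has removed
  \<open>U 1 n\<close>: pure y-derivatives and data remain.\<close>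

lemma taylor6_jet:
  assumes "pde_jet A B R F U" and "bc_jet al g U"
  shows "taylor6 U x y = (\<Sum>n=0..6. U 0 n * En A B al n x y) - (\<Sum>n=0..5. g n * G6 A B 1 n x y)
     + (\<Sum>(i, j)\<in>Lam 4. F i j * H6 A B R i j x y)"
proof -
  have "taylor6 U x y = taylor6 (\<lambda>p q. ((\<Sum>n=0..6. U 0 n * au A B p q 0 n) + (\<Sum>n=0..5. U 1 n * au A B p q 1 n))
     + (\<Sum>s\<in>Lam 4. F (fst s) (snd s) * af A B R p q (fst s) (snd s))) x y"
    by (rule taylor6_cong) (rule jet_reduction[OF assms(1), unfolded case_prod_unfold])
  also have "\<dots> = (\<Sum>n=0..6. U 0 n * G6 A B 0 n x y) + (\<Sum>n=0..5. U 1 n * G6 A B 1 n x y)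
     + (\<Sum>(i, j)\<in>Lam 4. F i j * H6 A B R i j x y)"
    unfolding taylor6_add taylor6_sum[where c = "\<lambda>n. U 0 n"] taylor6_sum[where c = "\<lambda>n. U 1 n"]
      taylor6_sum[where c = "\<lambda>s. F (fst s) (snd s)"] G6_taylor6 H6_taylor6 case_prod_unfold ..
  finally show ?thesis
    unfolding bc_sum[OF assms(2)] En_def distrib_left sum.distrib by linarith
qed

text \<open>The mirror image, with the pure x-derivatives \<open>U n 0\<close> as free parameters
  and the condition on the lower edge.\<close>

lemma taylor6_jet_transpose:
  assumes "pde_jet A B R F U" and "bc_jet be g (\<lambda>m n. U n m)"
  shows "taylor6 U x y = (\<Sum>n=0..6. U n 0 * Ent A B be n x y) - (\<Sum>n=0..5. g n * G6t A B n 1 x y)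
     + (\<Sum>(i, j)\<in>Lam 4. F i j * H6t A B R i j x y)"
proof -
  have "Lam 4 = prod.swap ` Lam 4" by (auto simp: Lam_def image_iff)
  then have "(\<Sum>(i, j)\<in>Lam 4. F i j * H6t A B R i j x y)
      = (\<Sum>(i, j)\<in>prod.swap ` Lam 4. F i j * H6t A B R i j x y)" by simp
  also have "\<dots> = (\<Sum>(i, j)\<in>Lam 4. F j i * H6t A B R j i x y)"
    by (subst sum.reindex) (auto simp: inj_on_def case_prod_unfold)
  finally have "(\<Sum>(i, j)\<in>Lam 4. F i j * H6t A B R i j x y)
      = (\<Sum>(i, j)\<in>Lam 4. F j i * H6t A B R j i x y)" .
  then show ?thesis
    using taylor6_jet[OF pde_jet_transpose[OF assms(1)] assms(2), of y x]
    unfolding taylor6_transpose[of U] Ent_eq_En G6t_eq_G6 H6t_eq_H6 by linarith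
qed

text \<open>The link between the two expansions: it rewrites the pure x-derivatives of the mirrored
  one through pure y-derivatives, so that both groups of unknowns enter the same seven equations.
  This is the origin of \<open>pmn\<close>, \<open>mu\<close> and \<open>nu\<close>.\<close>

lemma jet_x_axis:
  assumes "pde_jet A B R F U" and "bc_jet al g U" and "m \<le> 6"
  shows "U m 0 = (\<Sum>n=0..6. pmn A B al m n * U 0 n) - (\<Sum>n=0..5. mu A B m n * g n)
     + (\<Sum>(i, j)\<in>Lam 4. nu A B R m i j * F i j)"
proof -
  have "U m 0 = (\<Sum>n=0..6. U 0 n * pmn A B al m n) - (\<Sum>n=0..5. g n * mu A B m n)
     + (\<Sum>(i, j)\<in>Lam 4. F i j * nu A B R m i j)"
    using jet_reduction[OF assms(1), of m 0] assms(3)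
    unfolding bc_sum[OF assms(2)] pmn_def lam_def mu_def nu_def distrib_left sum.distrib by linarith
  then show ?thesis by (simp only: mult.commute)
qed

text \<open>Bookkeeping for one quantity \<open>T\<close> with two expansions, the first weighted by
  a hat polynomial and the second by a tilde polynomial; the data \<open>g3\<close> occur in the
  second only.\<close>

lemma two_expansions_sum:
  fixes T c1 c2 :: real
  assumes "T = (\<Sum>n\<in>N. u n * e n) - (\<Sum>n\<in>M. g n * gg n) + (\<Sum>s\<in>L. F s * hF s)"
    and "T = (\<Sum>n\<in>N. u n * e' n) - (\<Sum>n\<in>M. g n * gg' n) - (\<Sum>n\<in>M'. g3 n * gt n) + (\<Sum>s\<in>L. F s * hF' s)"
  shows "c1 * T + c2 * T = (\<Sum>n\<in>N. u n * (c1 * e n + c2 * e' n)) + (\<Sum>s\<in>L. F s * (c1 * hF s + c2 * hF' s))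
     - (\<Sum>n\<in>M. g n * (c1 * gg n + c2 * gg' n)) - (\<Sum>n\<in>M'. g3 n * (c2 * gt n))"
proof -
  have 1: "(\<Sum>s\<in>I. v s * (c1 * x s + c2 * y s)) = c1 * (\<Sum>s\<in>I. v s * x s) + c2 * (\<Sum>s\<in>I. v s * y s)"
    for I :: "'s set" and v x y
    by (simp add: sum_distrib_left sum.distrib algebra_simps)
  have 2: "(\<Sum>n\<in>M'. g3 n * (c2 * gt n)) = c2 * (\<Sum>n\<in>M'. g3 n * gt n)"
    by (simp add: sum_distrib_left mult.left_commute)
  have 3: "c1 * T + c2 * T
     = c1 * ((\<Sum>n\<in>N. u n * e n) - (\<Sum>n\<in>M. g n * gg n) + (\<Sum>s\<in>L. F s * hF s))
     + c2 * ((\<Sum>n\<in>N. u n * e' n) - (\<Sum>n\<in>M. g n * gg' n) - (\<Sum>n\<in>M'. g3 n * gt n) + (\<Sum>s\<in>L. F s * hF' s))"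
    using assms by simp
  show ?thesis unfolding 1 2 3 by (simp only: distrib_left right_diff_distrib)
qed

text \<open>An exact identity in \<open>h\<close>: \<open>Jf\<close>, \<open>Jg1\<close> and
  \<open>Jg3\<close> are precisely the factors of the data in the weighted expansions, so the data
  cancel and the left-hand sides of the linear system survive, weighted by the free derivatives
  \<open>U 0 n\<close>.\<close>

lemma scheme_residual:
  assumes "pde_jet A B R F U" and "bc_jet al g1 U" and "bc_jet be g3 (\<lambda>m n. U n m)"
  shows "inverse h * (\<Sum>k=0..1. \<Sum>l=0..1. Ckl ch ct k l h * taylor6 U (real k * h) (real l * h))
     - ((\<Sum>(m, n)\<in>Lam 4. F m n * Jf A B R be ch ct m n h)
        + (\<Sum>n=0..5. g1 n * Jg1 A B be ch ct n h) + (\<Sum>m=0..5. g3 m * Jg3 A B ct m h))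
    = inverse h * (\<Sum>n=0..6. U 0 n * (\<Sum>k=0..1. \<Sum>l=0..1.
       Cpol ch k l h * En A B al n (real k * h) (real l * h)
     + Cpol ct k l h * (\<Sum>m=0..6. pmn A B al m n * Ent A B be m (real k * h) (real l * h))))"
proof -
  have T1: "taylor6 U x y = (\<Sum>n=0..6. U 0 n * En A B al n x y) - (\<Sum>n=0..5. g1 n * G6 A B 1 n x y)
     + (\<Sum>s\<in>Lam 4. F (fst s) (snd s) * H6 A B R (fst s) (snd s) x y)" for x y
    using taylor6_jet[OF assms(1,2)] by (simp only: case_prod_unfold)
  have T2: "taylor6 U x y
     = (\<Sum>n=0..6. U 0 n * (\<Sum>m=0..6. pmn A B al m n * Ent A B be m x y))
      - (\<Sum>n=0..5. g1 n * (\<Sum>m=0..6. mu A B m n * Ent A B be m x y))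
      - (\<Sum>m=0..5. g3 m * G6t A B m 1 x y)
      + (\<Sum>s\<in>Lam 4. F (fst s) (snd s) * (H6t A B R (fst s) (snd s) x y
           + (\<Sum>m=0..6. nu A B R m (fst s) (snd s) * Ent A B be m x y)))"
    for x y
  proof -
    have "(\<Sum>m=0..6. U m 0 * Ent A B be m x y)
       = (\<Sum>m=0..6. ((\<Sum>n=0..6. pmn A B al m n * U 0 n) - (\<Sum>n=0..5. mu A B m n * g1 n)
           + (\<Sum>(i, j)\<in>Lam 4. nu A B R m i j * F i j)) * Ent A B be m x y)"
      by (intro sum.cong refl arg_cong2[where f = "(*)"] jet_x_axis[OF assms(1,2)]) simp
    also have "\<dots> = (\<Sum>n=0..6. U 0 n * (\<Sum>m=0..6. pmn A B al m n * Ent A B be m x y))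
      - (\<Sum>n=0..5. g1 n * (\<Sum>m=0..6. mu A B m n * Ent A B be m x y))
      + (\<Sum>s\<in>Lam 4. F (fst s) (snd s) * (\<Sum>m=0..6. nu A B R m (fst s) (snd s) * Ent A B be m x y))"
      unfolding case_prod_unfold distrib_right left_diff_distrib sum.distrib sum_subtractf
        sum_distrib_left sum_distrib_right
      by (intro arg_cong2[where f = "(+)"] arg_cong2[where f = "(-)"];
          subst sum.swap; intro sum.cong refl; simp only: mult_ac)
    finally have "(\<Sum>m=0..6. U m 0 * Ent A B be m x y) = \<dots>" .
    then show ?thesis
      unfolding taylor6_jet_transpose[OF assms(1,3)] case_prod_unfold distrib_left sum.distrib by linarith
  qed
  have swap: "(\<Sum>k=0..1. \<Sum>l=0..1. \<Sum>s\<in>I. w s k l) = (\<Sum>s\<in>I. \<Sum>k=0..1. \<Sum>l=0..1. w s k l)"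
    for I :: "'s set" and w :: "'s \<Rightarrow> nat \<Rightarrow> nat \<Rightarrow> real"
    by (simp add: sum.distrib)
  have pull: "(\<Sum>k=0..1. \<Sum>l=0..1. \<Sum>s\<in>I. c s * w s k l) = (\<Sum>s\<in>I. c s * (\<Sum>k=0..1. \<Sum>l=0..1. w s k l))"
    for I :: "'s set" and c and w :: "'s \<Rightarrow> nat \<Rightarrow> nat \<Rightarrow> real"
    unfolding swap by (simp only: sum_distrib_left)
  have split: "(\<Sum>k=0..1. \<Sum>l=0..1. a k l + b k l - c k l - d k l)
     = (\<Sum>k=0..1. \<Sum>l=0..1. a k l) + (\<Sum>k=0..1. \<Sum>l=0..1. b k l) - (\<Sum>k=0..1. \<Sum>l=0..1. c k l)
       - (\<Sum>k=0..1. \<Sum>l=0..1. d k l)" for a b c d :: "nat \<Rightarrow> nat \<Rightarrow> real"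
    by (simp only: sum.distrib sum_subtractf)
  have J: "(\<Sum>s\<in>I. c s * (inverse h * w s)) = inverse h * (\<Sum>s\<in>I. c s * w s)"
    "(\<Sum>s\<in>I. c s * (- inverse h * w s)) = - (inverse h * (\<Sum>s\<in>I. c s * w s))"
    for I :: "'s set" and c w :: "'s \<Rightarrow> real"
    by (simp_all add: sum_distrib_left sum_negf mult.left_commute)
  show ?thesis
    unfolding Ckl_def distrib_right two_expansions_sum[OF T1 T2] split pull
      Jf_def Jg1_def Jg3_def case_prod_unfold J
    by (simp only: right_diff_distrib distrib_left)
qed

section \<open>The linear system\<close>

text \<open>The homogeneous part of degree \<open>d\<close>. At a grid point
  \<open>(k h, l h)\<close> it contributes \<open>h ^ d\<close> times its value at
  \<open>(k, l)\<close>, which separates the powers of \<open>h\<close>.\<close>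

definition hcomp :: "(nat \<Rightarrow> nat \<Rightarrow> real) \<Rightarrow> nat \<Rightarrow> real \<Rightarrow> real \<Rightarrow> real" where
  "hcomp w d x y = (\<Sum>p\<le>d. w p (d - p) / (fact p * fact (d - p)) * x ^ p * y ^ (d - p))"

lemma taylor6_hcomp: "taylor6 w (x * h) (y * h) = (\<Sum>d\<le>6. hcomp w d x y * h ^ d)"
proof -
  have "taylor6 w (x * h) (y * h) = (\<Sum>d\<le>6. \<Sum>p\<le>d. w p (d - p) / (fact p * fact (d - p)) * (x * h) ^ p * (y * h) ^ (d - p))"
    unfolding taylor6_def Lam_def by (rule sum.triangle_reindex_eq)
  also have "\<dots> = (\<Sum>d\<le>6. hcomp w d x y * h ^ d)"
    unfolding hcomp_def sum_distrib_right
    by (intro sum.cong refl) (auto simp: power_mult_distrib power_add[symmetric])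
  finally show ?thesis .
qed

definition trunc :: "(nat \<Rightarrow> real) \<Rightarrow> real poly" where
  "trunc c = (\<Sum>p\<le>6. monom (c p) p)"

lemma coeff_trunc: "coeff (trunc c) i = (if i \<le> 6 then c i else 0)"
  by (simp add: trunc_def coeff_sum)

lemma poly_trunc: "poly (trunc c) h = (\<Sum>p\<le>6. c p * h ^ p)"
  by (simp add: trunc_def poly_sum poly_monom)

text \<open>A polynomial is determined by its values on the reals, so the witness in
  \<open>poly_O7\<close> can only be \<open>Q\<close>.\<close>

lemma poly_O7_iff:
  assumes "\<And>h. F h = poly Q h"
  shows "poly_O7 F \<longleftrightarrow> (\<forall>i\<le>6. coeff Q i = 0)"
proof -
  have "Q' = Q" if "\<forall>h. F h = poly Q' h" for Q'
    using that assms poly_eq_poly_eq_iff[of Q' Q] by auto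
  then show ?thesis using assms unfolding poly_O7_def by blast
qed

text \<open>The coefficient of \<open>h ^ r\<close> in the \<open>n\<close>-th equation, a Cauchy
  product. Keeping the families \<open>e\<close> and \<open>d\<close> abstract lets the solvability
  argument work with their low and leading parts alone.\<close>

definition sysval :: "(nat \<Rightarrow> nat \<Rightarrow> nat \<Rightarrow> nat \<Rightarrow> real) \<Rightarrow> (nat \<Rightarrow> nat \<Rightarrow> nat \<Rightarrow> nat \<Rightarrow> real)
    \<Rightarrow> (nat \<Rightarrow> nat \<Rightarrow> nat \<Rightarrow> real) \<Rightarrow> (nat \<Rightarrow> nat \<Rightarrow> nat \<Rightarrow> real) \<Rightarrow> nat \<Rightarrow> nat \<Rightarrow> real" where
  "sysval e d ch ct n r = (\<Sum>k=0..1. \<Sum>l=0..1. \<Sum>p\<le>r.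
      ch k l p * e n (r - p) k l + ct k l p * d n (r - p) k l)"

text \<open>\<open>ewt \<dots> n\<close> and \<open>dwt \<dots> n\<close> are the scaled Taylor coefficients of the functions multiplying the hat and
  the tilde unknowns in the \<open>n\<close>-th equation.\<close>

definition ewt :: "(nat \<Rightarrow> nat \<Rightarrow> real) \<Rightarrow> (nat \<Rightarrow> nat \<Rightarrow> real) \<Rightarrow> (nat \<Rightarrow> real) \<Rightarrow> nat \<Rightarrow> nat \<Rightarrow> nat \<Rightarrow> real" where
  "ewt A B al n p q = au A B p q 0 n
     + (1 - delta6 n) * (\<Sum>i=n..5. real (i choose n) * al (i - n) * au A B p q 1 i)"

definition dwt :: "(nat \<Rightarrow> nat \<Rightarrow> real) \<Rightarrow> (nat \<Rightarrow> nat \<Rightarrow> real) \<Rightarrow> (nat \<Rightarrow> real) \<Rightarrow> (nat \<Rightarrow> real)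
    \<Rightarrow> nat \<Rightarrow> nat \<Rightarrow> nat \<Rightarrow> real" where
  "dwt A B al be n p q = (\<Sum>m=0..6. pmn A B al m n * ewt (\<lambda>m n. B n m) (\<lambda>m n. A n m) be m q p)"

lemma En_taylor6: "En A B al n x y = taylor6 (ewt A B al n) x y"
proof -
  have "taylor6 (ewt A B al n) x y = taylor6 (\<lambda>p q. au A B p q 0 n
     + (1 - delta6 n) * (\<Sum>i=n..5. real (i choose n) * al (i - n) * au A B p q 1 i)) x y"
    by (simp add: ewt_def[abs_def])
  then show ?thesis
    unfolding taylor6_add taylor6_scale taylor6_sum[where c = "\<lambda>i. real (i choose n) * al (i - n)"] En_def G6_taylor6
    by simp
qed

lemma sum_pmn_Ent_taylor6: "(\<Sum>m=0..6. pmn A B al m n * Ent A B be m x y) = taylor6 (dwt A B al be n) x y"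
proof -
  have "Ent A B be m x y = taylor6 (\<lambda>p q. ewt (\<lambda>m n. B n m) (\<lambda>m n. A n m) be m q p) x y" for m
    unfolding Ent_eq_En En_taylor6 by (rule taylor6_transpose[symmetric])
  moreover have "taylor6 (dwt A B al be n) x y
     = taylor6 (\<lambda>p q. \<Sum>m=0..6. pmn A B al m n * ewt (\<lambda>m n. B n m) (\<lambda>m n. A n m) be m q p) x y"
    by (simp add: dwt_def[abs_def])
  ultimately show ?thesis
    unfolding taylor6_sum[where c = "\<lambda>m. pmn A B al m n"] by simp
qed

definition esys :: "(nat \<Rightarrow> nat \<Rightarrow> real) \<Rightarrow> (nat \<Rightarrow> nat \<Rightarrow> real) \<Rightarrow> (nat \<Rightarrow> real) \<Rightarrow> nat \<Rightarrow> nat \<Rightarrow> nat \<Rightarrow> nat \<Rightarrow> real" where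
  "esys A B al n d k l = hcomp (ewt A B al n) d (real k) (real l)"

definition dsys :: "(nat \<Rightarrow> nat \<Rightarrow> real) \<Rightarrow> (nat \<Rightarrow> nat \<Rightarrow> real) \<Rightarrow> (nat \<Rightarrow> real) \<Rightarrow> (nat \<Rightarrow> real)
   \<Rightarrow> nat \<Rightarrow> nat \<Rightarrow> nat \<Rightarrow> nat \<Rightarrow> real" where
  "dsys A B al be n d k l = hcomp (dwt A B al be n) d (real k) (real l)"

text \<open>Each of the seven polynomial conditions becomes seven scalar equations. Values of
  \<open>ch\<close> and \<open>ct\<close> beyond index 6 are cut off by \<open>trunc\<close> and
  cannot reach the coefficients up to \<open>h ^ 6\<close>.\<close>

lemma corner_system_iff:
  "corner_system A B al be ch ct
   \<longleftrightarrow> (\<forall>n\<le>6. \<forall>r\<le>6. sysval (esys A B al) (dsys A B al be) ch ct n r = 0)"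
proof -
  let ?Q = "\<lambda>n. \<Sum>k=0..1. \<Sum>l=0..1. trunc (ch k l) * trunc (\<lambda>d. esys A B al n d k l)
       + trunc (ct k l) * trunc (\<lambda>d. dsys A B al be n d k l)"
  have F: "(\<Sum>k=0..1. \<Sum>l=0..1.
       Cpol ch k l h * En A B al n (real k * h) (real l * h)
     + Cpol ct k l h * (\<Sum>m=0..6. pmn A B al m n * Ent A B be m (real k * h) (real l * h)))
     = poly (?Q n) h" for n h
    by (simp add: poly_sum poly_trunc Cpol_def atLeast0AtMost En_taylor6
        sum_pmn_Ent_taylor6[unfolded atLeast0AtMost] taylor6_hcomp esys_def dsys_def)
  have c: "coeff (trunc a * trunc b) r = (\<Sum>p\<le>r. a p * b (r - p))" if "r \<le> 6" for a b r
    unfolding coeff_mult by (intro sum.cong) (use that in \<open>auto simp: coeff_trunc\<close>)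
  have "coeff (?Q n) r = sysval (esys A B al) (dsys A B al be) ch ct n r" if "r \<le> 6" for n r
    unfolding sysval_def coeff_sum coeff_add c[OF that] by (simp add: sum.distrib)
  then show ?thesis
    unfolding corner_system_def poly_O7_iff[OF F] by auto
qed

text \<open>The real part of \<open>(l + \<i> k)\<^sup>n / n!\<close>.\<close>

definition hpoly :: "nat \<Rightarrow> nat \<Rightarrow> nat \<Rightarrow> real" where
  "hpoly n k l = hcomp (\<lambda>p q. if even p then (-1) ^ (p div 2) else 0) n (real k) (real l)"

lemma hpoly_values:
  "hpoly 0 k l = 1"
  "hpoly (Suc 0) 0 0 = 0" "hpoly (Suc 0) (Suc 0) 0 = 0" "hpoly (Suc 0) 0 (Suc 0) = 1"
  "hpoly (Suc 0) (Suc 0) (Suc 0) = 1"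
  "hpoly 2 0 0 = 0" "hpoly 2 (Suc 0) 0 = - 1 / 2" "hpoly 2 0 (Suc 0) = 1 / 2"
  "hpoly 2 (Suc 0) (Suc 0) = 0"
  "hpoly 3 0 0 = 0" "hpoly 3 (Suc 0) 0 = 0" "hpoly 3 0 (Suc 0) = 1 / 6"
  "hpoly 3 (Suc 0) (Suc 0) = - 1 / 3"
  "hpoly 4 0 0 = 0" "hpoly 4 (Suc 0) 0 = 1 / 24" "hpoly 4 0 (Suc 0) = 1 / 24"
  "hpoly 4 (Suc 0) (Suc 0) = - 1 / 6"
  "hpoly 6 0 0 = 0" "hpoly 6 (Suc 0) 0 = - 1 / 720" "hpoly 6 0 (Suc 0) = 1 / 720"
  "hpoly 6 (Suc 0) (Suc 0) = 0"
  by (simp_all add: hpoly_def hcomp_def atMost_nat_numeral fact_numeral)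

section \<open>Leading homogeneous parts of the two groups of coefficient functions\<close>

lemma ewt_low: "p + q < n \<Longrightarrow> ewt A B al n p q = 0"
  by (simp add: ewt_def au_low)

lemma ewt_top: "p + q = n \<Longrightarrow> ewt A B al n p q = (if even p then (-1) ^ (p div 2) else 0)"
  by (simp add: ewt_def au_low au_top)

lemma pmn_low: "m < n \<Longrightarrow> pmn A B al m n = 0"
  by (simp add: pmn_def lam_def mu_def au_low)

text \<open>For odd \<open>n\<close> the \<open>n\<close>-th x-derivative reduces in top order to
  one with a single x-derivative, which the boundary condition trades for lower order. This is the
  defect of the odd equations.\<close>

lemma pmn_diag: "pmn A B al n n = (if even n then (-1) ^ (n div 2) else 0)"
  by (simp add: pmn_def lam_def mu_def au_low au_top)

lemma dwt_low: "p + q < n \<Longrightarrow> dwt A B al be n p q = 0"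
  unfolding dwt_def by (rule sum.neutral) (metis ewt_low pmn_low mult_eq_0_iff not_less_iff_gr_or_eq order_less_trans add.commute)

text \<open>Coefficientwise form of \<open>(x + i y)^n = i^n (y - i x)^n\<close>, real parts taken
  for even \<open>n\<close>; it converts the mirrored harmonic polynomial into the unmirrored
  one.\<close>

lemma sign_split:
  assumes "p + q = n" "even n"
  shows "(-1) ^ (n div 2) * (if even q then (-1) ^ (q div 2) else 0)
    = (if even p then (-1) ^ (p div 2) else (0 :: real))"
proof (cases "even q")
  case True
  then have "n div 2 = p div 2 + q div 2" "even p" using assms by auto
  then show ?thesis using True by (simp add: power_add power_mult_distrib[symmetric])
qed (use assms in auto)

text \<open>In degree \<open>n\<close> only \<open>m = n\<close> survives: \<open>pmn\<close>
  vanishes for \<open>m < n\<close> and \<open>ewt\<close> for \<open>m > n\<close>.\<close>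

lemma dwt_top:
  assumes "p + q = n" "n \<le> 6"
  shows "dwt A B al be n p q = (if even n \<and> even p then (-1) ^ (p div 2) else 0)"
proof -
  have "dwt A B al be n p q = (\<Sum>m\<in>{n}. pmn A B al m n * ewt (\<lambda>m n. B n m) (\<lambda>m n. A n m) be m q p)"
    unfolding dwt_def
    by (rule sum.mono_neutral_right) (use assms in \<open>auto simp: ewt_low pmn_low neq_iff\<close>)
  also have "\<dots> = pmn A B al n n * (if even q then (-1) ^ (q div 2) else 0)"
    using assms by (simp add: ewt_top)
  also have "\<dots> = (if even n \<and> even p then (-1) ^ (p div 2) else 0)"
    by (cases "even n") (simp_all only: pmn_diag sign_split[OF assms(1)] if_True if_False simp_thms mult_zero_left)
  finally show ?thesis .
qed

text \<open>One degree higher, the summand \<open>m = n\<close> is lost because \<open>pmn\<close>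
  vanishes on the diagonal at odd \<open>n\<close>. This leaves \<open>m = n + 1\<close>, whose
  degree is even, so \<open>sign_split\<close> applies.\<close>

lemma dwt_odd_next:
  assumes "p + q = Suc n" "odd n" "n \<le> 5"
  shows "dwt A B al be n p q = pmn A B al (Suc n) n * (-1) ^ (Suc n div 2)
    * (if even p then (-1) ^ (p div 2) else 0)"
proof -
  have *: "ewt (\<lambda>m n. B n m) (\<lambda>m n. A n m) be m q p = 0 \<or> pmn A B al m n = 0" if "m \<noteq> Suc n" for m
    using that assms(1,2) by (cases m n rule: linorder_cases) (auto simp: ewt_low pmn_low pmn_diag)
  have "dwt A B al be n p q = (\<Sum>m\<in>{Suc n}. pmn A B al m n * ewt (\<lambda>m n. B n m) (\<lambda>m n. A n m) be m q p)"
    unfolding dwt_def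
    by (rule sum.mono_neutral_right) (use assms * in \<open>auto simp del: power_Suc\<close>)
  also have "\<dots> = pmn A B al (Suc n) n * (if even q then (-1) ^ (q div 2) else 0)"
    using assms by (simp add: ewt_top)
  also have "(if even q then (-1) ^ (q div 2) else (0::real))
     = (-1) ^ (Suc n div 2) * (if even p then (-1) ^ (p div 2) else 0)"
    using sign_split[of q p "Suc n"] assms by (simp add: add.commute)
  finally show ?thesis by simp
qed

lemma hcomp_cong: "(\<And>p q. p + q = d \<Longrightarrow> w p q = w' p q) \<Longrightarrow> hcomp w d x y = hcomp w' d x y"
  unfolding hcomp_def by (intro sum.cong) auto

lemma hcomp_scale: "hcomp (\<lambda>p q. c * w p q) d x y = c * hcomp w d x y"
  by (simp add: hcomp_def sum_distrib_left ac_simps)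

lemma hcomp_zero: "hcomp (\<lambda>p q. 0) d x y = 0"
  by (simp add: hcomp_def)

lemma esys_low: "d < n \<Longrightarrow> esys A B al n d k l = 0"
  using hcomp_cong[of d "ewt A B al n" "\<lambda>_ _. 0"] by (simp add: esys_def ewt_low hcomp_zero)

lemma dsys_low: "d < n \<Longrightarrow> dsys A B al be n d k l = 0"
  using hcomp_cong[of d "dwt A B al be n" "\<lambda>_ _. 0"] by (simp add: dsys_def dwt_low hcomp_zero)

lemma esys_top: "esys A B al n n k l = hpoly n k l"
  unfolding esys_def hpoly_def by (rule hcomp_cong) (rule ewt_top)

lemma dsys_top:
  assumes "n \<le> 6"
  shows "dsys A B al be n n k l = (if even n then hpoly n k l else 0)"
proof -
  have "dsys A B al be n n k l = hcomp (\<lambda>p q. if even n \<and> even p then (-1) ^ (p div 2) else 0) n (real k) (real l)"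
    unfolding dsys_def by (rule hcomp_cong) (simp add: dwt_top assms)
  then show ?thesis by (simp add: hpoly_def hcomp_zero)
qed

lemma dsys_odd_next:
  assumes "odd n" "n \<le> 5"
  shows "dsys A B al be n (Suc n) k l = pmn A B al (Suc n) n * (-1) ^ (Suc n div 2) * hpoly (Suc n) k l"
  unfolding dsys_def hpoly_def hcomp_scale[symmetric] by (rule hcomp_cong) (rule dwt_odd_next[OF _ assms])

lemma esys_0_1: "esys A B al 0 (Suc 0) (Suc 0) 0 = al 0"
  by (simp add: esys_def hcomp_def ewt_def au_def delta6_def eval_nat_numeral)

text \<open>With zero boundary data, \<open>u_x = \<alpha> u\<close> and
  \<open>u_y = \<beta> u\<close> at the corner, so the linear part is that of
  \<open>u (1 + \<alpha> x + \<beta> y)\<close>. In contrast, \<open>En\<close> keeps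
  \<open>u_y\<close> as a separate parameter and shows \<alpha> only.\<close>

lemma dsys_0_1: "dsys A B al be 0 (Suc 0) k l = al 0 * real k + be 0 * real l"
  by (simp add: dsys_def hcomp_def dwt_def pmn_def lam_def mu_def ewt_def au_def delta6_def eval_nat_numeral)

section \<open>Block triangularity and solvability\<close>

lemma sysval_split:
  assumes "\<forall>n d k l. d < n \<longrightarrow> e n d k l = 0" and "\<forall>n d k l. d < n \<longrightarrow> d' n d k l = 0"
  shows "sysval e d' ch ct n (n + p)
    = (\<Sum>k=0..1. \<Sum>l=0..1. ch k l p * e n n k l + ct k l p * d' n n k l)
      + (\<Sum>k=0..1. \<Sum>l=0..1. \<Sum>j<p. ch k l j * e n (n + p - j) k l + ct k l j * d' n (n + p - j) k l)"
proof -
  have "(\<Sum>j\<le>n+p. ch k l j * e n (n + p - j) k l + ct k l j * d' n (n + p - j) k l)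
      = (\<Sum>j\<le>p. ch k l j * e n (n + p - j) k l + ct k l j * d' n (n + p - j) k l)" for k l
  proof (rule sum.mono_neutral_right)
    show "\<forall>j\<in>{..n + p} - {..p}. ch k l j * e n (n + p - j) k l + ct k l j * d' n (n + p - j) k l = 0"
    proof
      fix j assume "j \<in> {..n + p} - {..p}"
      \<comment> \<open>Unknowns of level \<open>j > p\<close> meet only degrees below
        \<open>n\<close>, where both families vanish; this makes the system triangular in the
        level.\<close>
      then have "n + p - j < n" by auto
      then show "ch k l j * e n (n + p - j) k l + ct k l j * d' n (n + p - j) k l = 0"
        by (simp add: assms)
    qed
  qed auto
  also have "\<dots> k l = (ch k l p * e n n k l + ct k l p * d' n n k l)
      + (\<Sum>j<p. ch k l j * e n (n + p - j) k l + ct k l j * d' n (n + p - j) k l)" for k l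
    by (simp add: lessThan_Suc_atMost[symmetric])
  finally show ?thesis unfolding sysval_def by (simp only: sum.distrib)
qed

definition pick :: "real \<Rightarrow> real \<Rightarrow> real \<Rightarrow> real \<Rightarrow> nat \<Rightarrow> nat \<Rightarrow> real" where
  "pick c00 c10 c01 c11 k l = (if l = 0 then if k = 0 then c00 else c10 else if k = 0 then c01 else c11)"

text \<open>The weight at \<open>(1,1)\<close> is set to zero. Degree 2 gives the difference and
  degree 4 the sum of the weights at \<open>(0,1)\<close> and \<open>(1,0)\<close>; degree 0 gives
  the weight at the corner.\<close>

lemma solve_even:
  "\<exists>y. \<forall>n\<in>{0, 2, 4}. (\<Sum>k=0..1. \<Sum>l=0..1. y k l * hpoly n k l) = \<rho> n"
  by (rule exI[of _ "pick (\<rho> 0 - 24 * \<rho> 4) (12 * \<rho> 4 - \<rho> 2) (12 * \<rho> 4 + \<rho> 2) 0"])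
     (auto simp: pick_def hpoly_values field_simps)

text \<open>Both odd polynomials vanish at \<open>(0,0)\<close> and \<open>(1,0)\<close>. Their
  values 1, 1 and 1/6, -1/3 at the other two nodes form an invertible matrix, which the witness
  inverts.\<close>

lemma solve_odd:
  "\<exists>x. \<forall>n\<in>{1, 3}. (\<Sum>k=0..1. \<Sum>l=0..1. x k l * hpoly n k l) = \<rho> n"
  by (rule exI[of _ "pick 0 0 (2 * \<rho> 1 / 3 + 2 * \<rho> 3) (\<rho> 1 / 3 - 2 * \<rho> 3)"])
     (auto simp: pick_def hpoly_values field_simps)

lemma even_cases_6: "even n \<Longrightarrow> n \<le> 6 \<Longrightarrow> n \<in> {0, 2, 4, 6 :: nat}"
  unfolding insert_iff empty_iff by presburger

lemma even_cases_5: "even n \<Longrightarrow> n \<le> 5 \<Longrightarrow> n \<in> {0, 2, 4 :: nat}"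
  unfolding insert_iff empty_iff by presburger

lemma odd_cases_4: "odd n \<Longrightarrow> n \<le> 4 \<Longrightarrow> n \<in> {1, 3 :: nat}"
  unfolding insert_iff empty_iff by presburger

text \<open>The odd equations contain \<open>x\<close> only and the even ones \<open>x + y\<close>
  only, so the two can be prescribed independently.\<close>

lemma solve_level:
  "\<exists>x y. \<forall>n\<le>4. (\<Sum>k=0..1. \<Sum>l=0..1. x k l * hpoly n k l + y k l * (if even n then hpoly n k l else 0)) = \<rho> n"
proof -
  obtain c where c: "\<forall>n\<in>{0, 2, 4}. (\<Sum>k=0..1. \<Sum>l=0..1. c k l * hpoly n k l) = \<rho> n"
    using solve_even by blast
  obtain x where x: "\<forall>n\<in>{1, 3}. (\<Sum>k=0..1. \<Sum>l=0..1. x k l * hpoly n k l) = \<rho> n"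
    using solve_odd by blast
  have "(\<Sum>k=0..1. \<Sum>l=0..1. x k l * hpoly n k l + (c k l - x k l) * (if even n then hpoly n k l else 0)) = \<rho> n"
    if "n \<le> 4" for n
  proof (cases "even n")
    case True
    then have "n \<in> {0, 2, 4}" using that by (intro even_cases_5) auto
    then have "(\<Sum>k=0..1. \<Sum>l=0..1. c k l * hpoly n k l) = \<rho> n" using c by blast
    then show ?thesis using True by (simp add: algebra_simps)
  next
    case False
    then have "n \<in> {1, 3}" using that by (intro odd_cases_4) auto
    then have "(\<Sum>k=0..1. \<Sum>l=0..1. x k l * hpoly n k l) = \<rho> n" using x by blast
    then show ?thesis using False by simp
  qed
  then show ?thesis by (intro exI[of _ x] exI[of _ "\<lambda>k l. c k l - x k l"] allI impI)
qed

text \<open>Induction over the levels, with levels 0 and 1 as a joint base case because three odd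
  equations cannot be solved for arbitrary right-hand sides. The value 5 in the conclusion records
  nontriviality.\<close>

lemma system_solvable:
  assumes elow: "\<forall>n d k l. d < n \<longrightarrow> e n d k l = 0" and dlow: "\<forall>n d k l. d < n \<longrightarrow> d' n d k l = 0"
    and etop: "\<And>n k l. e n n k l = hpoly n k l"
    and dtop: "\<And>n k l. n \<le> 6 \<Longrightarrow> d' n n k l = (if even n then hpoly n k l else 0)"
    and dnext: "\<And>n k l. odd n \<Longrightarrow> n \<le> 5 \<Longrightarrow> d' n (Suc n) k l = \<kappa> n * hpoly (Suc n) k l"
  shows "\<exists>ch ct. (\<forall>n p. n + p \<le> 6 \<longrightarrow> sysval e d' ch ct n (n + p) = 0)
    \<and> ch 0 0 0 + ct 0 0 0 = 5"
proof -
  note split = sysval_split[OF elow dlow]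
  have "\<exists>ch ct. (\<forall>n p. p \<le> Suc P \<longrightarrow> n + p \<le> 6 \<longrightarrow> sysval e d' ch ct n (n + p) = 0)
      \<and> ch 0 0 0 + ct 0 0 0 = 5" for P
  proof (induction P)
    case 0
    \<comment> \<open>Degrees 0, 2 and 4 determine these weights up to a factor. Degree 6 is then
      annihilated too, its values at \<open>(1,0)\<close> and \<open>(0,1)\<close> being opposite
      and those at the other nodes zero.\<close>
    let ?c = "pick 5 (-2) (-2) (-1)"
    have c: "(\<Sum>k=0..1. \<Sum>l=0..1. ?c k l * hpoly n k l) = 0" if "even n" "n \<le> 6" for n
    proof -
      have "n \<in> {0, 2, 4, 6}" using that by (intro even_cases_6)
      then show ?thesis by (auto simp: pick_def hpoly_values)
    qed
    obtain y where y: "\<forall>n\<in>{0, 2, 4}. (\<Sum>k=0..1. \<Sum>l=0..1. y k l * hpoly n k l)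
        = - (\<Sum>k=0..1. \<Sum>l=0..1. ?c k l * d' n (Suc n) k l)"
      using solve_even[of "\<lambda>n. - (\<Sum>k=0..1. \<Sum>l=0..1. ?c k l * d' n (Suc n) k l)"] by blast
    let ?ct = "\<lambda>k l p :: nat. if p = 0 then ?c k l else y k l"
    have "sysval e d' (\<lambda>_ _ _. 0) ?ct n (n + p) = 0" if "p \<le> Suc 0" "n + p \<le> 6" for n p
    proof (cases "p = 0")
      case True
      then have "n \<le> 6" using that by simp
      have "sysval e d' (\<lambda>_ _ _. 0) ?ct n (n + p) = (\<Sum>k=0..1. \<Sum>l=0..1. ?c k l * d' n n k l)"
        unfolding split by (simp add: True)
      also have "\<dots> = 0" using c[of n] \<open>n \<le> 6\<close> dtop[of n] by (cases "even n") auto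
      finally show ?thesis .
    next
      case False
      then have p: "p = Suc 0" and n: "n \<le> 5" using that by auto
      have "sysval e d' (\<lambda>_ _ _. 0) ?ct n (n + p)
         = (\<Sum>k=0..1. \<Sum>l=0..1. y k l * d' n n k l) + (\<Sum>k=0..1. \<Sum>l=0..1. ?c k l * d' n (Suc n) k l)"
        unfolding split by (simp add: p)
      also have "\<dots> = 0"
      proof (cases "even n")
        case True
        then have "n \<in> {0, 2, 4}" using n by (intro even_cases_5) auto
        then have "(\<Sum>k=0..1. \<Sum>l=0..1. y k l * hpoly n k l)
           = - (\<Sum>k=0..1. \<Sum>l=0..1. ?c k l * d' n (Suc n) k l)" using y by blast
        then show ?thesis using True n by (simp add: dtop)
      next
        case False
        \<comment> \<open>In an odd equation of level 1 the tilde unknowns of that level do not act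
          and the hat ones are zero. What \<open>?c\<close> contributes is a multiple of an even
          degree up to 6, which it annihilates.\<close>
        have "(\<Sum>k=0..1. \<Sum>l=0..1. ?c k l * d' n (Suc n) k l)
            = \<kappa> n * (\<Sum>k=0..1. \<Sum>l=0..1. ?c k l * hpoly (Suc n) k l)"
          using dnext[OF False n] by (simp add: algebra_simps)
        then show ?thesis using c[of "Suc n"] dtop[of n] n False by simp
      qed
      finally show ?thesis .
    qed
    then show ?case
      by (intro exI[of _ "\<lambda>_ _ _. 0"] exI[of _ ?ct]) (simp add: pick_def)
  next
    case (Suc P)
    then obtain ch ct where IH: "\<And>n p. p \<le> Suc P \<Longrightarrow> n + p \<le> 6 \<Longrightarrow> sysval e d' ch ct n (n + p) = 0"
      and nt: "ch 0 0 0 + ct 0 0 0 = 5" by blast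
    let ?q = "Suc (Suc P)"
    let ?rest = "\<lambda>n. \<Sum>k=0..1. \<Sum>l=0..1. \<Sum>j<?q. ch k l j * e n (n + ?q - j) k l + ct k l j * d' n (n + ?q - j) k l"
    obtain x y where xy: "\<And>n. n \<le> 4 \<Longrightarrow>
        (\<Sum>k=0..1. \<Sum>l=0..1. x k l * hpoly n k l + y k l * (if even n then hpoly n k l else 0)) = - ?rest n"
      using solve_level[of "\<lambda>n. - ?rest n"] by blast
    let ?ch = "\<lambda>k l p. if p = ?q then x k l else ch k l p"
    let ?ct = "\<lambda>k l p. if p = ?q then y k l else ct k l p"
    have "sysval e d' ?ch ?ct n (n + p) = 0" if "p \<le> ?q" "n + p \<le> 6" for n p
    proof (cases "p = ?q")
      case True
      \<comment> \<open>From level 2 on the equations are those with \<open>n \<le> 4\<close>,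
        exactly the range of \<open>solve_level\<close>.\<close>
      then have n: "n \<le> 4" using that by simp
      have "sysval e d' ?ch ?ct n (n + p)
         = (\<Sum>k=0..1. \<Sum>l=0..1. x k l * e n n k l + y k l * d' n n k l) + ?rest n"
        unfolding split True by (intro arg_cong2[where f = "(+)"] sum.cong) auto
      also have "\<dots> = 0" using xy[OF n] n by (simp only: etop dtop)
      finally show ?thesis .
    next
      case False
      have "sysval e d' ?ch ?ct n (n + p) = sysval e d' ch ct n (n + p)"
        unfolding split using False that by (intro arg_cong2[where f = "(+)"] sum.cong) auto
      then show ?thesis using IH[of p n] that False by simp
    qed
    then show ?case
      using nt by (intro exI[of _ ?ch] exI[of _ ?ct]) simp
  qed
  \<comment> \<open>With \<open>P = 5\<close> all levels up to 6 are covered.\<close>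
  from this[of 5] obtain ch ct
    where "\<And>n p. p \<le> Suc 5 \<Longrightarrow> n + p \<le> 6 \<Longrightarrow> sysval e d' ch ct n (n + p) = 0"
      and "ch 0 0 0 + ct 0 0 0 = 5"
    by blast
  then show ?thesis by (intro exI[of _ ch] exI[of _ ct]) simp
qed

text \<open>Coefficients of \<open>h ^ r\<close> with \<open>r < n\<close> vanish identically, so
  the system may be indexed by equation and level.\<close>

lemma corner_system_iff_levels:
  "corner_system A B al be ch ct
   \<longleftrightarrow> (\<forall>n p. n + p \<le> 6 \<longrightarrow> sysval (esys A B al) (dsys A B al be) ch ct n (n + p) = 0)"
proof -
  have "sysval (esys A B al) (dsys A B al be) ch ct n r = 0" if "r < n" for n r
    unfolding sysval_def using that by (intro sum.neutral ballI) (simp add: esys_low dsys_low)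
  then have "(\<forall>n\<le>6. \<forall>r\<le>6. sysval (esys A B al) (dsys A B al be) ch ct n r = 0)
     \<longleftrightarrow> (\<forall>n p. n + p \<le> 6 \<longrightarrow> sysval (esys A B al) (dsys A B al be) ch ct n (n + p) = 0)"
    by (metis add_leD1 le_iff_add not_less)
  then show ?thesis
    unfolding corner_system_iff .
qed

lemma corner_system_solvable: "\<exists>ch ct. corner_system A B al be ch ct \<and> ch 0 0 0 + ct 0 0 0 = 5"
  unfolding corner_system_iff_levels
  by (rule system_solvable[where \<kappa> = "\<lambda>n. pmn A B al (Suc n) n * (-1) ^ (Suc n div 2)"])
     (simp_all add: esys_low dsys_low esys_top dsys_top dsys_odd_next del: power_Suc)

text \<open>At level 0 the even degrees leave one parameter \<open>s\<close> for the sums, and the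
  odd degrees 1 and 3 kill the hat weights at \<open>(0,1)\<close> and \<open>(1,1)\<close>. At
  level 1, equation 0 gives \<open>2 s (\<alpha> + \<beta>)\<close> from the edge nodes and
  \<open>s (\<alpha> + \<beta>)\<close> from the diagonal node.\<close>

lemma corner_system_leading:
  assumes "corner_system A B al be ch ct"
  obtains s where "ch 0 0 0 + ct 0 0 0 = 5 * s" "ch 1 0 0 + ct 1 0 0 = - 2 * s"
    "ch 0 1 0 + ct 0 1 0 = - 2 * s" "ch 1 1 0 + ct 1 1 0 = - s"
    "(\<Sum>k=0..1. \<Sum>l=0..1. ch k l 1 + ct k l 1) = 3 * s * (al 0 + be 0)"
proof -
  have low: "\<forall>n d k l. d < n \<longrightarrow> esys A B al n d k l = 0" "\<forall>n d k l. d < n \<longrightarrow> dsys A B al be n d k l = 0"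
    by (simp_all add: esys_low dsys_low)
  note split = sysval_split[OF low]
  have lev: "sysval (esys A B al) (dsys A B al be) ch ct n (n + p) = 0" if "n + p \<le> 6" for n p
    using assms that by (simp add: corner_system_iff_levels)
  have 0: "(\<Sum>k=0..1. \<Sum>l=0..1. ch k l 0 * hpoly n k l + ct k l 0 * (if even n then hpoly n k l else 0)) = 0"
    if "n \<le> 6" for n
    using lev[of n 0] that unfolding split by (simp add: esys_top dsys_top)
  \<comment> \<open>Without hat weights at the nodes with \<open>l = 1\<close>, the term in \<beta>
    enters with the full weights of the stencil.\<close>
  have ch: "ch 0 (Suc 0) 0 = 0" "ch (Suc 0) (Suc 0) 0 = 0"
    using 0[of 1] 0[of 3] by (simp_all add: hpoly_values)
  define s where "s = - ct 1 1 0"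
  have c: "ch 0 0 0 + ct 0 0 0 = 5 * s" "ch (Suc 0) 0 0 + ct (Suc 0) 0 0 = - 2 * s"
    "ch 0 (Suc 0) 0 + ct 0 (Suc 0) 0 = - 2 * s"  "ch (Suc 0) (Suc 0) 0 + ct (Suc 0) (Suc 0) 0 = - s"
    using 0[of 0] 0[of 2] 0[of 4] by (simp_all add: hpoly_values ch s_def field_simps)
  have "(\<Sum>k=0..1. \<Sum>l=0..1. ch k l 1 + ct k l 1)
      + ((ch 0 0 0 * esys A B al 0 1 0 0 + ct 0 0 0 * dsys A B al be 0 1 0 0)
       + (ch 1 0 0 * esys A B al 0 1 1 0 + ct 1 0 0 * dsys A B al be 0 1 1 0)
       + ct 0 1 0 * dsys A B al be 0 1 0 1 + ct 1 1 0 * dsys A B al be 0 1 1 1) = 0"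
    using lev[of 0 1] unfolding split by (simp add: esys_top dsys_top hpoly_values ch)
  moreover have "esys A B al 0 (Suc 0) 0 0 = 0"
    by (simp add: esys_def hcomp_def ewt_def au_def delta6_def)
  ultimately have "(\<Sum>k=0..1. \<Sum>l=0..1. ch k l 1 + ct k l 1)
      = - (al 0 * (ch (Suc 0) 0 0 + ct (Suc 0) 0 0) + be 0 * ct 0 (Suc 0) 0 + (al 0 + be 0) * ct (Suc 0) (Suc 0) 0)"
    by (simp add: esys_0_1 dsys_0_1 algebra_simps)
  also have "\<dots> = 3 * s * (al 0 + be 0)"
    using c ch by (simp add: algebra_simps)
  finally show thesis using c that by (simp add: s_def)
qed

section \<open>Multiplication of solutions by power series in \<open>h\<close>\<close>

definition tconv :: "(nat \<Rightarrow> real) \<Rightarrow> (nat \<Rightarrow> real) \<Rightarrow> nat \<Rightarrow> real" where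
  "tconv t c p = (\<Sum>j\<le>p. t j * c (p - j))"

lemma tconv_add: "tconv t (\<lambda>p. c p + c' p) p = tconv t c p + tconv t c' p"
  by (simp add: tconv_def distrib_left sum.distrib)

lemma tconv_minus: "tconv t (\<lambda>p. - c p) p = - tconv t c p"
  by (simp add: tconv_def sum_negf)

lemma tconv_assoc:
  "(\<Sum>p\<le>r. tconv t c p * e (r - p)) = (\<Sum>j\<le>r. t j * (\<Sum>p\<le>r-j. c p * e (r - j - p)))"
proof -
  have "(\<Sum>p\<le>r. tconv t c p * e (r - p)) = (\<Sum>p\<le>r. \<Sum>j\<le>p. t j * c (p - j) * e (r - (j + (p - j))))"
    unfolding tconv_def sum_distrib_right by (intro sum.cong refl) auto
  also have "\<dots> = (\<Sum>(j, i)\<in>{(j, i). j + i \<le> r}. t j * c i * e (r - (j + i)))"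
    by (rule sum.triangle_reindex_eq[symmetric])
  also have "\<dots> = (\<Sum>(j, i)\<in>(SIGMA j:{..r}. {..r - j}). t j * c i * e (r - (j + i)))"
    by (rule sum.cong) auto
  also have "\<dots> = (\<Sum>j\<le>r. \<Sum>i\<le>r-j. t j * c i * e (r - (j + i)))"
    by (rule sum.Sigma[symmetric]) auto
  finally show ?thesis by (simp add: sum_distrib_left mult.assoc)
qed

lemma sysval_tconv:
  "sysval e d (\<lambda>k l. tconv t (ch k l)) (\<lambda>k l. tconv t (ct k l)) n r
   = (\<Sum>j\<le>r. t j * sysval e d ch ct n (r - j))"
proof -
  note assoc = tconv_assoc[where e = "\<lambda>i. e n i k l" for k l] tconv_assoc[where e = "\<lambda>i. d n i k l" for k l]
  show ?thesis
    unfolding sysval_def sum.distrib assoc by (simp add: sum.distrib distrib_left)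
qed

text \<open>The equations hold modulo \<open>h^7\<close>, and multiplying all unknowns by one power
  series multiplies every equation by it.\<close>

lemma corner_system_tconv:
  assumes "corner_system A B al be ch ct"
  shows "corner_system A B al be (\<lambda>k l. tconv t (ch k l)) (\<lambda>k l. tconv t (ct k l))"
  using assms unfolding corner_system_iff sysval_tconv by (auto intro!: sum.neutral)

section \<open>Lexicographic positivity and multipliers\<close>

definition leads :: "(nat \<Rightarrow> real) \<Rightarrow> nat \<Rightarrow> bool" where
  "leads x k \<longleftrightarrow> (\<forall>p<k. x p = 0) \<and> x k > 0"

lemma leads_unique: "leads x k \<Longrightarrow> leads x l \<Longrightarrow> k = l"
  unfolding leads_def by (metis less_irrefl linorder_neqE_nat)

text \<open>The coefficient at \<open>k + q\<close> is \<open>t q * x k\<close> plus terms in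
  earlier \<open>t j\<close>. As \<open>x k > 0\<close>, a large enough \<open>t q\<close> makes it
  nonnegative for all of the finitely many sequences at once.\<close>

lemma rapid_multiplier:
  fixes X :: "(nat \<Rightarrow> real) set"
  assumes "finite X"
  shows "\<exists>t. t 0 = 1 \<and> (\<forall>x\<in>X. \<forall>k. leads x k \<longrightarrow> (\<forall>q\<le>N. tconv t x (k + q) \<ge> 0))"
proof (induction N)
  case 0
  have "tconv (\<lambda>j. if j = 0 then 1 else 0) x k = x k" for x k
    by (simp add: tconv_def if_distrib[of "\<lambda>y. y * _"] cong: if_cong)
  then show ?case
    by (intro exI[of _ "\<lambda>j. if j = 0 then 1 else 0"]) (simp add: leads_def)
next
  case (Suc N)
  then obtain t where t: "t 0 = 1" "\<And>x k q. x \<in> X \<Longrightarrow> leads x k \<Longrightarrow> q \<le> N \<Longrightarrow> tconv t x (k + q) \<ge> 0"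
    by blast
  have split: "tconv s x (k + q) = s q * x k + (\<Sum>j<q. s j * x (k + q - j))" if "leads x k" for s x k q
  proof -
    have "tconv s x (k + q) = (\<Sum>j\<le>q. s j * x (k + q - j))"
      unfolding tconv_def
    proof (rule sum.mono_neutral_right)
      show "\<forall>j\<in>{..k + q} - {..q}. s j * x (k + q - j) = 0"
      proof
        fix j assume "j \<in> {..k + q} - {..q}"
        then have "k + q - j < k" by auto
        then show "s j * x (k + q - j) = 0" using that by (simp add: leads_def)
      qed
    qed auto
    then show ?thesis by (simp add: lessThan_Suc_atMost[symmetric])
  qed
  let ?rest = "\<lambda>x k. \<Sum>j<Suc N. t j * x (k + Suc N - j)"
  \<comment> \<open>If \<open>x\<close> has no leading index, \<open>need x\<close> is an
    unspecified real, which merely joins the finite set bounded by \<open>T\<close>.\<close>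
  define need where "need x = - ?rest x (THE k. leads x k) / x (THE k. leads x k)" for x
  have the: "(THE k. leads x k) = k" if "leads x k" for x k
    by (rule the_equality[where P = "leads x", OF that leads_unique[OF _ that]])
  obtain T where T: "\<And>x. x \<in> X \<Longrightarrow> need x \<le> T"
    using bdd_above_finite[of "need ` X"] assms by (auto simp: bdd_above_def)
  let ?t = "t(Suc N := T)"
  have "tconv ?t x (k + q) \<ge> 0" if x: "x \<in> X" "leads x k" and q: "q \<le> Suc N" for x k q
  proof (cases "q = Suc N")
    case True
    have "- ?rest x k / x k \<le> T" using T[OF x(1)] by (simp add: need_def the[OF x(2)])
    then have "- ?rest x k \<le> T * x k"
      using x(2) unfolding leads_def by (subst (asm) pos_divide_le_eq) blast+
    then have "T * x k + ?rest x k \<ge> 0" by linarith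
    moreover have "tconv ?t x (k + q) = T * x k + ?rest x k"
      unfolding split[OF x(2)] True by (intro arg_cong2[where f = "(+)"] sum.cong) auto
    ultimately show ?thesis by simp
  next
    case False
    have "tconv ?t x (k + q) = tconv t x (k + q)"
      unfolding split[OF x(2)] using False q by (intro arg_cong2[where f = "(+)"] sum.cong) auto
    then show ?thesis using t(2)[OF x, of q] q False by simp
  qed
  then show ?case using t(1) by (intro exI[of _ ?t]) (simp del: fun_upd_apply add: fun_upd_other)
qed

text \<open>For polynomials of degree at most six, this expresses nonnegativity for small positive
  arguments through the coefficients.\<close>

definition lex_nonneg :: "(nat \<Rightarrow> real) \<Rightarrow> bool" where
  "lex_nonneg x \<longleftrightarrow> (\<forall>p\<le>6. x p = 0) \<or> (\<exists>k\<le>6. leads x k)"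

lemma lex_nonnegI: "x 0 > 0 \<Longrightarrow> lex_nonneg x"
  unfolding lex_nonneg_def leads_def by blast

lemma rapid_multiplier_nonneg:
  assumes "finite X" "\<forall>x\<in>X. lex_nonneg x"
  shows "\<exists>t. t 0 = 1 \<and> (\<forall>x\<in>X. \<forall>p\<le>6. tconv t x p \<ge> 0)"
proof -
  obtain t where t: "t 0 = 1" "\<forall>x\<in>X. \<forall>k. leads x k \<longrightarrow> (\<forall>q\<le>6. tconv t x (k + q) \<ge> 0)"
    using rapid_multiplier[OF assms(1)] by blast
  have "tconv t x p \<ge> 0" if x: "x \<in> X" and p: "p \<le> 6" for x p
  proof (cases "\<exists>k\<le>p. leads x k")
    case True
    then obtain k where "k \<le> p" "leads x k" by blast
    moreover have "p - k \<le> 6" using p by simp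
    ultimately have "tconv t x (k + (p - k)) \<ge> 0" using t(2) x by blast
    then show ?thesis using \<open>k \<le> p\<close> by simp
  next
    case False
    then have "x q = 0" if "q \<le> p" for q
    proof (cases "\<forall>p\<le>6. x p = 0")
      case True
      then show ?thesis using p that by simp
    next
      case nz: False
      then obtain k where k: "leads x k" using assms(2) x unfolding lex_nonneg_def by blast
      then have "p < k" using False by (meson not_le)
      then show ?thesis using k that by (simp add: leads_def)
    qed
    then show ?thesis by (simp add: tconv_def)
  qed
  then show ?thesis using t(1) by blast
qed

text \<open>Dividing by \<open>h ^ k\<close>, with \<open>k\<close> the first nonzero index, and
  letting \<open>h\<close> tend to zero leaves the coefficient \<open>x k\<close>.\<close>

lemma leading_term_nonneg:
  fixes x :: "nat \<Rightarrow> real"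
  assumes "\<forall>\<^sub>F h in at_right 0. (\<Sum>p=0..6. x p * h ^ p) \<ge> 0"
  shows "lex_nonneg x"
proof (cases "\<forall>p\<le>6. x p = 0")
  case False
  then obtain p where p: "p \<le> 6" "x p \<noteq> 0" by blast
  define k where "k = (LEAST p. x p \<noteq> 0)"
  have k: "x k \<noteq> 0" "\<And>p. p < k \<Longrightarrow> x p = 0" "k \<le> 6"
  proof -
    show "x k \<noteq> 0" unfolding k_def by (rule LeastI[of "\<lambda>p. x p \<noteq> 0", OF p(2)])
    show "x p = 0" if "p < k" for p using not_less_Least that unfolding k_def by blast
    show "k \<le> 6" using Least_le[of "\<lambda>p. x p \<noteq> 0", OF p(2)] p(1) unfolding k_def by linarith
  qed
  let ?g = "\<lambda>h. \<Sum>p=k..6. x p * h ^ (p - k)"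
  have g: "(\<Sum>p=0..6. x p * h ^ p) = h ^ k * ?g h" for h
  proof -
    have "(\<Sum>p=0..6. x p * h ^ p) = (\<Sum>p=k..6. x p * h ^ p)"
      by (rule sum.mono_neutral_right) (use k in auto)
    also have "\<dots> = h ^ k * ?g h"
      unfolding sum_distrib_left by (intro sum.cong) (auto simp: power_add[symmetric])
    finally show ?thesis .
  qed
  have "(?g \<longlongrightarrow> (\<Sum>p=k..6. x p * 0 ^ (p - k))) (at_right 0)"
    by (intro tendsto_intros)
  also have "(\<Sum>p=k..6. x p * 0 ^ (p - k)) = x k"
    using k(3) by (subst sum.remove[of _ k]) (auto intro!: sum.neutral)
  finally have "(?g \<longlongrightarrow> x k) (at_right 0)" .
  moreover have "\<forall>\<^sub>F h in at_right 0. 0 \<le> ?g h"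
    using assms eventually_at_right_less[of 0]
  proof eventually_elim
    case (elim h)
    then show ?case using mult_le_cancel_left_pos[of "h ^ k" 0 "?g h"] unfolding g by simp
  qed
  ultimately have "0 \<le> x k"
    by (rule tendsto_lowerbound) simp
  then have "leads x k" using k(1,2) by (simp add: leads_def)
  then show ?thesis using k(3) by (auto simp: lex_nonneg_def)
qed (simp add: lex_nonneg_def)

section \<open>Sign and sum conditions\<close>

definition csum :: "(nat \<Rightarrow> nat \<Rightarrow> nat \<Rightarrow> real) \<Rightarrow> (nat \<Rightarrow> nat \<Rightarrow> nat \<Rightarrow> real) \<Rightarrow> nat \<Rightarrow> real" where
  "csum ch ct p = (\<Sum>k=0..1. \<Sum>l=0..1. ch k l p + ct k l p)"

lemma Ckl_eq: "Ckl ch ct k l h = (\<Sum>p=0..6. (ch k l p + ct k l p) * h ^ p)"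
  by (simp only: Ckl_def Cpol_def distrib_right sum.distrib)

lemma sum_Ckl: "(\<Sum>k=0..1. \<Sum>l=0..1. Ckl ch ct k l h) = (\<Sum>p=0..6. csum ch ct p * h ^ p)"
  unfolding Ckl_eq csum_def by (simp add: distrib_right sum.distrib)

text \<open>Nontriviality says that the stencil parameter \<open>s\<close> is nonzero, so the
  leading term of the corner polynomial has order 0 and inherits the sign of the polynomial for
  small \<open>h\<close>.\<close>

lemma leading_coeff_pos:
  assumes sys: "corner_system A B al be ch ct" and nt: "nontrivial ch ct"
    and pos: "\<forall>\<^sub>F h in at_right 0. Ckl ch ct 0 0 h > 0"
  shows "ch 0 0 0 + ct 0 0 0 > 0"
proof -
  obtain s where s: "ch 0 0 0 + ct 0 0 0 = 5 * s" "ch 1 0 0 + ct 1 0 0 = - 2 * s"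
    "ch 0 1 0 + ct 0 1 0 = - 2 * s" "ch 1 1 0 + ct 1 1 0 = - s"
    by (rule corner_system_leading[OF sys])
  have "lex_nonneg (\<lambda>p. ch 0 0 p + ct 0 0 p)"
    using pos unfolding Ckl_eq by (intro leading_term_nonneg) (rule eventually_mono, assumption, rule less_imp_le)
  moreover have "s \<noteq> 0" using nt s by (auto simp: nontrivial_def)
  moreover have "k = 0" if "leads (\<lambda>p. ch 0 0 p + ct 0 0 p) k" for k
    using that \<open>s \<noteq> 0\<close> s(1) unfolding leads_def by (cases k) auto
  moreover have "\<not> (\<forall>p\<le>6. ch 0 0 p + ct 0 0 p = 0)" using \<open>s \<noteq> 0\<close> s(1) by force
  ultimately have "leads (\<lambda>p. ch 0 0 p + ct 0 0 p) 0" unfolding lex_nonneg_def by metis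
  then show ?thesis by (simp add: leads_def)
qed

text \<open>Solutions may be multiplied by -1; positivity at the corner node fixes
  \<open>s > 0\<close>, and then the sum at order 1 carries the sign of \<alpha> + \<beta> at the
  corner.\<close>

lemma necessary_sign:
  assumes sys: "corner_system A B al be ch ct" and nt: "nontrivial ch ct"
    and pos: "\<forall>\<^sub>F h in at_right 0. Ckl ch ct 0 0 h > 0"
    and sums: "\<forall>p\<le>6. (\<Sum>k=0..1. \<Sum>l=0..1. ch k l p + ct k l p) \<ge> 0"
  shows "al 0 + be 0 \<ge> 0"
proof -
  obtain s where s: "ch 0 0 0 + ct 0 0 0 = 5 * s"
    "(\<Sum>k=0..1. \<Sum>l=0..1. ch k l 1 + ct k l 1) = 3 * s * (al 0 + be 0)"
    by (rule corner_system_leading[OF sys])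
  have "s > 0" using leading_coeff_pos[OF sys nt pos] s(1) by simp
  moreover have "3 * s * (al 0 + be 0) \<ge> 0" unfolding s(2)[symmetric] using sums by simp
  ultimately show ?thesis by (simp add: zero_le_mult_iff)
qed

text \<open>One multiplier treats all stencil polynomials together: after sign reversal off the
  corner, the leading coefficients \<open>5 s\<close>, \<open>2 s\<close>, \<open>2 s\<close>,
  \<open>s\<close> are positive. Coefficients of one sign give the inequality for every
  \<open>h > 0\<close>, not merely for small \<open>h\<close>.\<close>

lemma good_scheme:
  assumes sys: "corner_system A B al be ch ct" and pos: "ch 0 0 0 + ct 0 0 0 > 0"
  shows "\<exists>ch' ct'. corner_system A B al be ch' ct' \<and> nontrivial ch' ct'
    \<and> (\<forall>h>0. sign_condition ch' ct' h)
    \<and> (lex_nonneg (csum ch ct) \<longrightarrow> (\<forall>h>0. sum_condition ch' ct' h))"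
proof -
  define c where "c k l p = ch k l p + ct k l p" for k l p
  obtain s where s: "c 0 0 0 = 5 * s" "c 1 0 0 = - 2 * s" "c 0 1 0 = - 2 * s" "c 1 1 0 = - s"
    unfolding c_def by (rule corner_system_leading[OF sys])
  have "s > 0" using pos s(1) by (simp add: c_def)
  \<comment> \<open>The coefficient sum joins the set only if it is lexicographically nonnegative;
    the comprehension covers both cases at once.\<close>
  define X where "X = {c 0 0, \<lambda>p. - c 1 0 p, \<lambda>p. - c 0 1 p, \<lambda>p. - c 1 1 p}
     \<union> {x. x = csum ch ct \<and> lex_nonneg x}"
  have fin: "finite X" unfolding X_def by (rule finite_UnI) (auto intro: finite_subset[of _ "{csum ch ct}"])
  have lex: "\<forall>x\<in>X. lex_nonneg x"
    unfolding X_def using s \<open>s > 0\<close> by (auto intro!: lex_nonnegI)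
  obtain t where t0: "t 0 = 1" and t: "\<And>x p. x \<in> X \<Longrightarrow> p \<le> 6 \<Longrightarrow> tconv t x p \<ge> 0"
    using rapid_multiplier_nonneg[OF fin lex] by blast
  let ?ch = "\<lambda>k l. tconv t (ch k l)" and ?ct = "\<lambda>k l. tconv t (ct k l)"
  have c: "?ch k l p + ?ct k l p = tconv t (c k l) p" for k l p
    unfolding c_def tconv_add ..
  have "csum ?ch ?ct p = tconv t (csum ch ct) p" for p
    unfolding csum_def tconv_def by (simp add: sum.distrib distrib_left)
  then have sum: "\<forall>h>0. sum_condition ?ch ?ct h" if "lex_nonneg (csum ch ct)"
    unfolding sum_condition_def sum_Ckl
    using that t[of "csum ch ct"] by (intro allI impI sum_nonneg) (simp add: X_def)
  have c0: "tconv t (c 0 0) 0 > 0" using t0 pos by (simp add: tconv_def c_def)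
  have nt: "nontrivial ?ch ?ct" unfolding nontrivial_def c using c0 by force
  have "sign_condition ?ch ?ct h" if "h > 0" for h
    unfolding sign_condition_def Ckl_eq c
  proof (intro conjI ballI impI)
    show "(\<Sum>p=0..6. tconv t (c 0 0) p * h ^ p) > 0"
      by (rule sum_pos2[of _ 0]) (use c0 t[of "c 0 0"] that in \<open>auto simp: X_def\<close>)
    fix k l :: nat assume "k \<in> {0, 1}" "l \<in> {0, 1}" "(k, l) \<noteq> (0, 0)"
    then have "(\<lambda>p. - c k l p) \<in> X" unfolding X_def by auto
    then have "tconv t (c k l) p \<le> 0" if "p \<le> 6" for p
      using t[OF _ that, of "\<lambda>p. - c k l p"] unfolding tconv_minus by linarith
    then show "(\<Sum>p=0..6. tconv t (c k l) p * h ^ p) \<le> 0"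
      using that by (intro sum_nonpos mult_nonpos_nonneg) auto
  qed
  then show ?thesis using corner_system_tconv[OF sys] nt sum by blast
qed

text \<open>If \<alpha> + \<beta> is positive at the corner, the sum has coefficient 0 at order 0
  and a positive one at order 1. Alternatively, a solution attaining the condition for small
  \<open>h\<close> supplies a lexicographically nonnegative sum, and a multiplier extends this to
  all \<open>h > 0\<close>. Otherwise only the signs are asserted.\<close>

lemma good_scheme_exists:
  "\<exists>ch ct. corner_system A B al be ch ct \<and> nontrivial ch ct
      \<and> (\<forall>h>0. sign_condition ch ct h)
      \<and> (al 0 + be 0 > 0
          \<or> (\<exists>ch' ct'. corner_system A B al be ch' ct' \<and> nontrivial ch' ct'
                \<and> (\<forall>\<^sub>F h in at_right 0. Ckl ch' ct' 0 0 h > 0 \<and> sum_condition ch' ct' h))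
          \<longrightarrow> (\<forall>h>0. sum_condition ch ct h))"
proof -
  let ?attain = "al 0 + be 0 > 0
          \<or> (\<exists>ch' ct'. corner_system A B al be ch' ct' \<and> nontrivial ch' ct'
                \<and> (\<forall>\<^sub>F h in at_right 0. Ckl ch' ct' 0 0 h > 0 \<and> sum_condition ch' ct' h))"
  obtain ch0 ct0 where 0: "corner_system A B al be ch0 ct0" "ch0 0 0 0 + ct0 0 0 0 = 5"
    using corner_system_solvable by blast
  have "\<exists>ch ct. corner_system A B al be ch ct \<and> ch 0 0 0 + ct 0 0 0 > 0
    \<and> (?attain \<longrightarrow> lex_nonneg (csum ch ct))"
  proof (cases ?attain)
    case True
    then show ?thesis
    proof
      assume ab: "al 0 + be 0 > 0"
      obtain s where s: "ch0 0 0 0 + ct0 0 0 0 = 5 * s" "ch0 1 0 0 + ct0 1 0 0 = - 2 * s"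
        "ch0 0 1 0 + ct0 0 1 0 = - 2 * s" "ch0 1 1 0 + ct0 1 1 0 = - s"
        "(\<Sum>k=0..1. \<Sum>l=0..1. ch0 k l 1 + ct0 k l 1) = 3 * s * (al 0 + be 0)"
        by (rule corner_system_leading[OF 0(1)])
      have "csum ch0 ct0 0 = 0" using s(1-4) by (simp add: csum_def)
      moreover have "csum ch0 ct0 1 > 0" unfolding csum_def s(5) using s(1) 0(2) ab by simp
      ultimately have "lex_nonneg (csum ch0 ct0)"
        unfolding lex_nonneg_def leads_def by (intro disjI2 exI[of _ 1]) auto
      then show ?thesis using 0 by (intro exI[of _ ch0] exI[of _ ct0]) simp
    next
      assume "\<exists>ch' ct'. corner_system A B al be ch' ct' \<and> nontrivial ch' ct'
                \<and> (\<forall>\<^sub>F h in at_right 0. Ckl ch' ct' 0 0 h > 0 \<and> sum_condition ch' ct' h)"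
      then obtain ch ct where c: "corner_system A B al be ch ct" "nontrivial ch ct"
        "\<forall>\<^sub>F h in at_right 0. Ckl ch ct 0 0 h > 0" "\<forall>\<^sub>F h in at_right 0. sum_condition ch ct h"
        unfolding eventually_conj_iff by blast
      have "lex_nonneg (csum ch ct)"
        by (rule leading_term_nonneg) (use c(4) in \<open>simp only: sum_condition_def sum_Ckl\<close>)
      then show ?thesis using c(1) leading_coeff_pos[OF c(1-3)] by blast
    qed
  next
    case False
    show ?thesis
    proof (rule exI[of _ ch0], rule exI[of _ ct0], intro conjI impI)
      assume ?attain
      then show "lex_nonneg (csum ch0 ct0)" using False by contradiction
    qed (use 0 in simp_all)
  qed
  then obtain ch ct where c: "corner_system A B al be ch ct" "ch 0 0 0 + ct 0 0 0 > 0"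
    "?attain \<longrightarrow> lex_nonneg (csum ch ct)" by blast
  obtain ch' ct' where c': "corner_system A B al be ch' ct'" "nontrivial ch' ct'"
    "\<forall>h>0. sign_condition ch' ct' h"
    "lex_nonneg (csum ch ct) \<longrightarrow> (\<forall>h>0. sum_condition ch' ct' h)"
    using good_scheme[OF c(1,2)] by blast
  show ?thesis
    by (rule exI[of _ ch'], rule exI[of _ ct'], intro conjI impI c'(1-3) c'(4)[THEN mp] c(3)[THEN mp])
qed

section \<open>Calculus of uniformly smooth functions\<close>

text \<open>On a bounded set both factors are bounded, which makes the product uniformly
  continuous.\<close>

lemma uniformly_continuous_on_mult_bounded:
  fixes f g :: "'a::heine_borel \<Rightarrow> real"
  assumes f: "uniformly_continuous_on S f" and g: "uniformly_continuous_on S g" and S: "bounded S"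
  shows "uniformly_continuous_on S (\<lambda>x. f x * g x)"
proof -
  obtain M where M: "\<And>x. x \<in> S \<Longrightarrow> \<bar>f x\<bar> \<le> M"
    using bounded_uniformly_continuous_image[OF f S] unfolding bounded_iff real_norm_def by blast
  obtain N where N: "\<And>x. x \<in> S \<Longrightarrow> \<bar>g x\<bar> \<le> N"
    using bounded_uniformly_continuous_image[OF g S] unfolding bounded_iff real_norm_def by blast
  show ?thesis
    unfolding uniformly_continuous_on_sequentially
  proof (intro allI impI, elim conjE)
    fix x y assume x: "\<forall>n. x n \<in> S" and y: "\<forall>n. y n \<in> S" and lim: "(\<lambda>n. dist (x n) (y n)) \<longlonglongrightarrow> 0"
    have "(\<lambda>n. dist (f (x n)) (f (y n))) \<longlonglongrightarrow> 0" "(\<lambda>n. dist (g (x n)) (g (y n))) \<longlonglongrightarrow> 0"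
      using f g x y lim unfolding uniformly_continuous_on_sequentially by blast+
    then have "(\<lambda>n. M * dist (g (x n)) (g (y n)) + N * dist (f (x n)) (f (y n))) \<longlonglongrightarrow> M * 0 + N * 0"
      by (intro tendsto_intros)
    then have lim0: "(\<lambda>n. M * dist (g (x n)) (g (y n)) + N * dist (f (x n)) (f (y n))) \<longlonglongrightarrow> 0"
      by simp
    have bound: "norm (dist (f (x n) * g (x n)) (f (y n) * g (y n)))
        \<le> M * dist (g (x n)) (g (y n)) + N * dist (f (x n)) (f (y n))" for n
    proof -
      have "f (x n) * g (x n) - f (y n) * g (y n) = f (x n) * (g (x n) - g (y n)) + g (y n) * (f (x n) - f (y n))"
        by (simp add: algebra_simps)
      then have "\<bar>f (x n) * g (x n) - f (y n) * g (y n)\<bar>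
          \<le> \<bar>f (x n)\<bar> * \<bar>g (x n) - g (y n)\<bar> + \<bar>g (y n)\<bar> * \<bar>f (x n) - f (y n)\<bar>"
        unfolding abs_mult[symmetric] by linarith
      also have "\<dots> \<le> M * \<bar>g (x n) - g (y n)\<bar> + N * \<bar>f (x n) - f (y n)\<bar>"
        by (intro add_mono mult_right_mono M N x[rule_format] y[rule_format] abs_ge_zero)
      finally show ?thesis by (simp add: dist_real_def)
    qed
    show "(\<lambda>n. dist (f (x n) * g (x n)) (f (y n) * g (y n))) \<longlonglongrightarrow> 0"
      by (rule Lim_null_comparison[OF always_eventually[OF allI[OF bound]] lim0])
  qed
qed

lemma uniformly_continuous_on_recip:
  fixes f :: "'a::metric_space \<Rightarrow> real"
  assumes f: "uniformly_continuous_on S f" and c: "c > 0" "\<And>x. x \<in> S \<Longrightarrow> c \<le> f x"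
  shows "uniformly_continuous_on S (\<lambda>x. 1 / f x)"
  unfolding uniformly_continuous_on_def
proof (intro allI impI)
  fix e :: real assume "e > 0"
  \<comment> \<open>The factor \<open>c\<^sup>2\<close> pays for the denominator
    \<open>f y * f x\<close>.\<close>
  then obtain d where d: "d > 0" "\<And>x y. x \<in> S \<Longrightarrow> y \<in> S \<Longrightarrow> dist y x < d \<Longrightarrow> dist (f y) (f x) < e * c\<^sup>2"
    using f c(1) unfolding uniformly_continuous_on_def by (metis mult_pos_pos zero_less_power)
  have "dist (1 / f y) (1 / f x) < e" if xy: "x \<in> S" "y \<in> S" "dist y x < d" for x y
  proof -
    have p: "f x > 0" "f y > 0" using c(1) c(2)[OF xy(1)] c(2)[OF xy(2)] by linarith+
    have "c\<^sup>2 \<le> f y * f x"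
      unfolding power2_eq_square using c(1) c(2)[OF xy(1)] c(2)[OF xy(2)] by (intro mult_mono) linarith+
    have "dist (1 / f y) (1 / f x) = dist (f y) (f x) / (f y * f x)"
      using p by (simp add: dist_real_def diff_frac_eq abs_mult abs_minus_commute)
    also have "\<dots> < e"
      using d(2)[OF xy] p \<open>c\<^sup>2 \<le> f y * f x\<close> \<open>e > 0\<close>
      by (simp add: divide_less_eq) (meson less_le_trans mult_left_mono less_imp_le)
    finally show ?thesis .
  qed
  then show "\<exists>d>0. \<forall>x\<in>S. \<forall>x'\<in>S. dist x' x < d \<longrightarrow> dist (1 / f x') (1 / f x) < e"
    using d(1) by blast
qed

lemma uniformly_continuous_on_restrict:
  fixes f :: "'a::metric_space \<Rightarrow> 'b::metric_space"
  shows "uniformly_continuous_on S f \<Longrightarrow> T \<subseteq> S \<Longrightarrow> uniformly_continuous_on T f"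
  unfolding uniformly_continuous_on_def
proof (intro allI impI)
  fix e :: real assume "e > 0" and T: "T \<subseteq> S"
    and S: "\<forall>e>0. \<exists>d>0. \<forall>x\<in>S. \<forall>x'\<in>S. dist x' x < d \<longrightarrow> dist (f x') (f x) < e"
  then obtain d where "d > 0" "\<forall>x\<in>S. \<forall>x'\<in>S. dist x' x < d \<longrightarrow> dist (f x') (f x) < e" by blast
  then show "\<exists>d>0. \<forall>x\<in>T. \<forall>x'\<in>T. dist x' x < d \<longrightarrow> dist (f x') (f x) < e"
    using T by (intro exI[of _ d]) (simp add: subset_iff)
qed

lemma uniformly_continuous_on_eqI:
  fixes f :: "'a::metric_space \<Rightarrow> 'b::metric_space"
  shows "uniformly_continuous_on S f \<Longrightarrow> (\<And>x. x \<in> S \<Longrightarrow> f x = g x) \<Longrightarrow> uniformly_continuous_on S g"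
  unfolding uniformly_continuous_on_def by simp

section \<open>Closure properties of functions with uniformly continuous derivatives\<close>

lemma pdx_has_deriv:
  assumes "uCk (Suc k) S F" "(x, y) \<in> S"
  shows "((\<lambda>s. F (s, y)) has_real_derivative pdx F (x, y)) (at x)"
  using assms by (auto simp: pdx_def DERIV_deriv_iff_real_differentiable)

lemma pdy_has_deriv:
  assumes "uCk (Suc k) S F" "(x, y) \<in> S"
  shows "((\<lambda>t. F (x, t)) has_real_derivative pdy F (x, y)) (at y)"
  using assms by (auto simp: pdy_def DERIV_deriv_iff_real_differentiable)

lemma uCk_uniformly_continuous: "uCk k S F \<Longrightarrow> uniformly_continuous_on S F"
  by (cases k) auto

lemma uCk_pdx: "uCk (Suc k) S F \<Longrightarrow> uCk k S (pdx F)" by simp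
lemma uCk_pdy: "uCk (Suc k) S F \<Longrightarrow> uCk k S (pdy F)" by simp

lemma uCk_Suc_mono: "uCk (Suc k) S F \<Longrightarrow> uCk k S F"
proof (induction k arbitrary: F)
  case (Suc k)
  have "uCk k S (pdx F)" "uCk k S (pdy F)"
    using Suc.IH[OF uCk_pdx[OF Suc.prems]] Suc.IH[OF uCk_pdy[OF Suc.prems]] .
  moreover have "uniformly_continuous_on S F
     \<and> (\<forall>(x, y)\<in>S. (\<lambda>s. F (s, y)) differentiable (at x) \<and> (\<lambda>t. F (x, t)) differentiable (at y))"
    using Suc.prems unfolding uCk.simps(2)[of "Suc k"] by (elim conjE) (intro conjI)
  ultimately show ?case unfolding uCk.simps(2)[of k] by (elim conjE) (intro conjI)
qed simp

lemma uCk_mono: "uCk k S F \<Longrightarrow> j \<le> k \<Longrightarrow> uCk j S F"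
proof (induction k)
  case (Suc k)
  show ?case
  proof (cases "j = Suc k")
    case False
    then show ?thesis using Suc.IH[OF uCk_Suc_mono[OF Suc.prems(1)]] Suc.prems(2) by linarith
  qed (use Suc.prems(1) in blast)
qed simp

lemma eventually_slice:
  fixes S :: "(real \<times> real) set"
  assumes "open S" "(x, y) \<in> S"
  shows "\<forall>\<^sub>F s in nhds x. (s, y) \<in> S" and "\<forall>\<^sub>F t in nhds y. (x, t) \<in> S"
proof -
  have "((\<lambda>s. (s, y)) \<longlongrightarrow> (x, y)) (nhds x)" "((\<lambda>t. (x, t)) \<longlongrightarrow> (x, y)) (nhds y)"
    by (intro tendsto_Pair tendsto_const filterlim_ident)+
  from this[THEN topological_tendstoD, OF assms(1) assms(2)]
  show "\<forall>\<^sub>F s in nhds x. (s, y) \<in> S" "\<forall>\<^sub>F t in nhds y. (x, t) \<in> S" .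
qed

lemma pd_step_cong:
  assumes "open S" "\<And>P. P \<in> S \<Longrightarrow> F P = G P" "P \<in> S"
  shows "pdx F P = pdx G P" "pdy F P = pdy G P"
proof -
  obtain x y where P: "P = (x, y)" by (cases P)
  note sl = eventually_slice[OF assms(1) assms(3)[unfolded P]]
  show "pdx F P = pdx G P"
    unfolding P pdx_def prod.case by (rule deriv_cong_ev[OF eventually_mono[OF sl(1) assms(2)] refl])
  show "pdy F P = pdy G P"
    unfolding P pdy_def prod.case by (rule deriv_cong_ev[OF eventually_mono[OF sl(2) assms(2)] refl])
qed

lemma differentiable_cong_ev:
  fixes f :: "real \<Rightarrow> real"
  assumes "f differentiable (at x)" "\<forall>\<^sub>F s in nhds x. f s = g s"
  shows "g differentiable (at x)"
  using assms(1) DERIV_cong_ev[OF refl assms(2) refl] unfolding real_differentiable_def by blast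

lemma uCk_Suc_intro:
  assumes "uniformly_continuous_on S F"
    and "\<And>x y. (x, y) \<in> S \<Longrightarrow> (\<lambda>s. F (s, y)) differentiable (at x)"
    and "\<And>x y. (x, y) \<in> S \<Longrightarrow> (\<lambda>t. F (x, t)) differentiable (at y)"
    and "uCk k S (pdx F)" "uCk k S (pdy F)"
  shows "uCk (Suc k) S F"
  unfolding uCk.simps(2) using assms by (intro conjI ballI) auto

lemma uCk_subset:
  assumes "uCk k S F" "T \<subseteq> S"
  shows "uCk k T F"
  using assms(1)
proof (induction k arbitrary: F)
  case 0
  then show ?case using uniformly_continuous_on_restrict[OF _ assms(2)] by simp
next
  case (Suc k)
  show ?case
  proof (rule uCk_Suc_intro)
    show "uniformly_continuous_on T F"
      by (rule uniformly_continuous_on_restrict[OF uCk_uniformly_continuous[OF Suc.prems] assms(2)])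
    show "uCk k T (pdx F)" by (rule Suc.IH[OF uCk_pdx[OF Suc.prems]])
    show "uCk k T (pdy F)" by (rule Suc.IH[OF uCk_pdy[OF Suc.prems]])
    fix x y assume "(x, y) \<in> T"
    then have "(x, y) \<in> S" using assms(2) by blast
    from pdx_has_deriv[OF Suc.prems this] pdy_has_deriv[OF Suc.prems this]
    show "(\<lambda>s. F (s, y)) differentiable (at x)" "(\<lambda>t. F (x, t)) differentiable (at y)"
      unfolding real_differentiable_def by blast+
  qed
qed

lemma uCk_cong:
  assumes "open S" "\<And>P. P \<in> S \<Longrightarrow> F P = G P" "uCk k S F"
  shows "uCk k S G"
  using assms(2,3)
proof (induction k arbitrary: F G)
  case 0
  then show ?case using uniformly_continuous_on_eqI[of S F G] by simp
next
  case (Suc k)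
  show ?case
  proof (rule uCk_Suc_intro)
    show "uniformly_continuous_on S G"
      using uniformly_continuous_on_eqI[OF uCk_uniformly_continuous[OF Suc.prems(2)] Suc.prems(1)] .
    show "uCk k S (pdx G)"
      by (rule Suc.IH[OF pd_step_cong(1)[OF assms(1) Suc.prems(1)] uCk_pdx[OF Suc.prems(2)]])
    show "uCk k S (pdy G)"
      by (rule Suc.IH[OF pd_step_cong(2)[OF assms(1) Suc.prems(1)] uCk_pdy[OF Suc.prems(2)]])
    fix x y assume P: "(x, y) \<in> S"
    have d: "(\<lambda>s. F (s, y)) differentiable (at x)" "(\<lambda>t. F (x, t)) differentiable (at y)"
      using Suc.prems(2) P by auto
    have "\<forall>\<^sub>F s in nhds x. F (s, y) = G (s, y)"
      using eventually_slice(1)[OF assms(1) P] by (rule eventually_mono) (rule Suc.prems(1))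
    then show "(\<lambda>s. G (s, y)) differentiable (at x)" by (rule differentiable_cong_ev[OF d(1)])
    have "\<forall>\<^sub>F t in nhds y. F (x, t) = G (x, t)"
      using eventually_slice(2)[OF assms(1) P] by (rule eventually_mono) (rule Suc.prems(1))
    then show "(\<lambda>t. G (x, t)) differentiable (at y)" by (rule differentiable_cong_ev[OF d(2)])
  qed
qed

text \<open>The candidates \<open>Fx\<close>, \<open>Fy\<close> match the derivatives on
  \<open>S\<close> only, while \<open>pdx F\<close> and \<open>pdy F\<close> are total functions;
  openness of \<open>S\<close> lets membership in \<open>uCk\<close> pass between them.\<close>

lemma uCk_SucI:
  assumes "open S" "uniformly_continuous_on S F"
    and dx: "\<And>x y. (x, y) \<in> S \<Longrightarrow> ((\<lambda>s. F (s, y)) has_real_derivative Fx (x, y)) (at x)"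
    and dy: "\<And>x y. (x, y) \<in> S \<Longrightarrow> ((\<lambda>t. F (x, t)) has_real_derivative Fy (x, y)) (at y)"
    and "uCk k S Fx" "uCk k S Fy"
  shows "uCk (Suc k) S F"
proof -
  have "Fx P = pdx F P" "Fy P = pdy F P" if "P \<in> S" for P
    using dx[of "fst P" "snd P"] dy[of "fst P" "snd P"] that
    by (simp_all add: pdx_def pdy_def case_prod_unfold DERIV_imp_deriv)
  note eq = this
  show ?thesis
  proof (rule uCk_Suc_intro[OF assms(2)])
    show "uCk k S (pdx F)" by (rule uCk_cong[OF assms(1) eq(1) assms(5)])
    show "uCk k S (pdy F)" by (rule uCk_cong[OF assms(1) eq(2) assms(6)])
    fix x y assume P: "(x, y) \<in> S"
    show "(\<lambda>s. F (s, y)) differentiable (at x)" "(\<lambda>t. F (x, t)) differentiable (at y)"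
      unfolding real_differentiable_def using dx[OF P] dy[OF P] by blast+
  qed
qed

lemma uCk_add:
  assumes "open S" "uCk k S F" "uCk k S G"
  shows "uCk k S (\<lambda>P. F P + G P)"
  using assms(2,3)
proof (induction k arbitrary: F G)
  case 0
  then show ?case by (simp add: uniformly_continuous_on_add)
next
  case (Suc k)
  show ?case
  proof (rule uCk_SucI[OF assms(1)])
    show "uniformly_continuous_on S (\<lambda>P. F P + G P)"
      by (intro uniformly_continuous_on_add uCk_uniformly_continuous[OF Suc.prems(1)]
          uCk_uniformly_continuous[OF Suc.prems(2)])
    show "uCk k S (\<lambda>P. pdx F P + pdx G P)" "uCk k S (\<lambda>P. pdy F P + pdy G P)"
      by (intro Suc.IH uCk_pdx[OF Suc.prems(1)] uCk_pdx[OF Suc.prems(2)]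
          uCk_pdy[OF Suc.prems(1)] uCk_pdy[OF Suc.prems(2)])+
    fix x y assume P: "(x, y) \<in> S"
    show "((\<lambda>s. F (s, y) + G (s, y)) has_real_derivative pdx F (x, y) + pdx G (x, y)) (at x)"
      by (rule DERIV_add[OF pdx_has_deriv[OF Suc.prems(1) P] pdx_has_deriv[OF Suc.prems(2) P]])
    show "((\<lambda>t. F (x, t) + G (x, t)) has_real_derivative pdy F (x, y) + pdy G (x, y)) (at y)"
      by (rule DERIV_add[OF pdy_has_deriv[OF Suc.prems(1) P] pdy_has_deriv[OF Suc.prems(2) P]])
  qed
qed

lemma uCk_mult:
  assumes "open S" "bounded S" "uCk k S F" "uCk k S G"
  shows "uCk k S (\<lambda>P. F P * G P)"
  using assms(3,4)
proof (induction k arbitrary: F G)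
  case 0
  then show ?case using assms(2) by (simp add: uniformly_continuous_on_mult_bounded)
next
  case (Suc k)
  note mono = Suc.prems[THEN uCk_Suc_mono]
  show ?case
  proof (rule uCk_SucI[OF assms(1)])
    show "uniformly_continuous_on S (\<lambda>P. F P * G P)"
      by (intro uniformly_continuous_on_mult_bounded assms(2) uCk_uniformly_continuous[OF Suc.prems(1)]
          uCk_uniformly_continuous[OF Suc.prems(2)])
    show "uCk k S (\<lambda>P. pdx F P * G P + pdx G P * F P)" "uCk k S (\<lambda>P. pdy F P * G P + pdy G P * F P)"
      by (intro uCk_add[OF assms(1)] Suc.IH mono uCk_pdx[OF Suc.prems(1)] uCk_pdx[OF Suc.prems(2)]
          uCk_pdy[OF Suc.prems(1)] uCk_pdy[OF Suc.prems(2)])+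
    fix x y assume P: "(x, y) \<in> S"
    show "((\<lambda>s. F (s, y) * G (s, y)) has_real_derivative
        pdx F (x, y) * G (x, y) + pdx G (x, y) * F (x, y)) (at x)"
      by (rule DERIV_mult[OF pdx_has_deriv[OF Suc.prems(1) P] pdx_has_deriv[OF Suc.prems(2) P]])
    show "((\<lambda>t. F (x, t) * G (x, t)) has_real_derivative
        pdy F (x, y) * G (x, y) + pdy G (x, y) * F (x, y)) (at y)"
      by (rule DERIV_mult[OF pdy_has_deriv[OF Suc.prems(1) P] pdy_has_deriv[OF Suc.prems(2) P]])
  qed
qed

lemma uCk_const: "uCk k S (\<lambda>_. c)"
proof (induction k arbitrary: c)
  case (Suc k)
  have "pdx (\<lambda>_. c) = (\<lambda>_. 0)" "pdy (\<lambda>_. c) = (\<lambda>_. 0)" by (auto simp: pdx_def pdy_def)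
  then show ?case by (intro uCk_Suc_intro) (simp_all add: uniformly_continuous_on_const Suc.IH)
qed (simp add: uniformly_continuous_on_const)

lemma uCk_uminus:
  assumes "open S" "bounded S" "uCk k S F"
  shows "uCk k S (\<lambda>P. - F P)"
  using uCk_mult[OF assms(1,2) uCk_const[of k S "- 1"] assms(3)] by simp

text \<open>The derivative is minus a product of the derivative of \<open>F\<close> with two
  reciprocals, taken one order lower, so the induction closes.\<close>

lemma uCk_recip:
  assumes "open S" "bounded S" "uCk k S F" "c > 0" "\<And>P. P \<in> S \<Longrightarrow> c \<le> F P"
  shows "uCk k S (\<lambda>P. 1 / F P)"
  using assms(3)
proof (induction k)
  case 0
  then show ?case using uniformly_continuous_on_recip[OF _ assms(4,5)] by simp
next
  case (Suc k)
  have nz: "F P \<noteq> 0" if "P \<in> S" for P using assms(4) assms(5)[OF that] by auto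
  have k: "uCk k S (\<lambda>P. 1 / F P)" using Suc uCk_Suc_mono by blast
  show ?case
  proof (rule uCk_SucI[OF assms(1)])
    show "uniformly_continuous_on S (\<lambda>P. 1 / F P)"
      using Suc.prems by (intro uniformly_continuous_on_recip[OF _ assms(4,5)] uCk_uniformly_continuous)
    fix x y assume P: "(x, y) \<in> S"
    show "((\<lambda>s. 1 / F (s, y)) has_real_derivative - (1 / F (x, y) * pdx F (x, y) * (1 / F (x, y)))) (at x)"
      unfolding inverse_eq_divide[symmetric] by (rule DERIV_inverse'[OF pdx_has_deriv[OF Suc.prems P] nz[OF P]])
    show "((\<lambda>t. 1 / F (x, t)) has_real_derivative - (1 / F (x, y) * pdy F (x, y) * (1 / F (x, y)))) (at y)"
      unfolding inverse_eq_divide[symmetric] by (rule DERIV_inverse'[OF pdy_has_deriv[OF Suc.prems P] nz[OF P]])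
  next
    show "uCk k S (\<lambda>P. - (1 / F P * pdx F P * (1 / F P)))" "uCk k S (\<lambda>P. - (1 / F P * pdy F P * (1 / F P)))"
      by (intro uCk_mult[OF assms(1,2)] uCk_uminus[OF assms(1,2)] k uCk_pdx[OF Suc.prems] uCk_pdy[OF Suc.prems])+
  qed
qed

section \<open>Iterated partial derivatives\<close>

lemma uCk_pdx_iter: "uCk (k + m) S F \<Longrightarrow> uCk k S ((pdx ^^ m) F)"
proof (induction m arbitrary: k)
  case (Suc m)
  then show ?case using uCk_pdx[OF Suc.IH[of "Suc k"]] by simp
qed simp

lemma uCk_pdy_iter: "uCk (k + n) S F \<Longrightarrow> uCk k S ((pdy ^^ n) F)"
proof (induction n arbitrary: k)
  case (Suc n)
  then show ?case using uCk_pdy[OF Suc.IH[of "Suc k"]] by simp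
qed simp

lemma uCk_pd: "uCk (k + (m + n)) S F \<Longrightarrow> uCk k S (pd m n F)"
  unfolding pd_def by (intro uCk_pdx_iter uCk_pdy_iter) (simp add: add.assoc)

lemma pdx_iter_cong:
  assumes "open S" "\<And>P. P \<in> S \<Longrightarrow> F P = G P" "P \<in> S"
  shows "(pdx ^^ m) F P = (pdx ^^ m) G P"
  using assms(3)
proof (induction m arbitrary: P)
  case (Suc m)
  show ?case unfolding funpow.simps o_apply by (rule pd_step_cong(1)[OF assms(1) Suc.IH Suc.prems])
qed (simp add: assms(2))

lemma pdy_iter_cong:
  assumes "open S" "\<And>P. P \<in> S \<Longrightarrow> F P = G P" "P \<in> S"
  shows "(pdy ^^ n) F P = (pdy ^^ n) G P"
  using assms(3)
proof (induction n arbitrary: P)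
  case (Suc n)
  show ?case unfolding funpow.simps o_apply by (rule pd_step_cong(2)[OF assms(1) Suc.IH Suc.prems])
qed (simp add: assms(2))

lemma pd_cong:
  assumes "open S" "\<And>P. P \<in> S \<Longrightarrow> F P = G P" "P \<in> S"
  shows "pd m n F P = pd m n G P"
  unfolding pd_def
  by (rule pdx_iter_cong[OF assms(1) _ assms(3)]) (rule pdy_iter_cong[OF assms(1,2)])

lemma pd_Suc_y: "pd m (Suc n) F = pd m n (pdy F)"
  by (simp add: pd_def funpow_swap1)

text \<open>In \<open>pd\<close> the y-derivatives act first, so an x-derivative is innermost only
  when \<open>n = 0\<close>. Inductions for sums and products of jets therefore run over
  \<open>n\<close> outside and over \<open>m\<close> at \<open>n = 0\<close>.\<close>

lemma pd_Suc_x_0: "pd (Suc m) 0 F = pd m 0 (pdx F)"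
  by (simp add: pd_def funpow_swap1)

section \<open>Jets at the corner\<close>

definition leib :: "(nat \<Rightarrow> nat \<Rightarrow> real) \<Rightarrow> (nat \<Rightarrow> nat \<Rightarrow> real) \<Rightarrow> nat \<Rightarrow> nat \<Rightarrow> real" where
  "leib f g m n = (\<Sum>i=0..m. \<Sum>j=0..n. real (m choose i) * real (n choose j) * (f (m - i) (n - j) * g i j))"

text \<open>Pascal's rule, splitting one further derivative between the two factors.\<close>

lemma binomial_leibniz_step:
  fixes w :: "nat \<Rightarrow> nat \<Rightarrow> real"
  shows "(\<Sum>j=0..Suc n. real (Suc n choose j) * w (Suc n - j) j)
    = (\<Sum>j=0..n. real (n choose j) * w (Suc (n - j)) j) + (\<Sum>j=0..n. real (n choose j) * w (n - j) (Suc j))"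
proof -
  have "(\<Sum>j=0..Suc n. real (Suc n choose j) * w (Suc n - j) j)
     = w (Suc n) 0 + (\<Sum>j=0..n. real (Suc n choose Suc j) * w (n - j) (Suc j))"
    by (subst sum.atLeast0_atMost_Suc_shift) simp
  also have "(\<Sum>j=0..n. real (Suc n choose Suc j) * w (n - j) (Suc j))
     = (\<Sum>j=0..n. real (n choose j) * w (n - j) (Suc j)) + (\<Sum>j=0..n. real (n choose Suc j) * w (n - j) (Suc j))"
    by (simp only: binomial_Suc_Suc of_nat_add distrib_right sum.distrib)
  finally have 1: "(\<Sum>j=0..Suc n. real (Suc n choose j) * w (Suc n - j) j) = w (Suc n) 0
     + ((\<Sum>j=0..n. real (n choose j) * w (n - j) (Suc j)) + (\<Sum>j=0..n. real (n choose Suc j) * w (n - j) (Suc j)))" .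
  have "w (Suc n) 0 + (\<Sum>j=0..n. real (n choose Suc j) * w (n - j) (Suc j))
     = (\<Sum>j=0..Suc n. real (n choose j) * w (Suc n - j) j)"
    by (subst sum.atLeast0_atMost_Suc_shift) simp
  also have "(\<Sum>j=0..Suc n. real (n choose j) * w (Suc n - j) j) = (\<Sum>j=0..n. real (n choose j) * w (Suc n - j) j)"
    by (subst sum.atLeast0_atMost_Suc) simp
  also have "\<dots> = (\<Sum>j=0..n. real (n choose j) * w (Suc (n - j)) j)"
    by (intro sum.cong refl) (simp add: Suc_diff_le)
  finally show ?thesis using 1 by linarith
qed

lemma leib_Suc_y:
  "leib f g m (Suc n) = leib (\<lambda>m n. f m (Suc n)) g m n + leib f (\<lambda>m n. g m (Suc n)) m n"
proof -
  have "leib f g m (Suc n) = (\<Sum>i=0..m. real (m choose i) *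
      (\<Sum>j=0..Suc n. real (Suc n choose j) * (f (m - i) (Suc n - j) * g i j)))"
    unfolding leib_def sum_distrib_left by (simp only: mult.assoc)
  also have "\<dots> = (\<Sum>i=0..m. real (m choose i) *
      ((\<Sum>j=0..n. real (n choose j) * (f (m - i) (Suc (n - j)) * g i j))
      + (\<Sum>j=0..n. real (n choose j) * (f (m - i) (n - j) * g i (Suc j)))))"
    by (subst binomial_leibniz_step) (rule refl)
  also have "\<dots> = leib (\<lambda>m n. f m (Suc n)) g m n + leib f (\<lambda>m n. g m (Suc n)) m n"
    unfolding leib_def distrib_left sum.distrib sum_distrib_left by (simp only: mult.assoc)
  finally show ?thesis .
qed

lemma leib_Suc_x_0:
  "leib f g (Suc m) 0 = leib (\<lambda>m n. f (Suc m) n) g m 0 + leib f (\<lambda>m n. g (Suc m) n) m 0"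
proof -
  have "leib f g m 0 = (\<Sum>i=0..m. real (m choose i) * (f (m - i) 0 * g i 0))" for f g m
    by (simp add: leib_def)
  then show ?thesis
    using binomial_leibniz_step[of m "\<lambda>i j. f i 0 * g j 0"] by simp
qed

text \<open>Lets a boundary identity that holds only in the limit be differentiated along the edge:
  the difference over a short tangential step tends to zero, the mean value theorem turns it into a
  value of \<open>g'\<close>, and equicontinuity moves that value to \<open>t\<close>.\<close>

lemma vanishing_limit_deriv:
  fixes g g' :: "real \<Rightarrow> real \<Rightarrow> real"
  assumes der: "\<And>s t. s \<in> {x0<..<x0+e} \<Longrightarrow> t \<in> {y0<..<y0+e} \<Longrightarrow> (g s has_real_derivative g' s t) (at t)"
    and equi: "\<And>\<epsilon>. \<epsilon> > 0 \<Longrightarrow> \<exists>\<delta>>0. \<forall>s\<in>{x0<..<x0+e}. \<forall>t\<in>{y0<..<y0+e}. \<forall>t'\<in>{y0<..<y0+e}.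
        \<bar>t' - t\<bar> < \<delta> \<longrightarrow> \<bar>g' s t' - g' s t\<bar> < \<epsilon>"
    and lim: "\<And>t. t \<in> {y0<..<y0+e} \<Longrightarrow> ((\<lambda>s. g s t) \<longlongrightarrow> 0) (at_right x0)"
    and e: "e > 0" and t: "t \<in> {y0<..<y0+e}"
  shows "((\<lambda>s. g' s t) \<longlongrightarrow> 0) (at_right x0)"
proof (rule tendstoI)
  fix \<epsilon> :: real assume "\<epsilon> > 0"
  then obtain \<delta> where d: "\<delta> > 0" "\<And>s t t'. s \<in> {x0<..<x0+e} \<Longrightarrow> t \<in> {y0<..<y0+e} \<Longrightarrow> t' \<in> {y0<..<y0+e} \<Longrightarrow>
        \<bar>t' - t\<bar> < \<delta> \<Longrightarrow> \<bar>g' s t' - g' s t\<bar> < \<epsilon> / 2"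
    using equi[OF half_gt_zero[OF \<open>\<epsilon> > 0\<close>]] by blast
  \<comment> \<open>Half of each distance, so that the step stays below \<open>\<delta>\<close> and
    inside the interval.\<close>
  define \<eta> where "\<eta> = min (\<delta> / 2) ((y0 + e - t) / 2)"
  have \<eta>: "\<eta> > 0" "\<eta> < \<delta>" "t + \<eta> \<in> {y0<..<y0+e}"
    using d(1) t by (auto simp: \<eta>_def min_def field_simps)
  have "((\<lambda>s. g s (t + \<eta>) - g s t) \<longlongrightarrow> 0 - 0) (at_right x0)"
    by (intro tendsto_diff lim \<eta>(3) t)
  then have "\<forall>\<^sub>F s in at_right x0. dist (g s (t + \<eta>) - g s t) (0 - 0) < \<eta> * \<epsilon> / 2"
    using \<eta>(1) \<open>\<epsilon> > 0\<close> by (intro tendstoD) simp_all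
  moreover have "\<forall>\<^sub>F s in at_right x0. s \<in> {x0<..<x0+e}"
    using e by (intro eventually_at_right_real) simp
  ultimately show "\<forall>\<^sub>F s in at_right x0. dist (g' s t) 0 < \<epsilon>"
  proof eventually_elim
    case (elim s)
    have "\<exists>z. t < z \<and> z < t + \<eta> \<and> g s (t + \<eta>) - g s t = (t + \<eta> - t) * g' s z"
    proof (rule MVT2)
      show "t < t + \<eta>" using \<eta>(1) by simp
      fix z assume "t \<le> z" "z \<le> t + \<eta>"
      then show "(g s has_real_derivative g' s z) (at z)"
        using \<eta>(3) t by (intro der elim(2)) simp
    qed
    then obtain z where z: "t < z" "z < t + \<eta>" "g s (t + \<eta>) - g s t = \<eta> * g' s z" by auto
    have "\<eta> * \<bar>g' s z\<bar> < \<eta> * (\<epsilon> / 2)"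
      using elim(1) \<eta>(1) unfolding z(3) by (simp add: abs_mult)
    then have "\<bar>g' s z\<bar> < \<epsilon> / 2" using \<eta>(1) by simp
    moreover have "\<bar>g' s t - g' s z\<bar> < \<epsilon> / 2"
      by (rule d(2)) (use elim(2) t z \<eta> in auto)
    ultimately show ?case unfolding dist_real_def by linarith
  qed
qed

section \<open>Jets of continuous extensions at the corner of a small square\<close>

locale corner_box =
  fixes x0 y0 e :: real
  assumes e_pos: "e > 0"
begin

definition Q :: "(real \<times> real) set" where "Q = {x0<..<x0+e} \<times> {y0<..<y0+e}"
text \<open>Adds to the open square its left and lower edges with the corner, where boundary values
  are taken.\<close>

definition Qc :: "(real \<times> real) set" where "Qc = {x0..<x0+e} \<times> {y0..<y0+e}"

definition jet :: "(real \<times> real \<Rightarrow> real) \<Rightarrow> nat \<Rightarrow> nat \<Rightarrow> real" where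
  "jet F m n = cext Q (pd m n F) (x0, y0)"

lemma open_Q: "open Q" unfolding Q_def by (intro open_Times) simp_all

lemma bounded_Q: "bounded Q"
proof -
  have "bounded {a<..<b :: real}" for a b
    by (rule bounded_subset[OF bounded_closed_interval[of a b]]) auto
  then show ?thesis unfolding Q_def by (intro bounded_Times)
qed

lemma mem_Q: "(x, y) \<in> Q \<longleftrightarrow> x0 < x \<and> x < x0 + e \<and> y0 < y \<and> y < y0 + e"
  by (auto simp: Q_def)

lemma mem_Qc: "(x, y) \<in> Qc \<longleftrightarrow> x0 \<le> x \<and> x < x0 + e \<and> y0 \<le> y \<and> y < y0 + e"
  by (auto simp: Qc_def)

lemma corner_in_Qc: "(x0, y0) \<in> Qc" using e_pos by (simp add: mem_Qc)

text \<open>Every point of \<open>Qc\<close> can be left along the diagonal into the open square.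
  This makes it a limit point and gives a path along which limits at the edges and the corner are
  computed.\<close>

lemma diagonal_approach:
  assumes "(x, y) \<in> Qc"
  shows "filterlim (\<lambda>d. (x + d, y + d)) (at (x, y) within Q) (at_right 0)"
  unfolding filterlim_at
proof
  have "((\<lambda>d. (x + d, y + d)) \<longlongrightarrow> (x + 0, y + 0)) (at_right 0)" by (intro tendsto_intros)
  then show "((\<lambda>d. (x + d, y + d)) \<longlongrightarrow> (x, y)) (at_right 0)" by simp
  have "\<forall>\<^sub>F d in at_right 0. d \<in> {0<..<min (x0 + e - x) (y0 + e - y)}"
    using assms by (intro eventually_at_right_real) (simp add: mem_Qc)
  then show "\<forall>\<^sub>F d in at_right 0. (x + d, y + d) \<in> Q \<and> (x + d, y + d) \<noteq> (x, y)"
  proof eventually_elim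
    case (elim d)
    then show ?case using assms by (simp add: mem_Q mem_Qc)
  qed
qed

lemma within_Q_nontrivial: "P \<in> Qc \<Longrightarrow> at P within Q \<noteq> bot"
proof
  assume "P \<in> Qc" "at P within Q = bot"
  then have "filtermap (\<lambda>d. (fst P + d, snd P + d)) (at_right 0) = bot"
    using diagonal_approach[of "fst P" "snd P"] by (simp add: filterlim_def le_bot)
  then show False by (simp add: filtermap_bot_iff trivial_limit_at_right_real)
qed

lemma cext_eqI: "P \<in> Qc \<Longrightarrow> (F \<longlongrightarrow> l) (at P within Q) \<Longrightarrow> cext Q F P = l"
  unfolding cext_def by (intro tendsto_Lim within_Q_nontrivial)

lemma cext_tendsto:
  assumes "uniformly_continuous_on Q F" "P \<in> Qc"
  shows "(F \<longlongrightarrow> cext Q F P) (at P within Q)"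
proof -
  have "P islimpt Q" using within_Q_nontrivial[OF assms(2)] trivial_limit_within by blast
  then have "P \<in> closure Q" by (simp add: closure_def)
  then obtain l where "(F \<longlongrightarrow> l) (at P within Q)"
    using uniformly_continuous_on_extension_at_closure[OF assms(1)] by blast
  then show ?thesis using cext_eqI[OF assms(2)] by simp
qed

lemma cext_cong:
  assumes "\<And>P. P \<in> Q \<Longrightarrow> F P = G P"
  shows "cext Q F P = cext Q G P"
proof -
  have "\<forall>\<^sub>F P in at P within Q. F P = G P" using assms by (simp add: eventually_at_filter)
  then have "(F \<longlongrightarrow> l) (at P within Q) \<longleftrightarrow> (G \<longlongrightarrow> l) (at P within Q)" for l by (rule tendsto_cong)
  \<comment> \<open>\<open>Lim\<close> is a description, so equality of the limit predicates
    suffices even where no limit exists.\<close>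
  then show ?thesis unfolding cext_def t2_space_class.Lim_def by simp
qed

lemma jet_cong: "(\<And>P. P \<in> Q \<Longrightarrow> F P = G P) \<Longrightarrow> jet F m n = jet G m n"
  unfolding jet_def by (intro cext_cong pd_cong[OF open_Q])

lemma jet_Suc_y: "jet F m (Suc n) = jet (pdy F) m n"
  unfolding jet_def pd_Suc_y ..

lemma jet_Suc_x_0: "jet F (Suc m) 0 = jet (pdx F) m 0"
  unfolding jet_def pd_Suc_x_0 ..

lemma jet_tendsto:
  assumes "uCk (m + n) Q F"
  shows "(pd m n F \<longlongrightarrow> jet F m n) (at (x0, y0) within Q)"
  unfolding jet_def
  by (intro cext_tendsto uCk_uniformly_continuous[of 0] uCk_pd corner_in_Qc) (simp only: add_0 assms)

lemma jet_00: "jet F 0 0 = cext Q F (x0, y0)"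
  by (simp add: jet_def pd_def)

lemma jet_0_tendsto: "uCk k Q F \<Longrightarrow> (F \<longlongrightarrow> jet F 0 0) (at (x0, y0) within Q)"
  unfolding jet_00 by (intro cext_tendsto corner_in_Qc uCk_uniformly_continuous)

lemma pd_step_add:
  assumes "uCk (Suc k) Q F" "uCk (Suc k) Q G" "P \<in> Q"
  shows "pdx (\<lambda>P. F P + G P) P = pdx F P + pdx G P" "pdy (\<lambda>P. F P + G P) P = pdy F P + pdy G P"
proof -
  obtain x y where P: "P = (x, y)" by (cases P)
  note m = assms(3)[unfolded P]
  show "pdx (\<lambda>P. F P + G P) P = pdx F P + pdx G P"
    using DERIV_imp_deriv[OF DERIV_add[OF pdx_has_deriv[OF assms(1) m] pdx_has_deriv[OF assms(2) m]]]
    unfolding P by (simp add: pdx_def)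
  show "pdy (\<lambda>P. F P + G P) P = pdy F P + pdy G P"
    using DERIV_imp_deriv[OF DERIV_add[OF pdy_has_deriv[OF assms(1) m] pdy_has_deriv[OF assms(2) m]]]
    unfolding P by (simp add: pdy_def)
qed

lemma pd_step_mult:
  assumes "uCk (Suc k) Q F" "uCk (Suc k) Q G" "P \<in> Q"
  shows "pdx (\<lambda>P. F P * G P) P = pdx F P * G P + F P * pdx G P"
    "pdy (\<lambda>P. F P * G P) P = pdy F P * G P + F P * pdy G P"
proof -
  obtain x y where P: "P = (x, y)" by (cases P)
  note m = assms(3)[unfolded P]
  show "pdx (\<lambda>P. F P * G P) P = pdx F P * G P + F P * pdx G P"
    using DERIV_imp_deriv[OF DERIV_mult[OF pdx_has_deriv[OF assms(1) m] pdx_has_deriv[OF assms(2) m]]]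
    unfolding P by (simp add: pdx_def mult.commute)
  show "pdy (\<lambda>P. F P * G P) P = pdy F P * G P + F P * pdy G P"
    using DERIV_imp_deriv[OF DERIV_mult[OF pdy_has_deriv[OF assms(1) m] pdy_has_deriv[OF assms(2) m]]]
    unfolding P by (simp add: pdy_def mult.commute)
qed

lemma jet_add:
  assumes "uCk (m + n) Q F" "uCk (m + n) Q G"
  shows "jet (\<lambda>P. F P + G P) m n = jet F m n + jet G m n"
  using assms
proof (induction n arbitrary: F G)
  case 0
  then show ?case
  proof (induction m arbitrary: F G)
    case 0
    have "((\<lambda>P. F P + G P) \<longlongrightarrow> jet F 0 0 + jet G 0 0) (at (x0, y0) within Q)"
      by (intro tendsto_add jet_0_tendsto[OF 0(1)] jet_0_tendsto[OF 0(2)])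
    then show ?case unfolding jet_00[of "\<lambda>P. F P + G P"] by (intro cext_eqI corner_in_Qc)
  next
    case (Suc m)
    note F = Suc.prems(1)[unfolded add_Suc] and G = Suc.prems(2)[unfolded add_Suc]
    have "jet (pdx (\<lambda>P. F P + G P)) m 0 = jet (\<lambda>P. pdx F P + pdx G P) m 0"
      by (intro jet_cong pd_step_add(1)[OF F G])
    then show ?case
      unfolding jet_Suc_x_0 using Suc.IH[OF uCk_pdx[OF F] uCk_pdx[OF G]] by simp
  qed
next
  case (Suc n)
  note F = Suc.prems(1)[unfolded add_Suc_right] and G = Suc.prems(2)[unfolded add_Suc_right]
  have "jet (pdy (\<lambda>P. F P + G P)) m n = jet (\<lambda>P. pdy F P + pdy G P) m n"
    by (intro jet_cong pd_step_add(2)[OF F G])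
  then show ?case
    unfolding jet_Suc_y using Suc.IH[OF uCk_pdy[OF F] uCk_pdy[OF G]] by simp
qed

text \<open>The product rule holds on the open square, and only the resulting identity passes to the
  limit at the corner.\<close>

lemma jet_mult:
  assumes "uCk (m + n) Q F" "uCk (m + n) Q G"
  shows "jet (\<lambda>P. F P * G P) m n = leib (jet F) (jet G) m n"
  using assms
proof (induction n arbitrary: F G)
  case 0
  then show ?case
  proof (induction m arbitrary: F G)
    case 0
    have "((\<lambda>P. F P * G P) \<longlongrightarrow> jet F 0 0 * jet G 0 0) (at (x0, y0) within Q)"
      by (intro tendsto_mult jet_0_tendsto[OF 0(1)] jet_0_tendsto[OF 0(2)])
    then have "jet (\<lambda>P. F P * G P) 0 0 = jet F 0 0 * jet G 0 0"
      unfolding jet_00[of "\<lambda>P. F P * G P"] by (intro cext_eqI corner_in_Qc)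
    then show ?case by (simp add: leib_def)
  next
    case (Suc m)
    note F = Suc.prems(1)[unfolded add_Suc] and G = Suc.prems(2)[unfolded add_Suc]
    note F' = uCk_Suc_mono[OF F] and G' = uCk_Suc_mono[OF G]
    have "jet (pdx (\<lambda>P. F P * G P)) m 0 = jet (\<lambda>P. pdx F P * G P + F P * pdx G P) m 0"
      by (intro jet_cong pd_step_mult(1)[OF F G])
    also have "\<dots> = jet (\<lambda>P. pdx F P * G P) m 0 + jet (\<lambda>P. F P * pdx G P) m 0"
      by (intro jet_add uCk_mult[OF open_Q bounded_Q] F' G' uCk_pdx[OF F] uCk_pdx[OF G])
    also have "\<dots> = leib (jet (pdx F)) (jet G) m 0 + leib (jet F) (jet (pdx G)) m 0"
      using Suc.IH[OF uCk_pdx[OF F] G'] Suc.IH[OF F' uCk_pdx[OF G]] by simp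
    also have "\<dots> = leib (jet F) (jet G) (Suc m) 0"
      unfolding leib_Suc_x_0 by (simp add: leib_def jet_Suc_x_0)
    finally show ?case unfolding jet_Suc_x_0[of "\<lambda>P. F P * G P"] .
  qed
next
  case (Suc n)
  note F = Suc.prems(1)[unfolded add_Suc_right] and G = Suc.prems(2)[unfolded add_Suc_right]
  note F' = uCk_Suc_mono[OF F] and G' = uCk_Suc_mono[OF G]
  have "jet (pdy (\<lambda>P. F P * G P)) m n = jet (\<lambda>P. pdy F P * G P + F P * pdy G P) m n"
    by (intro jet_cong pd_step_mult(2)[OF F G])
  also have "\<dots> = jet (\<lambda>P. pdy F P * G P) m n + jet (\<lambda>P. F P * pdy G P) m n"
    by (intro jet_add uCk_mult[OF open_Q bounded_Q] F' G' uCk_pdy[OF F] uCk_pdy[OF G])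
  also have "\<dots> = leib (jet (pdy F)) (jet G) m n + leib (jet F) (jet (pdy G)) m n"
    using Suc.IH[OF uCk_pdy[OF F] G'] Suc.IH[OF F' uCk_pdy[OF G]] by simp
  also have "\<dots> = leib (jet F) (jet G) m (Suc n)"
    unfolding leib_Suc_y jet_Suc_y ..
  finally show ?case unfolding jet_Suc_y[of "\<lambda>P. F P * G P"] .
qed

end

section \<open>Taylor remainder and symmetry of mixed derivatives\<close>

lemma dist_pair_le: "dist (x, y) (x', y') \<le> \<bar>x - x'\<bar> + \<bar>y - y'\<bar>" for x y x' y' :: real
  unfolding dist_Pair_Pair dist_real_def by (metis sqrt_sum_squares_le_sum_abs abs_abs)

text \<open>Lagrange remainder with \<open>1 / fact n\<close> estimated by 1. The case
  \<open>c = b\<close> is separate because the remainder theorem is applied to a proper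
  interval.\<close>

lemma taylor_remainder_bound:
  fixes D :: "nat \<Rightarrow> real \<Rightarrow> real"
  assumes "n > 0" "c \<le> b"
    and der: "\<And>m t. m < n \<Longrightarrow> c \<le> t \<Longrightarrow> t \<le> b \<Longrightarrow> (D m has_real_derivative D (Suc m) t) (at t)"
    and bound: "\<And>t. c \<le> t \<Longrightarrow> t \<le> b \<Longrightarrow> \<bar>D n t\<bar> \<le> M"
  shows "\<bar>D 0 b - (\<Sum>m<n. D m c / fact m * (b - c) ^ m)\<bar> \<le> M * (b - c) ^ n"
proof (cases "c = b")
  case True
  have "(\<Sum>m<n. D m c / fact m * (b - c) ^ m) = (\<Sum>m\<in>{0}. D m c / fact m * (b - c) ^ m)"
    by (rule sum.mono_neutral_right) (use True assms(1) in auto)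
  then show ?thesis using True assms(1) by (simp add: zero_power)
next
  case False
  have "\<exists>t. c < t \<and> t < b \<and>
    D 0 b = (\<Sum>m<n. (D m c / fact m) * (b - c)^m) + (D n t / fact n) * (b - c)^n"
    by (rule Taylor_up[of n D "D 0" c b c]) (use assms False in auto)
  then obtain t where t: "c < t" "t < b"
    "D 0 b - (\<Sum>m<n. (D m c / fact m) * (b - c)^m) = (D n t / fact n) * (b - c)^n"
    by force
  have "\<bar>D n t / fact n\<bar> \<le> \<bar>D n t\<bar> / 1"
    unfolding abs_divide by (intro frac_le) (simp_all add: fact_ge_1)
  also have "\<dots> \<le> M" using bound t by simp
  finally have "\<bar>D n t / fact n\<bar> * (b - c) ^ n \<le> M * (b - c) ^ n"
    using assms(2) by (intro mult_right_mono) simp_all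
  then show ?thesis unfolding t(3) using assms(2) by (simp only: abs_mult) simp
qed

context corner_box
begin

text \<open>The second difference over a small square, evaluated by two mean value steps in either
  order, is \<open>t * t\<close> times either mixed derivative at some point of the square;
  continuity moves both points to \<open>P\<close>.\<close>

lemma mixed_partials:
  assumes F: "uCk (Suc (Suc k)) Q F" and P: "P \<in> Q"
  shows "pdy (pdx F) P = pdx (pdy F) P"
proof -
  obtain x y where xy: "P = (x, y)" by (cases P)
  note Fx = uCk_pdx[OF F] and Fy = uCk_pdy[OF F]
  have box: "(s, t) \<in> Q" if "x \<le> s" "s < x0 + e" "y \<le> t" "t < y0 + e" for s t
    using P that unfolding xy mem_Q by linarith
  have close: "\<exists>\<delta>>0. \<forall>P'\<in>Q. dist P' P < \<delta> \<longrightarrow> \<bar>G P' - G P\<bar> < \<epsilon>" if "uCk k Q G" "\<epsilon> > 0" for G \<epsilon>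
    using uCk_uniformly_continuous[OF that(1)] that(2) P
    unfolding uniformly_continuous_on_def dist_real_def by blast
  have "\<bar>pdy (pdx F) P - pdx (pdy F) P\<bar> \<le> \<epsilon>" if "\<epsilon> > 0" for \<epsilon>
  proof -
    have "\<epsilon> / 2 > 0" using that by simp
    obtain d1 where d1: "d1 > 0" "\<And>P'. P' \<in> Q \<Longrightarrow> dist P' P < d1 \<Longrightarrow> \<bar>pdy (pdx F) P' - pdy (pdx F) P\<bar> < \<epsilon> / 2"
      using close[OF uCk_pdy[OF Fx] \<open>\<epsilon> / 2 > 0\<close>] by blast
    obtain d2 where d2: "d2 > 0" "\<And>P'. P' \<in> Q \<Longrightarrow> dist P' P < d2 \<Longrightarrow> \<bar>pdx (pdy F) P' - pdx (pdy F) P\<bar> < \<epsilon> / 2"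
      using close[OF uCk_pdx[OF Fy] \<open>\<epsilon> / 2 > 0\<close>] by blast
    \<comment> \<open>The bound \<open>2 * t\<close> on distances to \<open>P\<close> explains the
      halves; the other two terms keep the square in \<open>Q\<close>.\<close>
    obtain t where t: "0 < t" "t < min (min (d1 / 2) (d2 / 2)) (min (x0 + e - x) (y0 + e - y))"
    proof -
      have "0 < min (min (d1 / 2) (d2 / 2)) (min (x0 + e - x) (y0 + e - y))"
        using d1(1) d2(1) P unfolding xy mem_Q by simp
      then show thesis using dense that by blast
    qed
    then have tt: "2 * t < d1" "2 * t < d2" "x + t < x0 + e" "y + t < y0 + e" by simp_all
    have near: "dist (z, w) P \<le> 2 * t" if "x < z" "z < x + t" "y < w" "w < y + t" for z w
      using dist_pair_le[of z w x y] that unfolding xy by linarith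
    let ?D = "F (x + t, y + t) - F (x + t, y) - (F (x, y + t) - F (x, y))"
    have "\<exists>z. x < z \<and> z < x + t \<and> (F (x + t, y + t) - F (x + t, y)) - (F (x, y + t) - F (x, y))
        = (x + t - x) * (pdx F (z, y + t) - pdx F (z, y))"
      by (rule MVT2) (use t(1) tt in \<open>auto intro!: DERIV_diff pdx_has_deriv[OF F] box\<close>)
    then obtain z where z: "x < z" "z < x + t" "?D = t * (pdx F (z, y + t) - pdx F (z, y))" by auto
    have "\<exists>w. y < w \<and> w < y + t \<and> pdx F (z, y + t) - pdx F (z, y) = (y + t - y) * pdy (pdx F) (z, w)"
      by (rule MVT2) (use t(1) tt z in \<open>auto intro!: pdy_has_deriv[OF Fx] box\<close>)
    then obtain w where w: "y < w" "w < y + t" "?D = t * (t * pdy (pdx F) (z, w))" using z(3) by auto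
    have "\<exists>w. y < w \<and> w < y + t \<and> (F (x + t, y + t) - F (x, y + t)) - (F (x + t, y) - F (x, y))
        = (y + t - y) * (pdy F (x + t, w) - pdy F (x, w))"
      by (rule MVT2) (use t(1) tt in \<open>auto intro!: DERIV_diff pdy_has_deriv[OF F] box\<close>)
    then obtain w' where w': "y < w'" "w' < y + t" "?D = t * (pdy F (x + t, w') - pdy F (x, w'))" by auto
    have "\<exists>z. x < z \<and> z < x + t \<and> pdy F (x + t, w') - pdy F (x, w') = (x + t - x) * pdx (pdy F) (z, w')"
      by (rule MVT2) (use t(1) tt w' in \<open>auto intro!: pdx_has_deriv[OF Fy] box\<close>)
    then obtain z' where z': "x < z'" "z' < x + t" "?D = t * (t * pdx (pdy F) (z', w'))" using w'(3) by auto
    have "pdy (pdx F) (z, w) = pdx (pdy F) (z', w')"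
      using w(3) z'(3) t(1) by simp
    moreover have "\<bar>pdy (pdx F) (z, w) - pdy (pdx F) P\<bar> < \<epsilon> / 2"
      by (rule d1(2)[OF box]) (use z w tt near[OF z(1,2) w(1,2)] in linarith)+
    moreover have "\<bar>pdx (pdy F) (z', w') - pdx (pdy F) P\<bar> < \<epsilon> / 2"
      by (rule d2(2)[OF box]) (use z' w' tt near[OF z'(1,2) w'(1,2)] in linarith)+
    ultimately show ?thesis by linarith
  qed
  then have "\<bar>pdy (pdx F) P - pdx (pdy F) P\<bar> \<le> 0" by (rule dense_ge)
  then show ?thesis by simp
qed

lemma pdy_iter_pdx: "uCk (Suc n) Q F \<Longrightarrow> P \<in> Q \<Longrightarrow> (pdy ^^ n) (pdx F) P = pdx ((pdy ^^ n) F) P"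
proof (induction n arbitrary: F P)
  case (Suc n)
  have "(pdy ^^ Suc n) (pdx F) P = (pdy ^^ n) (pdy (pdx F)) P" by (simp only: funpow_Suc_right o_apply)
  also have "\<dots> = (pdy ^^ n) (pdx (pdy F)) P"
    by (rule pdy_iter_cong[OF open_Q mixed_partials[OF Suc.prems(1)] Suc.prems(2)])
  also have "\<dots> = pdx ((pdy ^^ n) (pdy F)) P"
    by (rule Suc.IH[OF uCk_pdy[OF Suc.prems(1)] Suc.prems(2)])
  finally show ?case by (simp only: funpow_Suc_right o_apply)
qed simp

text \<open>The x-derivative has to be moved past \<open>n\<close> y-derivatives by symmetry, hence
  the class \<open>uCk (Suc n)\<close> whatever \<open>m\<close> is.\<close>

lemma jet_pdx: "uCk (Suc n) Q F \<Longrightarrow> jet (pdx F) m n = jet F (Suc m) n"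
  unfolding jet_def pd_def funpow_Suc_right o_apply
  by (intro cext_cong pdx_iter_cong[OF open_Q] pdy_iter_pdx)

section \<open>Functions vanishing on an edge\<close>

lemma cext_zeroI:
  assumes "uniformly_continuous_on Q F"
    and pts: "\<And>\<epsilon> d. \<epsilon> > 0 \<Longrightarrow> d > 0 \<Longrightarrow> \<exists>P\<in>Q. dist P (x0, y0) < d \<and> \<bar>F P\<bar> < \<epsilon>"
  shows "cext Q F (x0, y0) = 0"
proof (rule ccontr)
  let ?l = "cext Q F (x0, y0)"
  assume "?l \<noteq> 0"
  then have l: "\<bar>?l\<bar> / 2 > 0" by simp
  have "\<forall>\<^sub>F P in at (x0, y0) within Q. dist (F P) ?l < \<bar>?l\<bar> / 2"
    by (rule tendstoD[OF cext_tendsto[OF assms(1) corner_in_Qc] l])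
  then obtain d where d: "d > 0"
    "\<And>P. P \<in> Q \<Longrightarrow> P \<noteq> (x0, y0) \<Longrightarrow> dist P (x0, y0) < d \<Longrightarrow> dist (F P) ?l < \<bar>?l\<bar> / 2"
    unfolding eventually_at by blast
  obtain P where P: "P \<in> Q" "dist P (x0, y0) < d" "\<bar>F P\<bar> < \<bar>?l\<bar> / 2" using pts[OF l d(1)] by blast
  have "P \<noteq> (x0, y0)" using P(1) mem_Q[of x0 y0] by auto
  then show False using d(2)[OF P(1) _ P(2)] P(3) unfolding dist_real_def by linarith
qed

text \<open>Limits along horizontal lines at the open left edge, the corner excluded: the form in
  which a boundary condition is available.\<close>

definition left_zero :: "(real \<times> real \<Rightarrow> real) \<Rightarrow> bool" where
  "left_zero F \<longleftrightarrow> (\<forall>y\<in>{y0<..<y0+e}. ((\<lambda>x. F (x, y)) \<longlongrightarrow> 0) (at_right x0))"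

definition bottom_zero :: "(real \<times> real \<Rightarrow> real) \<Rightarrow> bool" where
  "bottom_zero F \<longleftrightarrow> (\<forall>x\<in>{x0<..<x0+e}. ((\<lambda>y. F (x, y)) \<longlongrightarrow> 0) (at_right y0))"

lemma left_zero_pdy:
  assumes F: "uCk (Suc k) Q F" and "left_zero F"
  shows "left_zero (pdy F)"
  unfolding left_zero_def
proof
  fix y assume y: "y \<in> {y0<..<y0+e}"
  show "((\<lambda>x. pdy F (x, y)) \<longlongrightarrow> 0) (at_right x0)"
  proof (rule vanishing_limit_deriv[where g = "\<lambda>s t. F (s, t)" and g' = "\<lambda>s t. pdy F (s, t)", OF _ _ _ e_pos y])
    fix s t assume "s \<in> {x0<..<x0+e}" "t \<in> {y0<..<y0+e}"
    then show "((\<lambda>t. F (s, t)) has_real_derivative pdy F (s, t)) (at t)"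
      by (intro pdy_has_deriv[OF F]) (simp add: mem_Q)
  next
    fix \<epsilon> :: real assume "\<epsilon> > 0"
    then obtain d where d: "d > 0" "\<And>P P'. P \<in> Q \<Longrightarrow> P' \<in> Q \<Longrightarrow> dist P' P < d \<Longrightarrow> \<bar>pdy F P' - pdy F P\<bar> < \<epsilon>"
      using uCk_uniformly_continuous[OF uCk_pdy[OF F]] unfolding uniformly_continuous_on_def dist_real_def by blast
    show "\<exists>\<delta>>0. \<forall>s\<in>{x0<..<x0+e}. \<forall>t\<in>{y0<..<y0+e}. \<forall>t'\<in>{y0<..<y0+e}.
        \<bar>t' - t\<bar> < \<delta> \<longrightarrow> \<bar>pdy F (s, t') - pdy F (s, t)\<bar> < \<epsilon>"
    proof (intro exI[of _ d] conjI d(1) ballI impI d(2))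
      fix s t t' assume *: "s \<in> {x0<..<x0+e}" "t \<in> {y0<..<y0+e}" "t' \<in> {y0<..<y0+e}" "\<bar>t' - t\<bar> < d"
      then show "(s, t) \<in> Q" "(s, t') \<in> Q" by (simp_all add: mem_Q)
      show "dist (s, t') (s, t) < d" using dist_pair_le[of s t' s t] *(4) by simp
    qed
  qed (use assms(2) in \<open>simp add: left_zero_def\<close>)
qed

lemma bottom_zero_pdx:
  assumes F: "uCk (Suc k) Q F" and "bottom_zero F"
  shows "bottom_zero (pdx F)"
  unfolding bottom_zero_def
proof
  fix x assume x: "x \<in> {x0<..<x0+e}"
  show "((\<lambda>y. pdx F (x, y)) \<longlongrightarrow> 0) (at_right y0)"
  proof (rule vanishing_limit_deriv[where g = "\<lambda>s t. F (t, s)" and g' = "\<lambda>s t. pdx F (t, s)", OF _ _ _ e_pos x])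
    fix s t assume "s \<in> {y0<..<y0+e}" "t \<in> {x0<..<x0+e}"
    then show "((\<lambda>t. F (t, s)) has_real_derivative pdx F (t, s)) (at t)"
      by (intro pdx_has_deriv[OF F]) (simp add: mem_Q)
  next
    fix \<epsilon> :: real assume "\<epsilon> > 0"
    then obtain d where d: "d > 0" "\<And>P P'. P \<in> Q \<Longrightarrow> P' \<in> Q \<Longrightarrow> dist P' P < d \<Longrightarrow> \<bar>pdx F P' - pdx F P\<bar> < \<epsilon>"
      using uCk_uniformly_continuous[OF uCk_pdx[OF F]] unfolding uniformly_continuous_on_def dist_real_def by blast
    show "\<exists>\<delta>>0. \<forall>s\<in>{y0<..<y0+e}. \<forall>t\<in>{x0<..<x0+e}. \<forall>t'\<in>{x0<..<x0+e}.
        \<bar>t' - t\<bar> < \<delta> \<longrightarrow> \<bar>pdx F (t', s) - pdx F (t, s)\<bar> < \<epsilon>"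
    proof (intro exI[of _ d] conjI d(1) ballI impI d(2))
      fix s t t' assume *: "s \<in> {y0<..<y0+e}" "t \<in> {x0<..<x0+e}" "t' \<in> {x0<..<x0+e}" "\<bar>t' - t\<bar> < d"
      then show "(t, s) \<in> Q" "(t', s) \<in> Q" by (simp_all add: mem_Q)
      show "dist (t', s) (t, s) < d" using dist_pair_le[of t' s t s] *(4) by simp
    qed
  qed (use assms(2) in \<open>simp add: bottom_zero_def\<close>)
qed

text \<open>The extension at the corner exists, so small values at points arbitrarily close to the
  corner determine it: fix a small height, then move towards the edge.\<close>

lemma left_zero_cext:
  assumes F: "uniformly_continuous_on Q F" and z: "left_zero F"
  shows "cext Q F (x0, y0) = 0"
proof (rule cext_zeroI[OF F])
  fix \<epsilon> d :: real assume pos: "\<epsilon> > 0" "d > 0"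
  define r where "r = min (d / 2) (e / 2)"
  have r: "0 < r" "r \<le> d / 2" "r < e" using pos e_pos by (simp_all add: r_def)
  have "\<forall>\<^sub>F x in at_right x0. dist (F (x, y0 + r)) 0 < \<epsilon>"
    using z r pos(1) unfolding left_zero_def by (intro tendstoD) simp_all
  moreover have "\<forall>\<^sub>F x in at_right x0. x \<in> {x0<..<x0+r}"
    using r(1) by (intro eventually_at_right_real) simp
  ultimately have "\<forall>\<^sub>F x in at_right x0. dist (F (x, y0 + r)) 0 < \<epsilon> \<and> x \<in> {x0<..<x0+r}"
    by (rule eventually_conj)
  then obtain x where x: "dist (F (x, y0 + r)) 0 < \<epsilon>" "x \<in> {x0<..<x0+r}"
    using eventually_happens'[OF trivial_limit_at_right_real] by blast
  show "\<exists>P\<in>Q. dist P (x0, y0) < d \<and> \<bar>F P\<bar> < \<epsilon>"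
  proof (intro bexI[of _ "(x, y0 + r)"] conjI)
    show "dist (x, y0 + r) (x0, y0) < d" using dist_pair_le[of x "y0 + r" x0 y0] x(2) r by auto
    show "\<bar>F (x, y0 + r)\<bar> < \<epsilon>" using x(1) by simp
    show "(x, y0 + r) \<in> Q" using x(2) r by (simp add: mem_Q)
  qed
qed

lemma bottom_zero_cext:
  assumes F: "uniformly_continuous_on Q F" and z: "bottom_zero F"
  shows "cext Q F (x0, y0) = 0"
proof (rule cext_zeroI[OF F])
  fix \<epsilon> d :: real assume pos: "\<epsilon> > 0" "d > 0"
  define r where "r = min (d / 2) (e / 2)"
  have r: "0 < r" "r \<le> d / 2" "r < e" using pos e_pos by (simp_all add: r_def)
  have "\<forall>\<^sub>F y in at_right y0. dist (F (x0 + r, y)) 0 < \<epsilon>"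
    using z r pos(1) unfolding bottom_zero_def by (intro tendstoD) simp_all
  moreover have "\<forall>\<^sub>F y in at_right y0. y \<in> {y0<..<y0+r}"
    using r(1) by (intro eventually_at_right_real) simp
  ultimately have "\<forall>\<^sub>F y in at_right y0. dist (F (x0 + r, y)) 0 < \<epsilon> \<and> y \<in> {y0<..<y0+r}"
    by (rule eventually_conj)
  then obtain y where y: "dist (F (x0 + r, y)) 0 < \<epsilon>" "y \<in> {y0<..<y0+r}"
    using eventually_happens'[OF trivial_limit_at_right_real] by blast
  show "\<exists>P\<in>Q. dist P (x0, y0) < d \<and> \<bar>F P\<bar> < \<epsilon>"
  proof (intro bexI[of _ "(x0 + r, y)"] conjI)
    show "dist (x0 + r, y) (x0, y0) < d" using dist_pair_le[of "x0 + r" y x0 y0] y(2) r by auto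
    show "\<bar>F (x0 + r, y)\<bar> < \<epsilon>" using y(1) by simp
    show "(x0 + r, y) \<in> Q" using y(2) r by (simp add: mem_Q)
  qed
qed

lemma left_zero_jet: "uCk n Q F \<Longrightarrow> left_zero F \<Longrightarrow> jet F 0 n = 0"
proof (induction n arbitrary: F)
  case 0
  then show ?case unfolding jet_00 by (intro left_zero_cext uCk_uniformly_continuous)
next
  case (Suc n)
  show ?case
    unfolding jet_Suc_y by (rule Suc.IH[OF uCk_pdy[OF Suc.prems(1)] left_zero_pdy[OF Suc.prems]])
qed

lemma bottom_zero_jet: "uCk m Q F \<Longrightarrow> bottom_zero F \<Longrightarrow> jet F m 0 = 0"
proof (induction m arbitrary: F)
  case 0
  then show ?case unfolding jet_00 by (intro bottom_zero_cext uCk_uniformly_continuous)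
next
  case (Suc m)
  show ?case
    unfolding jet_Suc_x_0 by (rule Suc.IH[OF uCk_pdx[OF Suc.prems(1)] bottom_zero_pdx[OF Suc.prems]])
qed

end

lemma sum_Lam_6: "(\<Sum>(p, q)\<in>Lam 6. w p q) = (\<Sum>q<7. \<Sum>p<7-q. w p q :: real)"
proof -
  have "Lam 6 = prod.swap ` (SIGMA q:{..<7}. {..<7-q})"
    by (auto simp: Lam_def image_iff)
  then have "(\<Sum>(p, q)\<in>Lam 6. w p q) = (\<Sum>(p, q)\<in>prod.swap ` (SIGMA q:{..<7}. {..<7-q}). w p q)"
    by simp
  also have "\<dots> = (\<Sum>(q, p)\<in>(SIGMA q:{..<7}. {..<7-q}). w p q)"
    by (subst sum.reindex) (auto simp: inj_on_def case_prod_unfold)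
  also have "\<dots> = (\<Sum>q<7. \<Sum>p<7-q. w p q)"
    by (rule sum.Sigma[symmetric]) auto
  finally show ?thesis .
qed

section \<open>Functions of one variable on the square\<close>

lemma uCk_snd:
  assumes "uCk1 k I \<phi>" "\<And>P. P \<in> S \<Longrightarrow> snd P \<in> I"
  shows "uCk k S (\<lambda>P. \<phi> (snd P))"
  using assms(1)
proof (induction k arbitrary: \<phi>)
  case 0
  then show ?case
    using assms(2) dist_snd_le unfolding uCk.simps uCk1.simps uniformly_continuous_on_def
    by (meson le_less_trans)
next
  case (Suc k)
  have c: "uniformly_continuous_on I \<phi>" "\<And>y. y \<in> I \<Longrightarrow> \<phi> differentiable (at y)" "uCk1 k I (deriv \<phi>)"
    using Suc.prems by auto
  have d: "pdx (\<lambda>P. \<phi> (snd P)) = (\<lambda>_. 0)" "pdy (\<lambda>P. \<phi> (snd P)) = (\<lambda>P. deriv \<phi> (snd P))"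
    by (auto simp: pdx_def pdy_def)
  show ?case
  proof (rule uCk_Suc_intro)
    show "uniformly_continuous_on S (\<lambda>P. \<phi> (snd P))"
      unfolding uniformly_continuous_on_def
    proof (intro allI impI)
      fix \<epsilon> :: real assume "\<epsilon> > 0"
      then obtain d where d: "d > 0" "\<And>x y. x \<in> I \<Longrightarrow> y \<in> I \<Longrightarrow> dist y x < d \<Longrightarrow> dist (\<phi> y) (\<phi> x) < \<epsilon>"
        using c(1) unfolding uniformly_continuous_on_def by blast
      show "\<exists>d>0. \<forall>x\<in>S. \<forall>x'\<in>S. dist x' x < d \<longrightarrow> dist (\<phi> (snd x')) (\<phi> (snd x)) < \<epsilon>"
        by (intro exI[of _ d] conjI d(1) ballI impI d(2) assms(2) le_less_trans[OF dist_snd_le])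
    qed
    show "uCk k S (pdx (\<lambda>P. \<phi> (snd P)))" unfolding d by (rule uCk_const)
    show "uCk k S (pdy (\<lambda>P. \<phi> (snd P)))" unfolding d by (rule Suc.IH[OF c(3)])
    fix x y assume "(x, y) \<in> S"
    then show "(\<lambda>t. \<phi> (snd (x, t))) differentiable (at y)" using c(2) assms(2)[of "(x, y)"] by simp
  qed simp
qed

lemma uCk_fst:
  assumes "uCk1 k I \<phi>" "\<And>P. P \<in> S \<Longrightarrow> fst P \<in> I"
  shows "uCk k S (\<lambda>P. \<phi> (fst P))"
  using assms(1)
proof (induction k arbitrary: \<phi>)
  case 0
  then show ?case
    using assms(2) dist_fst_le unfolding uCk.simps uCk1.simps uniformly_continuous_on_def
    by (meson le_less_trans)
next
  case (Suc k)
  have c: "uniformly_continuous_on I \<phi>" "\<And>y. y \<in> I \<Longrightarrow> \<phi> differentiable (at y)" "uCk1 k I (deriv \<phi>)"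
    using Suc.prems by auto
  have d: "pdy (\<lambda>P. \<phi> (fst P)) = (\<lambda>_. 0)" "pdx (\<lambda>P. \<phi> (fst P)) = (\<lambda>P. deriv \<phi> (fst P))"
    by (auto simp: pdx_def pdy_def)
  show ?case
  proof (rule uCk_Suc_intro)
    show "uniformly_continuous_on S (\<lambda>P. \<phi> (fst P))"
      unfolding uniformly_continuous_on_def
    proof (intro allI impI)
      fix \<epsilon> :: real assume "\<epsilon> > 0"
      then obtain d where d: "d > 0" "\<And>x y. x \<in> I \<Longrightarrow> y \<in> I \<Longrightarrow> dist y x < d \<Longrightarrow> dist (\<phi> y) (\<phi> x) < \<epsilon>"
        using c(1) unfolding uniformly_continuous_on_def by blast
      show "\<exists>d>0. \<forall>x\<in>S. \<forall>x'\<in>S. dist x' x < d \<longrightarrow> dist (\<phi> (fst x')) (\<phi> (fst x)) < \<epsilon>"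
        by (intro exI[of _ d] conjI d(1) ballI impI d(2) assms(2) le_less_trans[OF dist_fst_le])
    qed
    show "uCk k S (pdx (\<lambda>P. \<phi> (fst P)))" unfolding d by (rule Suc.IH[OF c(3)])
    show "uCk k S (pdy (\<lambda>P. \<phi> (fst P)))" unfolding d by (rule uCk_const)
    fix x y assume "(x, y) \<in> S"
    then show "(\<lambda>s. \<phi> (fst (s, y))) differentiable (at x)" using c(2) assms(2)[of "(x, y)"] by simp
  qed simp
qed

lemma uCk1_deriv_iter: "uCk1 n I \<phi> \<Longrightarrow> uniformly_continuous_on I ((deriv ^^ n) \<phi>)"
proof (induction n arbitrary: \<phi>)
  case (Suc n)
  have "uCk1 n I (deriv \<phi>)" using Suc.prems by simp
  then show ?case unfolding funpow_Suc_right o_apply by (rule Suc.IH)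
qed simp

lemma uCk1_Suc_mono: "uCk1 (Suc n) I \<phi> \<Longrightarrow> uCk1 n I \<phi>"
proof (induction n arbitrary: \<phi>)
  case (Suc n)
  have "uCk1 (Suc n) I (deriv \<phi>)" using Suc.prems by simp
  then have "uCk1 n I (deriv \<phi>)" by (rule Suc.IH)
  moreover have "uniformly_continuous_on I \<phi> \<and> (\<forall>x\<in>I. \<phi> differentiable (at x))"
    using Suc.prems by simp
  ultimately show ?case unfolding uCk1.simps(2)[of n] by blast
qed simp

lemma uCk1_mono: "uCk1 k I \<phi> \<Longrightarrow> j \<le> k \<Longrightarrow> uCk1 j I \<phi>"
proof (induction k)
  case (Suc k)
  show ?case
  proof (cases "j = Suc k")
    case False
    then show ?thesis using Suc.IH[OF uCk1_Suc_mono[OF Suc.prems(1)]] Suc.prems(2) by linarith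
  qed (use Suc.prems(1) in blast)
qed simp

lemma one_sided_ext_tendsto:
  fixes \<phi> :: "real \<Rightarrow> real"
  assumes "uniformly_continuous_on {a<..<b} \<phi>" "a < b"
  shows "(\<phi> \<longlongrightarrow> cext {a<..<b} \<phi> a) (at a within {a<..<b})"
proof -
  have "a \<in> closure {a<..<b}" using assms(2) by simp
  then obtain l where l: "(\<phi> \<longlongrightarrow> l) (at a within {a<..<b})"
    using uniformly_continuous_on_extension_at_closure[OF assms(1)] by blast
  moreover have "at a within {a<..<b} \<noteq> bot"
    using islimpt_greaterThanLessThan1[OF assms(2)] trivial_limit_within by blast
  ultimately show ?thesis unfolding cext_def by (simp add: tendsto_Lim)
qed

context corner_box
begin

section \<open>Taylor expansion up to the corner\<close>

lemma pd_bounded: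
  assumes "uCk k Q F"
  shows "\<exists>M\<ge>0. \<forall>p q P. p + q \<le> k \<longrightarrow> P \<in> Q \<longrightarrow> \<bar>pd p q F P\<bar> \<le> M"
proof -
  have "bounded (pd p q F ` Q)" if "p + q \<le> k" for p q
  proof (rule bounded_uniformly_continuous_image[OF _ bounded_Q])
    have "uCk (0 + (p + q)) Q F" using uCk_mono[OF assms that] by simp
    then show "uniformly_continuous_on Q (pd p q F)" by (intro uCk_uniformly_continuous uCk_pd)
  qed
  then have "bounded (\<Union>s\<in>Lam k. pd (fst s) (snd s) F ` Q)"
    by (intro bounded_UN finite_Lam) (auto simp: Lam_def)
  then obtain M where M: "\<And>r. r \<in> (\<Union>s\<in>Lam k. pd (fst s) (snd s) F ` Q) \<Longrightarrow> \<bar>r\<bar> \<le> M"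
    unfolding bounded_iff real_norm_def by blast
  have "\<bar>pd p q F P\<bar> \<le> max 0 M" if "p + q \<le> k" "P \<in> Q" for p q P
  proof -
    have "pd p q F P \<in> (\<Union>s\<in>Lam k. pd (fst s) (snd s) F ` Q)"
      using that by (intro UN_I[of "(p, q)"]) (auto simp: Lam_def)
    then show ?thesis using M by fastforce
  qed
  then show ?thesis by (intro exI[of _ "max 0 M"]) simp
qed

text \<open>Expansion in y at the abscissa \<open>x + a\<close>, then of each coefficient in x to
  the complementary order. The constant is uniform in the base point, which can therefore move to
  the corner.\<close>

lemma box_taylor:
  assumes F: "uCk 7 Q F"
  shows "\<exists>M. \<forall>x y a b h. (x, y) \<in> Q \<longrightarrow> (x + a, y + b) \<in> Q \<longrightarrow> 0 \<le> a \<longrightarrow> a \<le> h \<longrightarrow>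
    0 \<le> b \<longrightarrow> b \<le> h \<longrightarrow> \<bar>F (x + a, y + b) - taylor6 (\<lambda>p q. pd p q F (x, y)) a b\<bar> \<le> M * h ^ 7"
proof -
  obtain M where M: "M \<ge> 0" "\<And>p q P. p + q \<le> 7 \<Longrightarrow> P \<in> Q \<Longrightarrow> \<bar>pd p q F P\<bar> \<le> M"
    using pd_bounded[OF F] by blast
  \<comment> \<open>One remainder from y and seven from x, each at most
    \<open>M * h ^ 7\<close>.\<close>
  have "\<bar>F (x + a, y + b) - taylor6 (\<lambda>p q. pd p q F (x, y)) a b\<bar> \<le> 8 * M * h ^ 7"
    if P: "(x, y) \<in> Q" "(x + a, y + b) \<in> Q" and ab: "0 \<le> a" "a \<le> h" "0 \<le> b" "b \<le> h" for x y a b h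
  proof -
    have inQ: "(s, t) \<in> Q" if "x \<le> s" "s \<le> x + a" "y \<le> t" "t \<le> y + b" for s t
      using P that unfolding mem_Q by linarith
    have 1: "\<bar>(pdy ^^ 0) F (x + a, y + b) - (\<Sum>q<7. (pdy ^^ q) F (x + a, y) / fact q * (y + b - y) ^ q)\<bar>
        \<le> M * (y + b - y) ^ 7"
    proof (rule taylor_remainder_bound[where D = "\<lambda>q t. (pdy ^^ q) F (x + a, t)"])
      fix q t assume q: "q < (7::nat)" "y \<le> t" "t \<le> y + b"
      have "uCk (Suc (6 - q)) Q ((pdy ^^ q) F)"
        by (rule uCk_pdy_iter) (use F q(1) in simp)
      then show "((\<lambda>t. (pdy ^^ q) F (x + a, t)) has_real_derivative (pdy ^^ Suc q) F (x + a, t)) (at t)"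
        unfolding funpow.simps o_apply by (rule pdy_has_deriv) (rule inQ, use q ab in auto)
    next
      fix t assume "y \<le> t" "t \<le> y + b"
      then have "\<bar>pd 0 7 F (x + a, t)\<bar> \<le> M" using ab by (intro M(2) inQ) auto
      then show "\<bar>(pdy ^^ 7) F (x + a, t)\<bar> \<le> M" by (simp add: pd_def)
    qed (use ab in auto)
    have 2: "\<bar>(pdx ^^ 0) ((pdy ^^ q) F) (x + a, y)
          - (\<Sum>p<7-q. (pdx ^^ p) ((pdy ^^ q) F) (x, y) / fact p * (x + a - x) ^ p)\<bar> \<le> M * (x + a - x) ^ (7 - q)"
      if q: "q < 7" for q
    proof (rule taylor_remainder_bound[where D = "\<lambda>p s. (pdx ^^ p) ((pdy ^^ q) F) (s, y)"])
      fix p s assume p: "p < 7 - q" "x \<le> s" "s \<le> x + a"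
      have "uCk (Suc (6 - q - p)) Q ((pdx ^^ p) ((pdy ^^ q) F))"
        by (intro uCk_pdx_iter uCk_pdy_iter) (use F p(1) q in simp)
      then show "((\<lambda>s. (pdx ^^ p) ((pdy ^^ q) F) (s, y)) has_real_derivative
          (pdx ^^ Suc p) ((pdy ^^ q) F) (s, y)) (at s)"
        unfolding funpow.simps o_apply by (rule pdx_has_deriv) (rule inQ, use p ab in auto)
    next
      fix s assume "x \<le> s" "s \<le> x + a"
      then have "\<bar>pd (7 - q) q F (s, y)\<bar> \<le> M" using ab q by (intro M(2) inQ) auto
      then show "\<bar>(pdx ^^ (7 - q)) ((pdy ^^ q) F) (s, y)\<bar> \<le> M" by (simp add: pd_def)
    qed (use ab q in auto)
    have taylor6: "taylor6 (\<lambda>p q. pd p q F (x, y)) a b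
        = (\<Sum>q<7. (\<Sum>p<7-q. (pdx ^^ p) ((pdy ^^ q) F) (x, y) / fact p * a ^ p) / fact q * b ^ q)"
      unfolding taylor6_def sum_Lam_6 pd_def sum_divide_distrib sum_distrib_right
      by (intro sum.cong refl) simp
    have "\<bar>(\<Sum>q<7. (pdy ^^ q) F (x + a, y) / fact q * b ^ q) - taylor6 (\<lambda>p q. pd p q F (x, y)) a b\<bar>
        \<le> (\<Sum>q<7::nat. M * h ^ 7)"
      unfolding taylor6 sum_subtractf[symmetric]
    proof (rule order_trans[OF sum_abs sum_mono])
      fix q :: nat assume "q \<in> {..<7}"
      then have q: "q < 7" by simp
      let ?d = "(pdy ^^ q) F (x + a, y) - (\<Sum>p<7-q. (pdx ^^ p) ((pdy ^^ q) F) (x, y) / fact p * a ^ p)"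
      have "\<bar>?d\<bar> \<le> M * a ^ (7 - q)" using 2[OF q] by simp
      also have "\<dots> \<le> M * h ^ (7 - q)" using ab M(1) by (intro mult_left_mono power_mono)
      finally have d: "\<bar>?d\<bar> \<le> M * h ^ (7 - q)" .
      have "\<bar>b ^ q / fact q\<bar> \<le> h ^ q / 1"
        unfolding abs_divide using ab by (intro frac_le) (simp_all add: fact_ge_1 power_mono)
      then have "\<bar>?d\<bar> * \<bar>b ^ q / fact q\<bar> \<le> (M * h ^ (7 - q)) * (h ^ q)"
        using d ab M(1) by (intro mult_mono) simp_all
      also have "\<dots> = M * h ^ 7" using q by (simp add: power_add[symmetric])
      finally show "\<bar>(pdy ^^ q) F (x + a, y) / fact q * b ^ q
          - (\<Sum>p<7-q. (pdx ^^ p) ((pdy ^^ q) F) (x, y) / fact p * a ^ p) / fact q * b ^ q\<bar> \<le> M * h ^ 7"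
        unfolding abs_mult[symmetric] by (simp add: algebra_simps diff_divide_distrib)
    qed
    moreover have "\<bar>F (x + a, y + b) - (\<Sum>q<7. (pdy ^^ q) F (x + a, y) / fact q * b ^ q)\<bar> \<le> M * b ^ 7"
      using 1 by simp
    moreover have "M * b ^ 7 \<le> M * h ^ 7" using ab M(1) by (intro mult_left_mono power_mono)
    ultimately show ?thesis by (simp add: algebra_simps)
  qed
  then show ?thesis by (intro exI[of _ "8 * M"]) blast
qed

text \<open>The base point approaches the corner along the diagonal; values, jets and the uniform
  bound pass to the limit. The condition \<open>h < e\<close> leaves room for the shifted
  points.\<close>

lemma cext_taylor:
  assumes F: "uCk 7 Q F"
  shows "\<exists>M. \<forall>a b h. 0 \<le> a \<longrightarrow> a \<le> h \<longrightarrow> 0 \<le> b \<longrightarrow> b \<le> h \<longrightarrow> h < e \<longrightarrow>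
    \<bar>cext Q F (x0 + a, y0 + b) - taylor6 (jet F) a b\<bar> \<le> M * h ^ 7"
proof -
  obtain M where M: "\<And>x y a b h. (x, y) \<in> Q \<Longrightarrow> (x + a, y + b) \<in> Q \<Longrightarrow> 0 \<le> a \<Longrightarrow> a \<le> h \<Longrightarrow>
    0 \<le> b \<Longrightarrow> b \<le> h \<Longrightarrow> \<bar>F (x + a, y + b) - taylor6 (\<lambda>p q. pd p q F (x, y)) a b\<bar> \<le> M * h ^ 7"
    using box_taylor[OF F] by blast
  have "\<bar>cext Q F (x0 + a, y0 + b) - taylor6 (jet F) a b\<bar> \<le> M * h ^ 7"
    if ab: "0 \<le> a" "a \<le> h" "0 \<le> b" "b \<le> h" "h < e" for a b h
  proof -
    have P: "(x0 + a, y0 + b) \<in> Qc" using ab by (simp add: mem_Qc)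
    have "((\<lambda>d. F (x0 + a + d, y0 + b + d)) \<longlongrightarrow> cext Q F (x0 + a, y0 + b)) (at_right 0)"
      by (rule filterlim_compose[OF cext_tendsto[OF uCk_uniformly_continuous[OF F] P] diagonal_approach[OF P]])
    moreover have "((\<lambda>d. pd p q F (x0 + d, y0 + d)) \<longlongrightarrow> jet F p q) (at_right 0)" if "p + q \<le> 6" for p q
    proof (rule filterlim_compose[OF jet_tendsto diagonal_approach[OF corner_in_Qc]])
      show "uCk (p + q) Q F" by (rule uCk_mono[OF F]) (use that in simp)
    qed
    then have "((\<lambda>d. taylor6 (\<lambda>p q. pd p q F (x0 + d, y0 + d)) a b) \<longlongrightarrow> taylor6 (jet F) a b) (at_right 0)"
      unfolding taylor6_def case_prod_unfold by (intro tendsto_intros) (auto simp: Lam_def)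
    ultimately have "((\<lambda>d. \<bar>F (x0 + a + d, y0 + b + d) - taylor6 (\<lambda>p q. pd p q F (x0 + d, y0 + d)) a b\<bar>)
        \<longlongrightarrow> \<bar>cext Q F (x0 + a, y0 + b) - taylor6 (jet F) a b\<bar>) (at_right 0)"
      by (intro tendsto_intros)
    moreover have "\<forall>\<^sub>F d in at_right 0. d \<in> {0<..<e - h}"
      using ab by (intro eventually_at_right_real) simp
    then have "\<forall>\<^sub>F d in at_right 0.
        \<bar>F (x0 + a + d, y0 + b + d) - taylor6 (\<lambda>p q. pd p q F (x0 + d, y0 + d)) a b\<bar> \<le> M * h ^ 7"
    proof eventually_elim
      case (elim d)
      have "\<bar>F (x0 + d + a, y0 + d + b) - taylor6 (\<lambda>p q. pd p q F (x0 + d, y0 + d)) a b\<bar> \<le> M * h ^ 7"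
        using elim ab by (intro M) (simp_all add: mem_Q)
      then show ?case by (simp only: add.assoc add.commute[of d])
    qed
    ultimately show ?thesis
      by (rule tendsto_upperbound) simp
  qed
  then show ?thesis by blast
qed

text \<open>Divided by \<open>a\<close>, the equation says that a sum of five terms vanishes, and so
  do its jets. The bound \<open>c\<close> makes \<open>1 / a\<close> as smooth as \<open>a\<close>;
  order at most 4 keeps the derivatives of \<open>u\<close> within order 6.\<close>

lemma pde_jet_of_solution:
  assumes a: "uCk 6 Q a" and u: "uCk 7 Q u" and f: "uCk 5 Q f"
    and c: "c > 0" "\<And>P. P \<in> Q \<Longrightarrow> c \<le> a P"
    and pde: "\<And>P. P \<in> Q \<Longrightarrow> - (pdx (\<lambda>P. a P * pdx u P) P + pdy (\<lambda>P. a P * pdy u P) P) = f P"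
  shows "pde_jet (jet (\<lambda>P. pdx a P / a P)) (jet (\<lambda>P. pdy a P / a P)) (jet (\<lambda>P. 1 / a P)) (jet f) (jet u)"
  unfolding pde_jet_def
proof (intro allI impI)
  fix p q :: nat assume pq: "p + q \<le> 4"
  have a': "uCk (Suc 5) Q a" and u': "uCk (Suc 6) Q u" using a u by (simp_all only: eval_nat_numeral BitM.simps)
  have ux: "uCk 6 Q (pdx u)" "uCk 6 Q (pdy u)" by (rule uCk_pdx[OF u'], rule uCk_pdy[OF u'])
  have ux': "uCk (Suc 5) Q (pdx u)" "uCk (Suc 5) Q (pdy u)" using ux by (simp_all only: eval_nat_numeral BitM.simps)
  have r: "uCk 6 Q (\<lambda>P. 1 / a P)" by (rule uCk_recip[OF open_Q bounded_Q a c])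
  have "uCk 5 Q (\<lambda>P. pdx a P * (1 / a P))" "uCk 5 Q (\<lambda>P. pdy a P * (1 / a P))"
    by (intro uCk_mult[OF open_Q bounded_Q] uCk_pdx[OF a'] uCk_pdy[OF a'] uCk_mono[OF r]; simp)+
  then have ax: "uCk 5 Q (\<lambda>P. pdx a P / a P)" "uCk 5 Q (\<lambda>P. pdy a P / a P)" by simp_all
  let ?n = "p + q"
  have n: "?n \<le> 5" "?n \<le> 6" using pq by simp_all
  let ?t1 = "pdx (pdx u)" and ?t2 = "pdy (pdy u)" and ?t3 = "\<lambda>P. pdx a P / a P * pdx u P"
    and ?t4 = "\<lambda>P. pdy a P / a P * pdy u P" and ?t5 = "\<lambda>P. 1 / a P * f P"
  note cls = uCk_mono[OF uCk_pdx[OF ux'(1)] n(1)] uCk_mono[OF uCk_pdy[OF ux'(2)] n(1)]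
    uCk_mono[OF ax(1) n(1)] uCk_mono[OF ax(2) n(1)] uCk_mono[OF ux(1) n(2)] uCk_mono[OF ux(2) n(2)]
    uCk_mono[OF r n(2)] uCk_mono[OF f n(1)]
  note add = uCk_add[OF open_Q] and mult = uCk_mult[OF open_Q bounded_Q]
  have eq: "?t1 P + ?t2 P + (?t3 P + ?t4 P) + ?t5 P = 0" if P: "P \<in> Q" for P
  proof -
    have "a P > 0" using c(1) c(2)[OF P] by linarith
    moreover have "- (pdx a P * pdx u P + a P * ?t1 P + (pdy a P * pdy u P + a P * ?t2 P)) = f P"
      using pde[OF P] pd_step_mult(1)[OF a' ux'(1) P] pd_step_mult(2)[OF a' ux'(2) P] by simp
    ultimately show ?thesis by (simp add: field_simps)
  qed
  have "jet (\<lambda>P. ?t1 P + ?t2 P + (?t3 P + ?t4 P) + ?t5 P) p q = jet (\<lambda>_. 0) p q"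
    by (rule jet_cong[OF eq])
  \<comment> \<open>From \<open>0 + 0 = 0\<close>: this jet is its own double.\<close>
  moreover have "jet (\<lambda>_. 0) p q = 0"
    using jet_add[OF uCk_const[of _ _ 0] uCk_const[of _ _ 0], of p q] by simp
  moreover have "jet (\<lambda>P. ?t1 P + ?t2 P + (?t3 P + ?t4 P) + ?t5 P) p q
     = jet ?t1 p q + jet ?t2 p q + (jet ?t3 p q + jet ?t4 p q) + jet ?t5 p q"
    by (subst jet_add, (intro add mult cls)+, subst jet_add, (intro add mult cls)+,
        subst jet_add, (intro add mult cls)+, subst jet_add, (intro add mult cls)+) (rule refl)
  moreover have "jet ?t1 p q = jet u (Suc (Suc p)) q"
    using jet_pdx[of q "pdx u" p] jet_pdx[of q u "Suc p"] uCk_mono[OF ux(1), of "Suc q"] uCk_mono[OF u, of "Suc q"] pq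
    by simp
  moreover have "jet ?t2 p q = jet u p (Suc (Suc q))" by (simp only: jet_Suc_y)
  moreover have "jet ?t3 p q = leib (jet (\<lambda>P. pdx a P / a P)) (jet (pdx u)) p q"
    by (rule jet_mult; intro cls)
  moreover have "jet ?t4 p q = leib (jet (\<lambda>P. pdy a P / a P)) (jet (pdy u)) p q"
    by (rule jet_mult; intro cls)
  moreover have "jet ?t5 p q = leib (jet (\<lambda>P. 1 / a P)) (jet f) p q"
    by (rule jet_mult; intro cls)
  moreover have "leib X (jet (pdx u)) p q = leib X (\<lambda>i j. jet u (i + 1) j) p q" for X
  proof -
    have "jet (pdx u) i j = jet u (i + 1) j" if "j \<le> q" for i j
      using jet_pdx[of j u i] uCk_mono[OF u, of "Suc j"] that pq by simp
    then show ?thesis unfolding leib_def by (intro sum.cong refl) simp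
  qed
  moreover have "leib X (jet (pdy u)) p q = leib X (\<lambda>i j. jet u i (j + 1)) p q" for X
    unfolding leib_def by (simp add: jet_Suc_y)
  ultimately show "jet u (p + 2) q + jet u p (q + 2)
     + (\<Sum>i=0..p. \<Sum>j=0..q. real (p choose i) * real (q choose j) *
          (jet (\<lambda>P. pdx a P / a P) (p - i) (q - j) * jet u (i + 1) j
          + jet (\<lambda>P. pdy a P / a P) (p - i) (q - j) * jet u i (j + 1)))
     + (\<Sum>i=0..p. \<Sum>j=0..q. real (p choose i) * real (q choose j) *
          (jet (\<lambda>P. 1 / a P) (p - i) (q - j) * jet f i j)) = 0"
    unfolding leib_def distrib_left sum.distrib by simp
qed

end

section \<open>Boundary conditions and consistency\<close>

lemma pdy_iter_snd: "(pdy ^^ n) (\<lambda>P. \<phi> (snd P)) = (\<lambda>P. (deriv ^^ n) \<phi> (snd P))"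
proof (induction n)
  case (Suc n)
  show ?case unfolding funpow.simps o_apply Suc by (simp add: pdy_def case_prod_unfold)
qed simp

lemma pdx_iter_fst: "(pdx ^^ n) (\<lambda>P. \<phi> (fst P)) = (\<lambda>P. (deriv ^^ n) \<phi> (fst P))"
proof (induction n)
  case (Suc n)
  show ?case unfolding funpow.simps o_apply Suc by (simp add: pdx_def case_prod_unfold)
qed simp

lemma tendsto_bigo_1: "(f \<longlongrightarrow> c) G \<Longrightarrow> f \<in> O[G](\<lambda>_. 1 :: real)"
  for f :: "'a \<Rightarrow> real"
  by (rule bigoI_tendsto[of f "\<lambda>_. 1" c]) simp_all

text \<open>Vanishing coefficients up to \<open>h^6\<close> mean divisibility by \<open>h^7\<close>,
  and the cofactor is bounded near zero.\<close>

lemma poly_O7_bigo: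
  assumes "poly_O7 F"
  shows "F \<in> O[at_right 0](\<lambda>h. h ^ 7)"
proof -
  obtain Q where Q: "\<And>h. F h = poly Q h" "\<And>i. i \<le> 6 \<Longrightarrow> coeff Q i = 0"
    using assms unfolding poly_O7_def by blast
  have "monom 1 7 dvd Q" unfolding monom_1_dvd_iff' using Q(2) by simp
  then obtain R where R: "Q = monom 1 7 * R" by (elim dvdE)
  have F: "F = (\<lambda>h. h ^ 7 * poly R h)" using Q(1) by (auto simp: R poly_monom)
  have "(poly R \<longlongrightarrow> poly R 0) (at_right 0)" by (intro tendsto_intros)
  then have "(\<lambda>h. h ^ 7 * poly R h) \<in> O[at_right 0](\<lambda>h. h ^ 7 * 1)"
    by (intro landau_o.big.mult landau_o.big_refl) (rule tendsto_bigo_1)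
  then show ?thesis unfolding F by simp
qed

lemma inverse_mult_bigo:
  assumes "F \<in> O[at_right 0](\<lambda>h. h ^ 7)"
  shows "(\<lambda>h. inverse h * F h) \<in> O[at_right 0](\<lambda>h::real. h ^ 6 :: real)"
proof -
  obtain c where c: "\<forall>\<^sub>F h in at_right 0. norm (F h) \<le> c * norm (h ^ 7)"
    using assms by (elim landau_o.bigE)
  have "\<forall>\<^sub>F h in at_right 0. norm (inverse h * F h) \<le> c * norm (h ^ 6)"
    using c eventually_at_right_less[of 0]
  proof eventually_elim
    case (elim h)
    have "norm (inverse h * F h) \<le> inverse h * (c * norm (h ^ 7))"
      using elim by (simp add: abs_mult)
    also have "\<dots> = c * norm (h ^ 6)" using elim(2) by (simp add: power_abs field_simps eval_nat_numeral)
    finally show ?case .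
  qed
  then show ?thesis by (rule bigoI)
qed

context corner_box
begin

text \<open>Below the upper and to the left of the right border of the square, \<open>S\<close> and
  \<open>Q\<close> coincide, so continuous extensions from \<open>S\<close> to points of
  \<open>Qc\<close> can be computed from \<open>Q\<close> alone.\<close>

lemma at_within_side:
  assumes "Q \<subseteq> S" and "\<forall>x y. (x, y) \<in> S \<longrightarrow> x0 < x \<and> y0 < y" and "P \<in> Qc"
  shows "at P within S = at P within Q"
proof (rule at_within_nhd)
  show "P \<in> {..<x0+e} \<times> {..<y0+e}" using assms(3) by (auto simp: Qc_def)
  show "open ({..<x0+e} \<times> {..<y0+e})" by (intro open_Times open_lessThan)
  show "S \<inter> ({..<x0+e} \<times> {..<y0+e}) - {P} = Q \<inter> ({..<x0+e} \<times> {..<y0+e}) - {P}"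
    using assms(1,2) by (auto simp: Q_def)
qed

lemma jet_snd:
  assumes "uCk1 n {y0<..<b} \<phi>" "y0 + e \<le> b"
  shows "jet (\<lambda>P. \<phi> (snd P)) 0 n = cext {y0<..<b} ((deriv ^^ n) \<phi>) y0"
proof -
  have "y0 < b" using e_pos assms(2) by linarith
  have "filterlim snd (at y0 within {y0<..<b}) (at (x0, y0) within Q)"
    unfolding filterlim_at
  proof
    show "(snd \<longlongrightarrow> y0) (at (x0, y0) within Q)"
      using tendsto_snd[OF tendsto_ident_at[of "(x0, y0)" Q]] by simp
    have "\<forall>\<^sub>F P in at (x0, y0) within Q. P \<in> Q" by (simp add: eventually_at_filter)
    then show "\<forall>\<^sub>F P in at (x0, y0) within Q. snd P \<in> {y0<..<b} \<and> snd P \<noteq> y0"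
      by (rule eventually_mono) (use assms(2) in \<open>auto simp: Q_def\<close>)
  qed
  from filterlim_compose[OF one_sided_ext_tendsto[OF uCk1_deriv_iter[OF assms(1)] \<open>y0 < b\<close>] this]
  show ?thesis unfolding jet_def pd_def pdy_iter_snd by (simp add: cext_eqI[OF corner_in_Qc])
qed

lemma jet_fst:
  assumes "uCk1 n {x0<..<b} \<phi>" "x0 + e \<le> b"
  shows "jet (\<lambda>P. \<phi> (fst P)) n 0 = cext {x0<..<b} ((deriv ^^ n) \<phi>) x0"
proof -
  have "x0 < b" using e_pos assms(2) by linarith
  have "filterlim fst (at x0 within {x0<..<b}) (at (x0, y0) within Q)"
    unfolding filterlim_at
  proof
    show "(fst \<longlongrightarrow> x0) (at (x0, y0) within Q)"
      using tendsto_fst[OF tendsto_ident_at[of "(x0, y0)" Q]] by simp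
    have "\<forall>\<^sub>F P in at (x0, y0) within Q. P \<in> Q" by (simp add: eventually_at_filter)
    then show "\<forall>\<^sub>F P in at (x0, y0) within Q. fst P \<in> {x0<..<b} \<and> fst P \<noteq> x0"
      by (rule eventually_mono) (use assms(2) in \<open>auto simp: Q_def\<close>)
  qed
  from filterlim_compose[OF one_sided_ext_tendsto[OF uCk1_deriv_iter[OF assms(1)] \<open>x0 < b\<close>] this]
  show ?thesis unfolding jet_def pd_def funpow_0 pdx_iter_fst by (simp add: cext_eqI[OF corner_in_Qc])
qed

lemma cext_left_tendsto:
  assumes "uniformly_continuous_on Q F" "y \<in> {y0<..<y0+e}"
  shows "((\<lambda>x. F (x, y)) \<longlongrightarrow> cext Q F (x0, y)) (at_right x0)"
proof -
  have P: "(x0, y) \<in> Qc" using assms(2) e_pos by (simp add: mem_Qc)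
  have "filterlim (\<lambda>x. (x, y)) (at (x0, y) within Q) (at_right x0)"
    unfolding filterlim_at
  proof
    show "((\<lambda>x. (x, y)) \<longlongrightarrow> (x0, y)) (at_right x0)" by (intro tendsto_intros)
    have "\<forall>\<^sub>F x in at_right x0. x \<in> {x0<..<x0+e}" using e_pos by (intro eventually_at_right_real) simp
    then show "\<forall>\<^sub>F x in at_right x0. (x, y) \<in> Q \<and> (x, y) \<noteq> (x0, y)"
      by (rule eventually_mono) (use assms(2) in \<open>simp add: mem_Q\<close>)
  qed
  from filterlim_compose[OF cext_tendsto[OF assms(1) P] this] show ?thesis .
qed

lemma cext_bottom_tendsto:
  assumes "uniformly_continuous_on Q F" "x \<in> {x0<..<x0+e}"
  shows "((\<lambda>y. F (x, y)) \<longlongrightarrow> cext Q F (x, y0)) (at_right y0)"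
proof -
  have P: "(x, y0) \<in> Qc" using assms(2) e_pos by (simp add: mem_Qc)
  have "filterlim (\<lambda>y. (x, y)) (at (x, y0) within Q) (at_right y0)"
    unfolding filterlim_at
  proof
    show "((\<lambda>y. (x, y)) \<longlongrightarrow> (x, y0)) (at_right y0)" by (intro tendsto_intros)
    have "\<forall>\<^sub>F y in at_right y0. y \<in> {y0<..<y0+e}" using e_pos by (intro eventually_at_right_real) simp
    then show "\<forall>\<^sub>F y in at_right y0. (x, y) \<in> Q \<and> (x, y) \<noteq> (x, y0)"
      by (rule eventually_mono) (use assms(2) in \<open>simp add: mem_Q\<close>)
  qed
  from filterlim_compose[OF cext_tendsto[OF assms(1) P] this] show ?thesis .
qed

text \<open>The defect \<open>\<alpha> u - u_x - g\<close> tends to zero at the left edge, so its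
  y-jets at the corner vanish; expanding them by the Leibniz rule gives the differentiated
  condition.\<close>

lemma bc_jet_left:
  assumes u: "uCk 7 Q u" and al: "uCk1 5 {y0<..<b} \<alpha>" and g: "uCk1 5 {y0<..<b} g" and b: "y0 + e \<le> b"
    and bc: "\<And>y. y \<in> {y0<..<y0+e} \<Longrightarrow> - cext Q (pdx u) (x0, y) + \<alpha> y * cext Q u (x0, y) = g y"
  shows "bc_jet (\<lambda>n. cext {y0<..<b} ((deriv ^^ n) \<alpha>) y0) (\<lambda>n. cext {y0<..<b} ((deriv ^^ n) g) y0) (jet u)"
proof -
  have u': "uCk (Suc 6) Q u" using u by (simp only: eval_nat_numeral BitM.simps)
  have snd: "snd P \<in> {y0<..<b}" if "P \<in> Q" for P using that b by (auto simp: Q_def)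
  have A: "uCk 5 Q (\<lambda>P. \<alpha> (snd P))" by (rule uCk_snd[OF al snd])
  have G: "uCk 5 Q (\<lambda>P. g (snd P))" by (rule uCk_snd[OF g snd])
  have ux: "uCk 5 Q (pdx u)" by (rule uCk_mono[OF uCk_pdx[OF u']]) simp
  have u5: "uCk 5 Q u" by (rule uCk_mono[OF u]) simp
  let ?H = "\<lambda>P. \<alpha> (snd P) * u P + - (pdx u P + g (snd P))"
  have H: "uCk 5 Q ?H"
    by (intro uCk_add[OF open_Q] uCk_mult[OF open_Q bounded_Q] uCk_uminus[OF open_Q bounded_Q] A G ux u5)
  have "left_zero ?H"
    unfolding left_zero_def
  proof
    fix y assume y: "y \<in> {y0<..<y0+e}"
    have "((\<lambda>x. ?H (x, y)) \<longlongrightarrow> \<alpha> (snd (x0, y)) * cext Q u (x0, y) + - (cext Q (pdx u) (x0, y) + g (snd (x0, y)))) (at_right x0)"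
      unfolding snd_conv
      by (intro tendsto_add tendsto_mult tendsto_minus tendsto_const
          cext_left_tendsto[OF uCk_uniformly_continuous[OF u] y] cext_left_tendsto[OF uCk_uniformly_continuous[OF ux] y])
    moreover have "\<alpha> (snd (x0, y)) * cext Q u (x0, y) + - (cext Q (pdx u) (x0, y) + g (snd (x0, y))) = 0"
      using bc[OF y] by simp
    ultimately show "((\<lambda>x. ?H (x, y)) \<longlongrightarrow> 0) (at_right x0)" by (simp only:)
  qed
  then have H0: "jet ?H 0 n = 0" if "n \<le> 5" for n
    by (intro left_zero_jet uCk_mono[OF H that])
  show ?thesis
    unfolding bc_jet_def
  proof (intro allI impI)
    fix n :: nat assume n: "n \<le> 5"
    have n': "0 + n \<le> 5" using n by simp
    \<comment> \<open>The defect is added on the right, so that the sum and product rules for jets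
      apply directly.\<close>
    have "jet (\<lambda>P. \<alpha> (snd P) * u P) 0 n = jet (\<lambda>P. pdx u P + g (snd P) + ?H P) 0 n"
      by (rule jet_cong) simp
    also have "\<dots> = jet (\<lambda>P. pdx u P + g (snd P)) 0 n + jet ?H 0 n"
      by (rule jet_add; intro uCk_mono[OF _ n'] uCk_add[OF open_Q] ux G H)
    also have "jet (\<lambda>P. pdx u P + g (snd P)) 0 n = jet (pdx u) 0 n + jet (\<lambda>P. g (snd P)) 0 n"
      by (rule jet_add; intro uCk_mono[OF _ n'] ux G)
    also have "jet (pdx u) 0 n = jet u (Suc 0) n"
      by (rule jet_pdx[OF uCk_mono[OF u]]) (use n in simp)
    finally have "jet u 1 n = jet (\<lambda>P. \<alpha> (snd P) * u P) 0 n - jet (\<lambda>P. g (snd P)) 0 n"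
      using H0[OF n] by simp
    also have "jet (\<lambda>P. \<alpha> (snd P) * u P) 0 n = leib (jet (\<lambda>P. \<alpha> (snd P))) (jet u) 0 n"
      by (rule jet_mult; intro uCk_mono[OF _ n'] A u5)
    also have "\<dots> = (\<Sum>i=0..n. real (n choose i) * cext {y0<..<b} ((deriv ^^ (n - i)) \<alpha>) y0 * jet u 0 i)"
    proof -
      have "jet (\<lambda>P. \<alpha> (snd P)) 0 (n - i) = cext {y0<..<b} ((deriv ^^ (n - i)) \<alpha>) y0" for i
        by (rule jet_snd[OF uCk1_mono[OF al] b]) (use n in simp)
      then show ?thesis by (simp add: leib_def mult.assoc)
    qed
    also have "jet (\<lambda>P. g (snd P)) 0 n = cext {y0<..<b} ((deriv ^^ n) g) y0"
      by (rule jet_snd[OF uCk1_mono[OF g n] b])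
    finally show "jet u 1 n = (\<Sum>i=0..n. real (n choose i) * cext {y0<..<b} ((deriv ^^ (n - i)) \<alpha>) y0 * jet u 0 i)
        - cext {y0<..<b} ((deriv ^^ n) g) y0" .
  qed
qed

text \<open>Mirror image of the left edge, except that the normal derivative is now the innermost
  one in \<open>pd\<close> and is peeled off directly.\<close>

lemma bc_jet_bottom:
  assumes u: "uCk 7 Q u" and be: "uCk1 5 {x0<..<b} \<beta>" and g: "uCk1 5 {x0<..<b} g" and b: "x0 + e \<le> b"
    and bc: "\<And>x. x \<in> {x0<..<x0+e} \<Longrightarrow> - cext Q (pdy u) (x, y0) + \<beta> x * cext Q u (x, y0) = g x"
  shows "bc_jet (\<lambda>n. cext {x0<..<b} ((deriv ^^ n) \<beta>) x0) (\<lambda>n. cext {x0<..<b} ((deriv ^^ n) g) x0)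
     (\<lambda>m n. jet u n m)"
proof -
  have u': "uCk (Suc 6) Q u" using u by (simp only: eval_nat_numeral BitM.simps)
  have fst: "fst P \<in> {x0<..<b}" if "P \<in> Q" for P using that b by (auto simp: Q_def)
  have A: "uCk 5 Q (\<lambda>P. \<beta> (fst P))" by (rule uCk_fst[OF be fst])
  have G: "uCk 5 Q (\<lambda>P. g (fst P))" by (rule uCk_fst[OF g fst])
  have uy: "uCk 5 Q (pdy u)" by (rule uCk_mono[OF uCk_pdy[OF u']]) simp
  have u5: "uCk 5 Q u" by (rule uCk_mono[OF u]) simp
  let ?H = "\<lambda>P. \<beta> (fst P) * u P + - (pdy u P + g (fst P))"
  have H: "uCk 5 Q ?H"
    by (intro uCk_add[OF open_Q] uCk_mult[OF open_Q bounded_Q] uCk_uminus[OF open_Q bounded_Q] A G uy u5)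
  have "bottom_zero ?H"
    unfolding bottom_zero_def
  proof
    fix x assume x: "x \<in> {x0<..<x0+e}"
    have "((\<lambda>y. ?H (x, y)) \<longlongrightarrow> \<beta> (fst (x, y0)) * cext Q u (x, y0) + - (cext Q (pdy u) (x, y0) + g (fst (x, y0)))) (at_right y0)"
      unfolding fst_conv
      by (intro tendsto_add tendsto_mult tendsto_minus tendsto_const
          cext_bottom_tendsto[OF uCk_uniformly_continuous[OF u] x] cext_bottom_tendsto[OF uCk_uniformly_continuous[OF uy] x])
    moreover have "\<beta> (fst (x, y0)) * cext Q u (x, y0) + - (cext Q (pdy u) (x, y0) + g (fst (x, y0))) = 0"
      using bc[OF x] by simp
    ultimately show "((\<lambda>y. ?H (x, y)) \<longlongrightarrow> 0) (at_right y0)" by (simp only:)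
  qed
  then have H0: "jet ?H n 0 = 0" if "n \<le> 5" for n
    by (intro bottom_zero_jet uCk_mono[OF H that])
  show ?thesis
    unfolding bc_jet_def
  proof (intro allI impI)
    fix n :: nat assume n: "n \<le> 5"
    have n': "n + 0 \<le> 5" using n by simp
    have "jet (\<lambda>P. \<beta> (fst P) * u P) n 0 = jet (\<lambda>P. pdy u P + g (fst P) + ?H P) n 0"
      by (rule jet_cong) simp
    also have "\<dots> = jet (\<lambda>P. pdy u P + g (fst P)) n 0 + jet ?H n 0"
      by (rule jet_add; intro uCk_mono[OF _ n'] uCk_add[OF open_Q] uy G H)
    also have "jet (\<lambda>P. pdy u P + g (fst P)) n 0 = jet (pdy u) n 0 + jet (\<lambda>P. g (fst P)) n 0"
      by (rule jet_add; intro uCk_mono[OF _ n'] uy G)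
    also have "jet (pdy u) n 0 = jet u n (Suc 0)"
      by (rule jet_Suc_y[symmetric])
    finally have "jet u n 1 = jet (\<lambda>P. \<beta> (fst P) * u P) n 0 - jet (\<lambda>P. g (fst P)) n 0"
      using H0[OF n] by simp
    also have "jet (\<lambda>P. \<beta> (fst P) * u P) n 0 = leib (jet (\<lambda>P. \<beta> (fst P))) (jet u) n 0"
      by (rule jet_mult; intro uCk_mono[OF _ n'] A u5)
    also have "\<dots> = (\<Sum>i=0..n. real (n choose i) * cext {x0<..<b} ((deriv ^^ (n - i)) \<beta>) x0 * jet u i 0)"
    proof -
      have "jet (\<lambda>P. \<beta> (fst P)) (n - i) 0 = cext {x0<..<b} ((deriv ^^ (n - i)) \<beta>) x0" for i
        by (rule jet_fst[OF uCk1_mono[OF be] b]) (use n in simp)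
      then show ?thesis by (simp add: leib_def mult.assoc)
    qed
    also have "jet (\<lambda>P. g (fst P)) n 0 = cext {x0<..<b} ((deriv ^^ n) g) x0"
      by (rule jet_fst[OF uCk1_mono[OF g n] b])
    finally show "jet u n 1 = (\<Sum>i=0..n. real (n choose i) * cext {x0<..<b} ((deriv ^^ (n - i)) \<beta>) x0 * jet u i 0)
        - cext {x0<..<b} ((deriv ^^ n) g) x0" .
  qed
qed

text \<open>The residual has two parts: the Taylor error of \<open>u\<close> at the four nodes,
  weighted by bounded polynomials, and the left-hand sides of the linear system. Each is of order
  seven before \<open>inverse h\<close> takes one order away.\<close>

lemma consistency:
  assumes pde: "pde_jet A B R F (jet u)" and bc1: "bc_jet al g1 (jet u)"
    and bc3: "bc_jet be g3 (\<lambda>m n. jet u n m)" and u: "uCk 7 Q u" and sys: "corner_system A B al be ch ct"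
  shows "(\<lambda>h. inverse h * (\<Sum>k=0..1. \<Sum>l=0..1. Ckl ch ct k l h * cext Q u (x0 + real k * h, y0 + real l * h))
             - ((\<Sum>(m, n)\<in>Lam 4. F m n * Jf A B R be ch ct m n h)
                + (\<Sum>n=0..5. g1 n * Jg1 A B be ch ct n h)
                + (\<Sum>m=0..5. g3 m * Jg3 A B ct m h)))
          \<in> O[at_right 0](\<lambda>h. h ^ 6)"
proof -
  let ?S = "\<lambda>n h. \<Sum>k=0..1. \<Sum>l=0..1. Cpol ch k l h * En A B al n (real k * h) (real l * h)
     + Cpol ct k l h * (\<Sum>m=0..6. pmn A B al m n * Ent A B be m (real k * h) (real l * h))"
  let ?T = "\<lambda>k l h. cext Q u (x0 + real k * h, y0 + real l * h) - taylor6 (jet u) (real k * h) (real l * h)"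
  let ?Z = "\<lambda>h. \<Sum>k=0..1. \<Sum>l=0..1. Ckl ch ct k l h * ?T k l h"
  let ?Y = "\<lambda>h. \<Sum>n=0..6. jet u 0 n * ?S n h"
  have 0: "inverse h * (\<Sum>k=0..1. \<Sum>l=0..1. Ckl ch ct k l h * cext Q u (x0 + real k * h, y0 + real l * h))
      = inverse h * ?Z h + inverse h * (\<Sum>k=0..1. \<Sum>l=0..1. Ckl ch ct k l h * taylor6 (jet u) (real k * h) (real l * h))" for h
    unfolding right_diff_distrib sum_subtractf by (simp only: right_diff_distrib diff_add_cancel)
  have res: "inverse h * (\<Sum>k=0..1. \<Sum>l=0..1. Ckl ch ct k l h * cext Q u (x0 + real k * h, y0 + real l * h))
             - ((\<Sum>(m, n)\<in>Lam 4. F m n * Jf A B R be ch ct m n h)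
                + (\<Sum>n=0..5. g1 n * Jg1 A B be ch ct n h)
                + (\<Sum>m=0..5. g3 m * Jg3 A B ct m h))
      = inverse h * ?Z h + inverse h * ?Y h" for h
    using scheme_residual[OF pde bc1 bc3, of h ch ct] 0[of h] by linarith
  have "(\<lambda>h. jet u 0 n * ?S n h) \<in> O[at_right 0](\<lambda>h. h ^ 7)" if "n \<in> {0..6}" for n
  proof -
    have "n \<le> 6" using that by simp
    then have "?S n \<in> O[at_right 0](\<lambda>h. h ^ 7)"
      using sys unfolding corner_system_def by (intro poly_O7_bigo) blast
    from landau_o.big.mult[OF tendsto_bigo_1[OF tendsto_const] this] show ?thesis
      unfolding mult_1 .
  qed
  then have Y: "?Y \<in> O[at_right 0](\<lambda>h. h ^ 7)" by (rule big_sum_in_bigo)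
  obtain M where M: "\<And>a b h. 0 \<le> a \<Longrightarrow> a \<le> h \<Longrightarrow> 0 \<le> b \<Longrightarrow> b \<le> h \<Longrightarrow> h < e \<Longrightarrow>
    \<bar>cext Q u (x0 + a, y0 + b) - taylor6 (jet u) a b\<bar> \<le> M * h ^ 7"
    using cext_taylor[OF u] by blast
  have "(\<lambda>h. Ckl ch ct k l h * ?T k l h) \<in> O[at_right 0](\<lambda>h. h ^ 7)" if "k \<le> 1" "l \<le> 1" for k l
  proof -
    have "(Ckl ch ct k l \<longlongrightarrow> Ckl ch ct k l 0) (at_right 0)"
      unfolding Ckl_def Cpol_def by (intro tendsto_intros)
    then have C: "Ckl ch ct k l \<in> O[at_right 0](\<lambda>_. 1)" by (rule tendsto_bigo_1)
    have "\<forall>\<^sub>F h in at_right 0. h \<in> {0<..<e}" using e_pos by (intro eventually_at_right_real)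
    then have "\<forall>\<^sub>F h in at_right 0. norm (?T k l h) \<le> M * norm (h ^ 7)"
    proof eventually_elim
      case (elim h)
      have "real k * h \<le> 1 * h" "real l * h \<le> 1 * h"
        using that elim by (intro mult_right_mono; simp)+
      then have "\<bar>?T k l h\<bar> \<le> M * h ^ 7" using elim by (intro M) simp_all
      then show ?case using elim by simp
    qed
    then have "?T k l \<in> O[at_right 0](\<lambda>h. h ^ 7)" by (rule bigoI)
    from landau_o.big.mult[OF C this] show ?thesis by simp
  qed
  then have Z: "?Z \<in> O[at_right 0](\<lambda>h. h ^ 7)" by (intro big_sum_in_bigo) auto
  show ?thesis
    unfolding res by (intro sum_in_bigo inverse_mult_bigo Y Z)
qed

end

section \<open>Localisation at the corner and assembly of the results\<close>

theorem theoremA2: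
  fixes l1 l2 l3 l4 :: real and N0 :: nat
    and \<Omega> \<Gamma> S :: "(real \<times> real) set"
    and a u f :: "real \<times> real \<Rightarrow> real"
    and \<alpha> \<beta> g1 g3 :: "real \<Rightarrow> real"
    and A B R F :: "nat \<Rightarrow> nat \<Rightarrow> real"
    and al be g1d g3d :: "nat \<Rightarrow> real"
  assumes "l1 < l2" and "l3 < l4" and "N0 \<ge> 1" and "l4 - l3 = real N0 * (l2 - l1)"
    and "\<Omega> = {l1<..<l2} \<times> {l3<..<l4}"
    and "interface_curve \<Omega> \<Gamma>"
    and regularity: "\<forall>T\<in>sides \<Omega> \<Gamma>. uCk 6 T a \<and> uCk 7 T u \<and> uCk 5 T f"
    and "uCk1 5 {l3<..<l4} \<alpha>" and "uCk1 5 {l3<..<l4} g1"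
    and "uCk1 5 {l1<..<l2} \<beta>" and "uCk1 5 {l1<..<l2} g3"
    and a_pos: "\<forall>P\<in>\<Omega> - \<Gamma>. a P > 0"
    and pde: "\<forall>P\<in>\<Omega> - \<Gamma>. - (pdx (\<lambda>Q. a Q * pdx u Q) P + pdy (\<lambda>Q. a Q * pdy u Q) P) = f P"
    and bc1: "\<forall>T\<in>sides \<Omega> \<Gamma>. \<forall>y\<in>{l3<..<l4}. on_side \<Omega> T (l1, y) \<longrightarrow>
       - cext T (pdx u) (l1, y) + \<alpha> y * cext T u (l1, y) = g1 y"
    and bc3: "\<forall>T\<in>sides \<Omega> \<Gamma>. \<forall>x\<in>{l1<..<l2}. on_side \<Omega> T (x, l3) \<longrightarrow>
       - cext T (pdy u) (x, l3) + \<beta> x * cext T u (x, l3) = g3 x"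
    and side: "S \<in> sides \<Omega> \<Gamma>"
    and stencil: "\<forall>\<^sub>F h in at_right 0. \<forall>k\<in>{0, 1}. \<forall>l\<in>{0, 1}.
       on_side \<Omega> S (l1 + real k * h, l3 + real l * h)"
    and a_pos_corner: "cext S a (l1, l3) > 0"
    and "A = (\<lambda>m n. cext S (pd m n (\<lambda>P. pdx a P / a P)) (l1, l3))"
    and "B = (\<lambda>m n. cext S (pd m n (\<lambda>P. pdy a P / a P)) (l1, l3))"
    and "R = (\<lambda>m n. cext S (pd m n (\<lambda>P. 1 / a P)) (l1, l3))"
    and "F = (\<lambda>m n. cext S (pd m n f) (l1, l3))"
    and "al = (\<lambda>n. cext {l3<..<l4} ((deriv ^^ n) \<alpha>) l3)"
    and "g1d = (\<lambda>n. cext {l3<..<l4} ((deriv ^^ n) g1) l3)"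
    and "be = (\<lambda>m. cext {l1<..<l2} ((deriv ^^ m) \<beta>) l1)"
    and "g3d = (\<lambda>m. cext {l1<..<l2} ((deriv ^^ m) g3) l1)"
  shows
    "(\<forall>ch ct. corner_system A B al be ch ct \<and> nontrivial ch ct \<longrightarrow>
        (\<lambda>h. inverse h * (\<Sum>k=0..1. \<Sum>l=0..1.
                 Ckl ch ct k l h * cext S u (l1 + real k * h, l3 + real l * h))
             - ((\<Sum>(m, n)\<in>Lam 4. F m n * Jf A B R be ch ct m n h)
                + (\<Sum>n=0..5. g1d n * Jg1 A B be ch ct n h)
                + (\<Sum>m=0..5. g3d m * Jg3 A B ct m h)))
          \<in> O[at_right 0](\<lambda>h. h ^ 6))
   \<and> (\<exists>ch ct. corner_system A B al be ch ct \<and> nontrivial ch ct)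
   \<and> (\<forall>ch ct. corner_system A B al be ch ct \<and> nontrivial ch ct
          \<and> (\<forall>\<^sub>F h in at_right 0. Ckl ch ct 0 0 h > 0)
          \<and> (\<forall>p\<le>6. (\<Sum>k=0..1. \<Sum>l=0..1. ch k l p + ct k l p) \<ge> 0) \<longrightarrow>
        al 0 + be 0 \<ge> 0)
   \<and> (al 0 + be 0 \<ge> 0 \<longrightarrow>
        (\<exists>ch ct. corner_system A B al be ch ct \<and> nontrivial ch ct
          \<and> (\<forall>h>0. sign_condition ch ct h)
          \<and> (al 0 + be 0 > 0
              \<or> (\<exists>ch' ct'. corner_system A B al be ch' ct' \<and> nontrivial ch' ct'
                    \<and> (\<forall>\<^sub>F h in at_right 0. Ckl ch' ct' 0 0 h > 0 \<and> sum_condition ch' ct' h))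
              \<longrightarrow> (\<forall>h>0. sum_condition ch ct h))))"
proof -
  have ab: "l1 < l2" "l3 < l4" by fact+
  have \<Omega>: "\<Omega> = {l1<..<l2} \<times> {l3<..<l4}" by fact
  have al5: "uCk1 5 {l3<..<l4} \<alpha>" and g15: "uCk1 5 {l3<..<l4} g1"
    and be5: "uCk1 5 {l1<..<l2} \<beta>" and g35: "uCk1 5 {l1<..<l2} g3" by fact+
  have S: "S \<subseteq> \<Omega> - \<Gamma>" using side unfolding sides_def by (rule in_components_subset)
  have reg: "uCk 6 S a" "uCk 7 S u" "uCk 5 S f" using regularity side by blast+
  have in_S: "\<forall>x y. (x, y) \<in> S \<longrightarrow> l1 < x \<and> l3 < y" using S \<Omega> by auto
  \<comment> \<open>The node \<open>k = l = 0\<close> is the corner for every \<open>h\<close>, so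
    one admissible \<open>h\<close> shows that the corner lies on the side \<open>S\<close>.\<close>
  obtain h where "on_side \<Omega> S (l1 + real 0 * h, l3 + real 0 * h)"
    using eventually_happens'[OF trivial_limit_at_right_real stencil] by blast
  then obtain \<epsilon> where \<epsilon>: "\<epsilon> > 0" "ball (l1, l3) \<epsilon> \<inter> \<Omega> \<subseteq> S" unfolding on_side_def by auto
  \<comment> \<open>Half of \<open>\<epsilon>\<close> because the distance to the corner is
    estimated by the sum of the coordinate differences; the other terms keep the square in the
    domain.\<close>
  define e1 where "e1 = min (\<epsilon> / 2) (min (l2 - l1) (l4 - l3))"
  have e1: "e1 > 0" "e1 \<le> \<epsilon> / 2" "l1 + e1 \<le> l2" "l3 + e1 \<le> l4" using \<epsilon>(1) ab by (auto simp: e1_def min_def)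
  have box_S: "{l1<..<l1+r} \<times> {l3<..<l3+r} \<subseteq> S" if "r \<le> e1" for r
  proof
    fix P assume "P \<in> {l1<..<l1+r} \<times> {l3<..<l3+r}"
    then obtain x y where P: "P = (x, y)" "l1 < x" "x < l1 + r" "l3 < y" "y < l3 + r" by auto
    have "dist (l1, l3) P < \<epsilon>" unfolding P(1) using dist_pair_le[of l1 l3 x y] P that e1 by linarith
    moreover have "P \<in> \<Omega>" unfolding P(1) \<Omega> using P that e1 by simp
    ultimately show "P \<in> S" using \<epsilon>(2) by auto
  qed
  interpret b1: corner_box l1 l3 e1 by unfold_locales (rule e1(1))
  have b1S: "b1.Q \<subseteq> S" unfolding b1.Q_def by (rule box_S) simp
  \<comment> \<open>Positivity of \<open>a\<close> inside does not bound it away from zero; half of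
    its positive limit at the corner does so on a smaller square.\<close>
  let ?c = "cext S a (l1, l3) / 2"
  have c: "?c > 0" using a_pos_corner by simp
  have "cext S a (l1, l3) = cext b1.Q a (l1, l3)"
    unfolding cext_def b1.at_within_side[OF b1S in_S b1.corner_in_Qc] ..
  then have "(a \<longlongrightarrow> cext S a (l1, l3)) (at (l1, l3) within b1.Q)"
    using b1.cext_tendsto[OF uCk_uniformly_continuous[OF uCk_subset[OF reg(1) b1S]] b1.corner_in_Qc] by simp
  then have "\<forall>\<^sub>F P in at (l1, l3) within b1.Q. dist (a P) (cext S a (l1, l3)) < ?c"
    using c by (rule tendstoD)
  then obtain d where d: "d > 0" "\<And>P. P \<in> b1.Q \<Longrightarrow> P \<noteq> (l1, l3) \<Longrightarrow> dist P (l1, l3) < d \<Longrightarrow>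
      dist (a P) (cext S a (l1, l3)) < ?c"
    unfolding eventually_at by blast
  \<comment> \<open>Halved again for the sum of coordinate differences, now for the neighbourhood in
    which \<open>a\<close> is close to its limit.\<close>
  define e where "e = min e1 (d / 2)"
  have e: "e > 0" "e \<le> e1" "e \<le> d / 2" using e1 d(1) by (auto simp: e_def)
  interpret b: corner_box l1 l3 e by unfold_locales (rule e(1))
  have QS: "b.Q \<subseteq> S" unfolding b.Q_def by (rule box_S[OF e(2)])
  have Q\<Omega>: "P \<in> \<Omega> - \<Gamma>" if "P \<in> b.Q" for P using that QS S by blast
  have a_low: "?c \<le> a P" if PQ: "P \<in> b.Q" for P
  proof -
    obtain x y where P: "P = (x, y)" "l1 < x" "x < l1 + e" "l3 < y" "y < l3 + e"
      using PQ unfolding b.Q_def by auto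
    have "P \<in> b1.Q" unfolding P(1) b1.mem_Q using P e by linarith
    moreover have "dist P (l1, l3) < d" unfolding P(1) using dist_pair_le[of x y l1 l3] P e by linarith
    ultimately have "dist (a P) (cext S a (l1, l3)) < ?c" using P by (intro d(2)) auto
    then show ?thesis unfolding dist_real_def by linarith
  qed
  note within = b.at_within_side[OF QS in_S]
  have ext: "cext S G P = cext b.Q G P" if "P \<in> b.Qc" for G P
    unfolding cext_def within[OF that] ..
  have jets: "A = b.jet (\<lambda>P. pdx a P / a P)" "B = b.jet (\<lambda>P. pdy a P / a P)"
    "R = b.jet (\<lambda>P. 1 / a P)" "F = b.jet f"
    using assms ext[OF b.corner_in_Qc] by (auto simp: b.jet_def[abs_def])
  have u: "uCk 7 b.Q u" by (rule uCk_subset[OF reg(2) QS])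
  have pde_jet: "pde_jet A B R F (b.jet u)"
    unfolding jets
  proof (rule b.pde_jet_of_solution[OF uCk_subset[OF reg(1) QS] u uCk_subset[OF reg(3) QS] c a_low])
    fix P assume "P \<in> b.Q"
    then show "- (pdx (\<lambda>P. a P * pdx u P) P + pdy (\<lambda>P. a P * pdy u P) P) = f P"
      using pde Q\<Omega> by blast
  qed
  have e2: "l3 + e \<le> l4" "l1 + e \<le> l2" using e e1 by linarith+
  have clos: "closure \<Omega> = {l1..l2} \<times> {l3..l4}" unfolding \<Omega> closure_Times using ab by simp
  have on_left: "on_side \<Omega> S (l1, y)" if y: "y \<in> {l3<..<l3+e}" for y
    unfolding on_side_def clos
  proof
    show "(l1, y) \<in> {l1..l2} \<times> {l3..l4}" using y e2 ab by simp
    \<comment> \<open>This radius keeps the part of the ball inside the domain within the square,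
      hence within \<open>S\<close>.\<close>
    define r where "r = min e (min (y - l3) (l3 + e - y))"
    have r: "r > 0" "r \<le> e" "r \<le> y - l3" "r \<le> l3 + e - y" using y e by (auto simp: r_def)
    have "ball (l1, y) r \<inter> \<Omega> \<subseteq> S"
    proof
      fix P assume P: "P \<in> ball (l1, y) r \<inter> \<Omega>"
      have "dist l1 (fst P) < r" "dist y (snd P) < r"
        using P dist_fst_le[of "(l1, y)" P] dist_snd_le[of "(l1, y)" P] by auto
      moreover have "l1 < fst P" using P \<Omega> by auto
      ultimately have "(fst P, snd P) \<in> b.Q" unfolding b.mem_Q dist_real_def using r by linarith
      then show "P \<in> S" using QS by auto
    qed
    then show "\<exists>\<epsilon>>0. ball (l1, y) \<epsilon> \<inter> \<Omega> \<subseteq> S" using r(1) by blast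
  qed
  have on_bottom: "on_side \<Omega> S (x, l3)" if x: "x \<in> {l1<..<l1+e}" for x
    unfolding on_side_def clos
  proof
    show "(x, l3) \<in> {l1..l2} \<times> {l3..l4}" using x e2 ab by simp
    define r where "r = min e (min (x - l1) (l1 + e - x))"
    have r: "r > 0" "r \<le> e" "r \<le> x - l1" "r \<le> l1 + e - x" using x e by (auto simp: r_def)
    have "ball (x, l3) r \<inter> \<Omega> \<subseteq> S"
    proof
      fix P assume P: "P \<in> ball (x, l3) r \<inter> \<Omega>"
      have "dist x (fst P) < r" "dist l3 (snd P) < r"
        using P dist_fst_le[of "(x, l3)" P] dist_snd_le[of "(x, l3)" P] by auto
      moreover have "l3 < snd P" using P \<Omega> by auto
      ultimately have "(fst P, snd P) \<in> b.Q" unfolding b.mem_Q dist_real_def using r by linarith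
      then show "P \<in> S" using QS by auto
    qed
    then show "\<exists>\<epsilon>>0. ball (x, l3) \<epsilon> \<inter> \<Omega> \<subseteq> S" using r(1) by blast
  qed
  have bc_left: "bc_jet al g1d (b.jet u)"
    unfolding \<open>al = _\<close> \<open>g1d = _\<close>
  proof (rule b.bc_jet_left[OF u al5 g15 e2(1)])
    fix y assume y: "y \<in> {l3<..<l3+e}"
    have "(l1, y) \<in> b.Qc" using y e by (simp add: b.mem_Qc)
    moreover have "y \<in> {l3<..<l4}" using y e2 by simp
    then have "- cext S (pdx u) (l1, y) + \<alpha> y * cext S u (l1, y) = g1 y"
      using bc1 side on_left[OF y] by blast
    ultimately show "- cext b.Q (pdx u) (l1, y) + \<alpha> y * cext b.Q u (l1, y) = g1 y"
      by (simp only: ext)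
  qed
  have bc_bottom: "bc_jet be g3d (\<lambda>m n. b.jet u n m)"
    unfolding \<open>be = _\<close> \<open>g3d = _\<close>
  proof (rule b.bc_jet_bottom[OF u be5 g35 e2(2)])
    fix x assume x: "x \<in> {l1<..<l1+e}"
    have "(x, l3) \<in> b.Qc" using x e by (simp add: b.mem_Qc)
    moreover have "x \<in> {l1<..<l2}" using x e2 by simp
    then have "- cext S (pdy u) (x, l3) + \<beta> x * cext S u (x, l3) = g3 x"
      using bc3 side on_bottom[OF x] by blast
    ultimately show "- cext b.Q (pdy u) (x, l3) + \<beta> x * cext b.Q u (x, l3) = g3 x"
      by (simp only: ext)
  qed
  have consistent: "(\<lambda>h. inverse h * (\<Sum>k=0..1. \<Sum>l=0..1.
                 Ckl ch ct k l h * cext S u (l1 + real k * h, l3 + real l * h))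
             - ((\<Sum>(m, n)\<in>Lam 4. F m n * Jf A B R be ch ct m n h)
                + (\<Sum>n=0..5. g1d n * Jg1 A B be ch ct n h)
                + (\<Sum>m=0..5. g3d m * Jg3 A B ct m h)))
          \<in> O[at_right 0](\<lambda>h. h ^ 6)" if "corner_system A B al be ch ct" for ch ct
  proof -
    \<comment> \<open>For \<open>h < e\<close> all four nodes lie in \<open>Qc\<close>, where the
      extensions from \<open>S\<close> and from the square agree.\<close>
    have "\<forall>\<^sub>F h in at_right 0. h \<in> {0<..<e}" using e(1) by (intro eventually_at_right_real)
    then have "\<forall>\<^sub>F h in at_right 0. inverse h * (\<Sum>k=0..1. \<Sum>l=0..1.
                 Ckl ch ct k l h * cext b.Q u (l1 + real k * h, l3 + real l * h))
             - ((\<Sum>(m, n)\<in>Lam 4. F m n * Jf A B R be ch ct m n h)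
                + (\<Sum>n=0..5. g1d n * Jg1 A B be ch ct n h)
                + (\<Sum>m=0..5. g3d m * Jg3 A B ct m h))
       = inverse h * (\<Sum>k=0..1. \<Sum>l=0..1.
                 Ckl ch ct k l h * cext S u (l1 + real k * h, l3 + real l * h))
             - ((\<Sum>(m, n)\<in>Lam 4. F m n * Jf A B R be ch ct m n h)
                + (\<Sum>n=0..5. g1d n * Jg1 A B be ch ct n h)
                + (\<Sum>m=0..5. g3d m * Jg3 A B ct m h))"
    proof eventually_elim
      case (elim h)
      have "cext b.Q u (l1 + real k * h, l3 + real l * h) = cext S u (l1 + real k * h, l3 + real l * h)"
        if "k \<in> {0..1}" "l \<in> {0..1}" for k l
      proof (rule ext[symmetric])
        have "k = 0 \<or> k = 1" "l = 0 \<or> l = 1" using that by auto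
        then show "(l1 + real k * h, l3 + real l * h) \<in> b.Qc"
          unfolding b.mem_Qc using elim by auto
      qed
      then have "(\<Sum>k=0..1. \<Sum>l=0..1. Ckl ch ct k l h * cext b.Q u (l1 + real k * h, l3 + real l * h))
        = (\<Sum>k=0..1. \<Sum>l=0..1. Ckl ch ct k l h * cext S u (l1 + real k * h, l3 + real l * h))"
        by (intro sum.cong refl) simp
      then show ?case by simp
    qed
    from landau_o.big.in_cong[OF this] show ?thesis
      using b.consistency[OF pde_jet bc_left bc_bottom u that] by simp
  qed
  have solvable: "\<exists>ch ct. corner_system A B al be ch ct \<and> nontrivial ch ct"
    using good_scheme_exists[of A B al be] by blast
  show ?thesis
  proof (intro conjI allI impI)
    show "al 0 + be 0 \<ge> 0" if "corner_system A B al be ch ct \<and> nontrivial ch ct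
          \<and> (\<forall>\<^sub>F h in at_right 0. Ckl ch ct 0 0 h > 0)
          \<and> (\<forall>p\<le>6. (\<Sum>k=0..1. \<Sum>l=0..1. ch k l p + ct k l p) \<ge> 0)" for ch ct
      using that by (elim conjE) (rule necessary_sign)
  qed (use consistent in \<open>elim conjE, blast\<close>, rule solvable, rule good_scheme_exists)
qed

end
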